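(* Let $\mathbf{R}=k[x_1,\dots,x_d]$ be a polynomial ring over a field $k$ and let $I=(f_1,\dots,f_d,f_{d+1})$ be an ideal generated by forms of degree $n$. If $J=(f_1,\dots,f_d)$ is a complete intersection, then, with $\mathbf{S}=\operatorname{Sym}(I)$, $$\deg \mathbf{S}=\sum_{j=0}^{d-1}n^j+\lambda(\mathbf{R}/(J:I)).$$
   Context: $\lambda$ denotes length. $\operatorname{Sym}(I)$ is the symmetric algebra of $I$, a quotient of $\mathbf{B}=\mathbf{R}[\mathbf{T}_1,\dots,\mathbf{T}_{d+1}]$ via $\mathbf{T}_i\mapsto f_i$. For a finitely generated graded $\mathbf{B}$-module $A$, $\deg(A)$ is the multiplicity of $A$ relative to the maximal homogeneous ideal $\mathcal{M}=(x_1,\dots,x_d,\mathbf{T}_1,\dots,\mathbf{T}_{d+1})$, i.e. $\deg A=\deg(\operatorname{gr}_{\mathcal{M}}(A))$. $J$ is a complete intersection means $f_1,\dots,f_d$ is a regular sequence. *)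

theory Defs
  imports "HOL-Library.Poly_Mapping" "HOL-Library.Extended_Nat"
    "HOL-Computational_Algebra.Polynomial" "HOL-Algebra.Module" "HOL-Algebra.Ideal_Product" "HOL-Algebra.QuotRing"
begin

section \<open>Polynomial rings\<close>

text \<open>A polynomial in variables of type \<open>'v\<close> is a finitely supported map from exponent vectors to
  coefficients; the ring operations are those of the type. \<open>mpoly_ring K V\<close> is the subring of
  polynomials with coefficients in the subring \<open>K\<close> and variables in \<open>V\<close>.\<close>

definition mpoly_ring :: "'a::comm_ring_1 set \<Rightarrow> 'v set \<Rightarrow> (('v \<Rightarrow>\<^sub>0 nat) \<Rightarrow>\<^sub>0 'a) ring" where
  "mpoly_ring K V =
    \<lparr>carrier = {p. \<forall>m \<in> Poly_Mapping.keys p.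
        Poly_Mapping.lookup p m \<in> K \<and> Poly_Mapping.keys m \<subseteq> V},
     mult = (*), one = 1, zero = 0, add = (+)\<rparr>"

definition mVar :: "'v \<Rightarrow> (('v \<Rightarrow>\<^sub>0 nat) \<Rightarrow>\<^sub>0 'a::comm_ring_1)" where
  "mVar v = Poly_Mapping.single (Poly_Mapping.single v 1) 1"

definition mConst :: "'a::comm_ring_1 \<Rightarrow> (('v \<Rightarrow>\<^sub>0 nat) \<Rightarrow>\<^sub>0 'a)" where
  "mConst c = Poly_Mapping.single 0 c"

text \<open>Substitution of \<open>\<sigma> v\<close> for each variable \<open>v\<close>, fixing the coefficients.\<close>

definition msubst ::
  "('v \<Rightarrow> (('w \<Rightarrow>\<^sub>0 nat) \<Rightarrow>\<^sub>0 'a)) \<Rightarrow> (('v \<Rightarrow>\<^sub>0 nat) \<Rightarrow>\<^sub>0 'a::comm_ring_1) \<Rightarrow> (('w \<Rightarrow>\<^sub>0 nat) \<Rightarrow>\<^sub>0 'a)" where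
  "msubst \<sigma> p = (\<Sum>m \<in> Poly_Mapping.keys p.
     mConst (Poly_Mapping.lookup p m) *
     (\<Prod>v \<in> Poly_Mapping.keys m. \<sigma> v ^ Poly_Mapping.lookup m v))"

text \<open>The zero polynomial is a form of every degree.\<close>

definition is_form :: "nat \<Rightarrow> (('v \<Rightarrow>\<^sub>0 nat) \<Rightarrow>\<^sub>0 'a::comm_ring_1) \<Rightarrow> bool" where
  "is_form n p \<longleftrightarrow> (\<forall>m \<in> Poly_Mapping.keys p.
     (\<Sum>v \<in> Poly_Mapping.keys m. Poly_Mapping.lookup m v) = n)"


section \<open>Ideals\<close>

definition colon_ideal :: "('a, 'b) ring_scheme \<Rightarrow> 'a set \<Rightarrow> 'a set \<Rightarrow> 'a set" where
  "colon_ideal R J I = {r \<in> carrier R. \<forall>a \<in> I. r \<otimes>\<^bsub>R\<^esub> a \<in> J}"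

primrec ideal_pow :: "('a, 'b) ring_scheme \<Rightarrow> 'a set \<Rightarrow> nat \<Rightarrow> 'a set" where
  "ideal_pow R I 0 = carrier R"
| "ideal_pow R I (Suc i) = ideal_prod R I (ideal_pow R I i)"

text \<open>Each entry is a nonzerodivisor modulo the preceding ones, and the quotient by all of them
  is nonzero.\<close>

definition regular_sequence :: "('a, 'b) ring_scheme \<Rightarrow> 'a list \<Rightarrow> bool" where
  "regular_sequence R xs \<longleftrightarrow>
     set xs \<subseteq> carrier R \<and>
     (\<forall>i < length xs. \<forall>r \<in> carrier R.
        (xs ! i) \<otimes>\<^bsub>R\<^esub> r \<in> genideal R (set (take i xs)) \<longrightarrow> r \<in> genideal R (set (take i xs))) \<and>
     genideal R (set xs) \<noteq> carrier R"


section \<open>Modules\<close>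

text \<open>The ring \<open>S\<close> as a module over the source of the ring homomorphism \<open>h\<close>.\<close>

definition hom_module :: "('b, 'c) ring_scheme \<Rightarrow> ('a \<Rightarrow> 'b) \<Rightarrow> ('a, 'b) module" where
  "hom_module S h =
    \<lparr>carrier = carrier S, mult = mult S, one = one S, zero = zero S, add = add S,
     smult = (\<lambda>r x. h r \<otimes>\<^bsub>S\<^esub> x)\<rparr>"

text \<open>The fields \<open>mult\<close> and \<open>one\<close> of a module record play no role in the locale \<open>module\<close>.\<close>

definition quot_module :: "('a, 'b, 'c) module_scheme \<Rightarrow> 'b set \<Rightarrow> ('a, 'b set) module" where
  "quot_module A N =
    \<lparr>carrier = a_rcosets\<^bsub>A\<^esub> N, mult = undefined, one = undefined, zero = N, add = set_add A,
     smult = (\<lambda>r X. \<Union>x\<in>X. N +>\<^bsub>A\<^esub> (r \<odot>\<^bsub>A\<^esub> x))\<rparr>"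

text \<open>The submodule \<open>I A\<close>.\<close>

definition ideal_smult ::
  "('a, 'c) ring_scheme \<Rightarrow> 'a set \<Rightarrow> ('a, 'b, 'e) module_scheme \<Rightarrow> 'b set" where
  "ideal_smult R I A =
     \<Inter> {N. submodule N R A \<and> (\<forall>r \<in> I. \<forall>x \<in> carrier A. r \<odot>\<^bsub>A\<^esub> x \<in> N)}"

definition module_length ::
  "('a, 'c) ring_scheme \<Rightarrow> ('a, 'b, 'e) module_scheme \<Rightarrow> enat" where
  "module_length R A = Sup {enat l | l. \<exists>N :: nat \<Rightarrow> 'b set.
     (\<forall>i \<le> l. submodule (N i) R A) \<and> (\<forall>i < l. N i \<subset> N (Suc i))}"


section \<open>Multiplicity\<close>

text \<open>The graded component \<open>I\<^sup>i A / I\<^sup>i\<^sup>+\<^sup>1 A\<close> of the associated graded module.\<close>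

definition gr_component ::
  "('a, 'c) ring_scheme \<Rightarrow> 'a set \<Rightarrow> ('a, 'b) module \<Rightarrow> nat \<Rightarrow> ('a, 'b set) module" where
  "gr_component R I A i =
     quot_module (A\<lparr>carrier := ideal_smult R (ideal_pow R I i) A\<rparr>)
       (ideal_smult R (ideal_pow R I (Suc i)) A)"

text \<open>If \<open>gr\<^sub>I A\<close> has dimension \<open>D\<close>, the cumulative Hilbert function
  \<open>t \<mapsto> \<Sum>i\<le>t. \<lambda>(I\<^sup>i A / I\<^sup>i\<^sup>+\<^sup>1 A)\<close> agrees for large \<open>t\<close> with a polynomial of degree \<open>D\<close>
  and leading coefficient \<open>deg A / D!\<close>. For \<open>D \<ge> 1\<close> this is the usual normalisation
  \<open>deg A / (D - 1)!\<close> for the Hilbert polynomial itself; for \<open>D = 0\<close> it gives the length.\<close>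

definition module_deg ::
  "('a, 'c) ring_scheme \<Rightarrow> 'a set \<Rightarrow> ('a, 'b) module \<Rightarrow> nat" where
  "module_deg R I A = (THE e. \<exists>P :: real poly.
     (\<exists>t0. \<forall>t \<ge> t0. \<exists>h :: nat.
        (\<Sum>i\<le>t. module_length R (gr_component R I A i)) = enat h \<and> real h = poly P (real t)) \<and>
     real e = fact (Polynomial.degree P) * Polynomial.lead_coeff P)"


section \<open>The symmetric algebra of a module\<close>

text \<open>\<open>Sym A\<close> is the polynomial ring over \<open>R\<close> with one variable for each element of \<open>A\<close>, modulo the
  relations making the map from \<open>A\<close> to the variables \<open>R\<close>-linear. The operations of \<open>R\<close> must be
  those of its type.\<close>

definition sym_poly_ring ::
  "('a::comm_ring_1, 'c) ring_scheme \<Rightarrow> ('a, 'b, 'e) module_scheme \<Rightarrow> (('b \<Rightarrow>\<^sub>0 nat) \<Rightarrow>\<^sub>0 'a) ring" where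
  "sym_poly_ring R A = mpoly_ring (carrier R) (carrier A)"

definition sym_relations ::
  "('a::comm_ring_1, 'c) ring_scheme \<Rightarrow> ('a, 'b, 'e) module_scheme \<Rightarrow> (('b \<Rightarrow>\<^sub>0 nat) \<Rightarrow>\<^sub>0 'a) set" where
  "sym_relations R A = genideal (sym_poly_ring R A)
     ({mVar (x \<oplus>\<^bsub>A\<^esub> y) - mVar x - mVar y | x y. x \<in> carrier A \<and> y \<in> carrier A} \<union>
      {mVar (r \<odot>\<^bsub>A\<^esub> x) - mConst r * mVar x | r x. r \<in> carrier R \<and> x \<in> carrier A})"

definition sym_algebra ::
  "('a::comm_ring_1, 'c) ring_scheme \<Rightarrow> ('a, 'b, 'e) module_scheme \<Rightarrow> (('b \<Rightarrow>\<^sub>0 nat) \<Rightarrow>\<^sub>0 'a) set ring" where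
  "sym_algebra R A = sym_poly_ring R A Quot sym_relations R A"

definition ideal_module :: "('a, 'c) ring_scheme \<Rightarrow> 'a set \<Rightarrow> ('a, 'a) module" where
  "ideal_module R I = (hom_module R (\<lambda>r. r))\<lparr>carrier := I\<rparr>"

text \<open>\<open>Sym I\<close> as a module over \<open>R[T\<^sub>1, T\<^sub>2, \<dots>]\<close>, where \<open>T\<^sub>i\<close> acts as the class of \<open>f i \<in> I\<close>.\<close>

definition sym_ideal_module ::
  "('a::comm_ring_1, 'c) ring_scheme \<Rightarrow> 'a set \<Rightarrow> ('i \<Rightarrow> 'a) \<Rightarrow>
     (('i \<Rightarrow>\<^sub>0 nat) \<Rightarrow>\<^sub>0 'a, (('a \<Rightarrow>\<^sub>0 nat) \<Rightarrow>\<^sub>0 'a) set) module" where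
  "sym_ideal_module R I f =
     hom_module (sym_algebra R (ideal_module R I))
       (\<lambda>b. sym_relations R (ideal_module R I)
              +>\<^bsub>sym_poly_ring R (ideal_module R I)\<^esub> msubst (\<lambda>i. mVar (f i)) b)"

end

theory Submission
  imports Defs
begin

text \<open>
  The symmetric algebra is a standard graded quotient \<open>B/L\<close>, where \<open>L\<close> is generated by the linear
  syzygies of the forms, so its multiplicity is read off the lengths of \<open>B / (L + M\<^sup>t)\<close>. Adding the
  generators one at a time and filtering by the degree in the last variable \<open>T\<^sub>j\<^sub>+\<^sub>1\<close>, the leading
  coefficients of \<open>L\<close> form the extension of the colon ideal \<open>(f\<^sub>1, \<dots>, f\<^sub>j) : f\<^sub>j\<^sub>+\<^sub>1\<close>. For \<open>j < d\<close> this is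
  \<open>(f\<^sub>1, \<dots>, f\<^sub>j)\<close> by regularity and the step contributes \<open>n\<^sup>j\<close>; for \<open>j = d\<close> it is \<open>J : I\<close>, which has
  finite colength and contributes that colength. That nothing else occurs among the leading
  coefficients rests on \<open>f\<^sub>1, \<dots>, f\<^sub>j\<close> being of linear type: then the quotient is generated over the
  Rees algebra by \<open>T\<^sub>j\<^sub>+\<^sub>1\<close> subject to the multiples of \<open>T\<^sub>j\<^sub>+\<^sub>1 - f\<^sub>j\<^sub>+\<^sub>1 t\<close> by the colon ideal.
\<close>

section \<open>Lengths of chains of stable subgroups\<close>

text \<open>The multiplicity is defined by lengths over \<open>B\<close> of the components of the
  associated graded module, but the filtration by degree in the last variable consists of vector
  spaces only. Elements of positive degree kill each component, so its length over \<open>B\<close>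
  equals its length over the constants; the count is done with subgroups stable under constants, and
  \<open>len A K D\<close> measures D/K inside one type. The powers n^j arise since multiplication
  by f (j+1) shifts degrees by n: passing from R/J j to R/J (j+1) replaces the cumulative Hilbert
  function h(t) by h(t) - h(t - n), which lowers its degree by one and multiplies the leading term
  by n. The variables T 1, ..., T j raise the degree from d - j back to d, and summation over the
  powers of T (j+1) gives d + 1. All steps thus contribute in the same degree, while the starting
  term R, of degree d, drops out. For j = d the Hilbert function of R/J is eventually constant,
  which is where the finite colength comes from. Linear type is proved together with its consequence
  that forms vanishing at f 1, ..., f j have coefficients in J j; this makes f (j+1) regular modulo
  all powers of J j.\<close>

definition chain_len :: "('a set \<Rightarrow> bool) \<Rightarrow> enat" where
  "chain_len P = Sup {enat l | l. \<exists>N :: nat \<Rightarrow> 'a set. (\<forall>i \<le> l. P (N i)) \<and> (\<forall>i < l. N i \<subset> N (Suc i))}"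

lemma chain_len_upper:
  assumes "\<And>i. i \<le> l \<Longrightarrow> P (N i)" "\<And>i. i < l \<Longrightarrow> N i \<subset> N (Suc i)"
  shows "enat l \<le> chain_len P"
  unfolding chain_len_def by (rule Sup_upper) (use assms in blast)

lemma chain_len_least:
  assumes "\<And>l N. (\<And>i. i \<le> l \<Longrightarrow> P (N i)) \<Longrightarrow> (\<And>i. i < l \<Longrightarrow> N i \<subset> N (Suc i)) \<Longrightarrow> enat l \<le> b"
  shows "chain_len P \<le> b"
  unfolding chain_len_def by (rule Sup_least) (use assms in blast)

lemma chain_len_map_le:
  assumes "\<And>X. P X \<Longrightarrow> Q (g X)" "\<And>X Y. P X \<Longrightarrow> P Y \<Longrightarrow> X \<subset> Y \<Longrightarrow> g X \<subset> g Y"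
  shows "chain_len P \<le> chain_len Q"
proof (rule chain_len_least)
  fix l N assume "\<And>i. i \<le> l \<Longrightarrow> P (N i)" "\<And>i. i < l \<Longrightarrow> N i \<subset> N (Suc i)"
  then show "enat l \<le> chain_len Q"
    by (intro chain_len_upper[where N = "\<lambda>i. g (N i)"]) (simp_all add: assms)
qed

text \<open>A bounded set of \<open>enat\<close> values is finite, so its supremum is a maximum;
  \<open>P X\<close> supplies the chain of length zero that keeps the set nonempty.\<close>

lemma chain_len_attained:
  assumes "P X" "chain_len P = enat l"
  obtains N where "\<And>i. i \<le> l \<Longrightarrow> P (N i)" "\<And>i. i < l \<Longrightarrow> N i \<subset> N (Suc i)"
proof -
  define Q where "Q l \<longleftrightarrow> (\<exists>N :: nat \<Rightarrow> 'a set. (\<forall>i \<le> l. P (N i)) \<and> (\<forall>i < l. N i \<subset> N (Suc i)))" for l :: nat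
  have sup: "Sup (enat ` Collect Q) = enat l"
    using assms(2) unfolding chain_len_def Q_def[symmetric] image_Collect by simp
  have "Q 0" unfolding Q_def by (rule exI[of _ "\<lambda>_::nat. X"]) (simp add: assms(1))
  then have ne: "enat ` Collect Q \<noteq> {}" by blast
  have "finite (enat ` Collect Q)"
  proof (rule finite_enat_bounded)
    fix y assume "y \<in> enat ` Collect Q"
    then show "y \<le> enat l" unfolding sup[symmetric] by (rule Sup_upper)
  qed
  then have "enat l \<in> enat ` Collect Q"
    using ne Max_in[of "enat ` Collect Q"] sup unfolding Sup_enat_def by (metis (full_types))
  then have "Q l" by auto
  then show ?thesis using that unfolding Q_def by auto
qed

text \<open>Omitting repetitions leaves one step per jump. The last conjunct carries the induction:
  the next jump is appended above \<open>N m\<close>.\<close>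

lemma strict_subchain:
  fixes N :: "nat \<Rightarrow> 'a set"
  assumes "\<And>i. i < m \<Longrightarrow> N i \<subseteq> N (Suc i)"
  shows "\<exists>N'. (\<forall>i \<le> card {i. i < m \<and> N i \<noteq> N (Suc i)}. \<exists>j\<le>m. N' i = N j) \<and>
     (\<forall>i < card {i. i < m \<and> N i \<noteq> N (Suc i)}. N' i \<subset> N' (Suc i)) \<and>
     N' (card {i. i < m \<and> N i \<noteq> N (Suc i)}) = N m"
  using assms
proof (induction m)
  case 0
  then show ?case by (auto intro!: exI[of _ "\<lambda>_. N 0"])
next
  case (Suc m)
  let ?c = "card {i. i < m \<and> N i \<noteq> N (Suc i)}"
  obtain N' where N': "\<forall>i \<le> ?c. \<exists>j\<le>m. N' i = N j" "\<forall>i < ?c. N' i \<subset> N' (Suc i)" "N' ?c = N m"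
    using Suc.IH[OF Suc.prems[OF less_SucI]] by auto
  show ?case
  proof (cases "N m = N (Suc m)")
    case True
    then have "{i. i < Suc m \<and> N i \<noteq> N (Suc i)} = {i. i < m \<and> N i \<noteq> N (Suc i)}"
      by (auto simp: less_Suc_eq)
    then show ?thesis using N' True by (auto intro!: exI[of _ N'] le_SucI)
  next
    case False
    then have "{i. i < Suc m \<and> N i \<noteq> N (Suc i)} = insert m {i. i < m \<and> N i \<noteq> N (Suc i)}"
      by (auto simp: less_Suc_eq)
    then have c: "card {i. i < Suc m \<and> N i \<noteq> N (Suc i)} = Suc ?c" by simp
    have "N m \<subset> N (Suc m)" using Suc.prems[of m] False by auto
    then show ?thesis unfolding c using N'
      by (intro exI[of _ "N'(Suc ?c := N (Suc m))"]) (auto simp: le_Suc_eq less_Suc_eq)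
  qed
qed

lemma chain_len_weak_upper:
  assumes "\<And>i. i \<le> m \<Longrightarrow> P (N i)" "\<And>i. i < m \<Longrightarrow> N i \<subseteq> N (Suc i)"
  shows "enat (card {i. i < m \<and> N i \<noteq> N (Suc i)}) \<le> chain_len P"
proof -
  obtain N' where "\<forall>i \<le> card {i. i < m \<and> N i \<noteq> N (Suc i)}. \<exists>j\<le>m. N' i = N j"
     "\<forall>i < card {i. i < m \<and> N i \<noteq> N (Suc i)}. N' i \<subset> N' (Suc i)"
    using strict_subchain[of m N] assms(2) by blast
  moreover from this(1) assms(1) have "P (N' i)" if "i \<le> card {i. i < m \<and> N i \<noteq> N (Suc i)}" for i
    using that by force
  ultimately show ?thesis by (intro chain_len_upper[where N = N']) simp_all
qed

section \<open>Stable subgroups and the length of a quotient\<close>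

definition stable :: "('a::ab_group_add \<Rightarrow> 'a) set \<Rightarrow> 'a set \<Rightarrow> bool" where
  "stable A N \<longleftrightarrow> 0 \<in> N \<and> (\<forall>x\<in>N. \<forall>y\<in>N. x + y \<in> N) \<and> (\<forall>x\<in>N. - x \<in> N) \<and> (\<forall>h\<in>A. \<forall>x\<in>N. h x \<in> N)"

text \<open>The length of \<open>D/K\<close> over the operators \<open>A\<close>, without forming the quotient.\<close>

definition len :: "('a::ab_group_add \<Rightarrow> 'a) set \<Rightarrow> 'a set \<Rightarrow> 'a set \<Rightarrow> enat" where
  "len A K D = chain_len (\<lambda>N. stable A N \<and> K \<subseteq> N \<and> N \<subseteq> D)"

definition additive_ops :: "('a::ab_group_add \<Rightarrow> 'a) set \<Rightarrow> bool" where
  "additive_ops A \<longleftrightarrow> (\<forall>h\<in>A. \<forall>x y. h (x + y) = h x + h y)"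

definition set_sum :: "'a::ab_group_add set \<Rightarrow> 'a set \<Rightarrow> 'a set" where
  "set_sum X Y = {x + y | x y. x \<in> X \<and> y \<in> Y}"

lemma stableI:
  assumes "0 \<in> N" "\<And>x y. x \<in> N \<Longrightarrow> y \<in> N \<Longrightarrow> x + y \<in> N" "\<And>x. x \<in> N \<Longrightarrow> - x \<in> N"
    "\<And>h x. h \<in> A \<Longrightarrow> x \<in> N \<Longrightarrow> h x \<in> N"
  shows "stable A N"
  using assms by (auto simp: stable_def)

lemma stableD:
  assumes "stable A N"
  shows "0 \<in> N" "x \<in> N \<Longrightarrow> y \<in> N \<Longrightarrow> x + y \<in> N" "x \<in> N \<Longrightarrow> - x \<in> N"
    "h \<in> A \<Longrightarrow> x \<in> N \<Longrightarrow> h x \<in> N" "x \<in> N \<Longrightarrow> y \<in> N \<Longrightarrow> x - y \<in> N"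
  using assms unfolding stable_def by (auto simp: diff_conv_add_uminus simp del: add_uminus_conv_diff)

lemma stable_sum:
  assumes "stable A N" "\<And>i. i \<in> S \<Longrightarrow> g i \<in> N"
  shows "sum g S \<in> N"
  using assms by (induction S rule: infinite_finite_induct) (auto simp: stable_def)

lemma stable_subset: "stable A N \<Longrightarrow> A' \<subseteq> A \<Longrightarrow> stable A' N"
  by (auto simp: stable_def)

lemma stable_Int: "stable A X \<Longrightarrow> stable A Y \<Longrightarrow> stable A (X \<inter> Y)"
  by (auto simp: stable_def)

lemma stable_set_sum:
  assumes "additive_ops A" "stable A X" "stable A Y"
  shows "stable A (set_sum X Y)"
proof (rule stableI)
  show "0 \<in> set_sum X Y" using stableD(1)[OF assms(2)] stableD(1)[OF assms(3)]
    by (force simp: set_sum_def)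
next
  fix u v assume "u \<in> set_sum X Y" "v \<in> set_sum X Y"
  then obtain x y x' y' where "u = x + y" "v = x' + y'" "x \<in> X" "y \<in> Y" "x' \<in> X" "y' \<in> Y"
    by (auto simp: set_sum_def)
  moreover from this have "u + v = (x + x') + (y + y')" by simp
  ultimately show "u + v \<in> set_sum X Y"
    unfolding set_sum_def using assms stableD(2) by blast
next
  fix u assume "u \<in> set_sum X Y"
  then obtain x y where "u = x + y" "x \<in> X" "y \<in> Y" by (auto simp: set_sum_def)
  moreover from this have "- u = (- x) + (- y)" by simp
  ultimately show "- u \<in> set_sum X Y"
    unfolding set_sum_def using assms stableD(3) by blast
next
  fix u h assume h: "h \<in> A" and "u \<in> set_sum X Y"
  then obtain x y where "u = x + y" "x \<in> X" "y \<in> Y" by (auto simp: set_sum_def)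
  moreover from this have "h u = h x + h y" using h assms(1) by (auto simp: additive_ops_def)
  ultimately show "h u \<in> set_sum X Y"
    unfolding set_sum_def using assms stableD(4) h by blast
qed

lemma set_sum_upper1: "0 \<in> Y \<Longrightarrow> X \<subseteq> set_sum X Y"
  unfolding set_sum_def by force

lemma set_sum_upper2: "0 \<in> X \<Longrightarrow> Y \<subseteq> set_sum X Y"
  unfolding set_sum_def by force

lemma set_sum_least: "stable A D \<Longrightarrow> X \<subseteq> D \<Longrightarrow> Y \<subseteq> D \<Longrightarrow> set_sum X Y \<subseteq> D"
  unfolding set_sum_def by (auto intro!: stableD(2)[of A D])

lemma set_sum_absorb: "stable A D \<Longrightarrow> Y \<subseteq> D \<Longrightarrow> 0 \<in> Y \<Longrightarrow> set_sum D Y = D"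
  by (intro antisym set_sum_least[of A] set_sum_upper1) auto

lemma set_sum_mono: "X \<subseteq> X' \<Longrightarrow> set_sum X E \<subseteq> set_sum X' E"
  unfolding set_sum_def by blast

text \<open>The modular law. Contrapositively, a strict inclusion stays strict after intersecting
  with \<open>E\<close> or after adding \<open>E\<close>, so the jumps of a chain are counted by the
  jumps of its two traces.\<close>

lemma stable_modular:
  assumes "stable A X" "stable A X'" "stable A E" "X \<subseteq> X'" "X \<inter> E = X' \<inter> E" "set_sum X E = set_sum X' E"
  shows "X = X'"
proof -
  have "u \<in> X" if u: "u \<in> X'" for u
  proof -
    have "u \<in> set_sum X E" using u assms(6) set_sum_upper1[of E X'] stableD(1)[OF assms(3)] by auto
    then obtain x e where xe: "u = x + e" "x \<in> X" "e \<in> E" by (auto simp: set_sum_def)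
    then have "e = u - x" by simp
    then have "e \<in> X' \<inter> E" using xe u stableD(5)[OF assms(2), of u x] assms(4) by blast
    then show "u \<in> X" using xe assms(5) stableD(2)[OF assms(1)] by auto
  qed
  then show ?thesis using assms(4) by auto
qed

lemma len_mono:
  assumes "K \<subseteq> K'" "D' \<subseteq> D"
  shows "len A K' D' \<le> len A K D"
  unfolding len_def by (rule chain_len_map_le[of _ _ "\<lambda>x. x"]) (use assms in auto)

text \<open>For the upper bound, a chain in D/K is traced in E/K and in D/E, and by
  \<open>stable_modular\<close> each jump survives in at least one trace. For the lower bound,
  chains of maximal length in E/K and D/E are concatenated.\<close>

lemma len_add:
  assumes A: "additive_ops A" and st: "stable A K" "stable A E" "stable A D" and sub: "K \<subseteq> E" "E \<subseteq> D"
  shows "len A K D = len A K E + len A E D"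
proof (rule antisym)
  show "len A K D \<le> len A K E + len A E D"
    unfolding len_def[of A K D]
  proof (rule chain_len_least)
    fix l N assume N: "\<And>i. i \<le> l \<Longrightarrow> stable A (N i) \<and> K \<subseteq> N i \<and> N i \<subseteq> D"
      and lt: "\<And>i. i < l \<Longrightarrow> N i \<subset> N (Suc i)"
    let ?X = "\<lambda>i. N i \<inter> E" and ?Y = "\<lambda>i. set_sum (N i) E"
    have X: "enat (card {i. i < l \<and> ?X i \<noteq> ?X (Suc i)}) \<le> len A K E"
      unfolding len_def
    proof (rule chain_len_weak_upper)
      fix i assume "i \<le> l"
      then show "stable A (?X i) \<and> K \<subseteq> ?X i \<and> ?X i \<subseteq> E"
        using N[of i] stable_Int[OF _ st(2), of "N i"] sub by blast
    next
      fix i assume "i < l" then show "?X i \<subseteq> ?X (Suc i)" using lt by blast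
    qed
    have Y: "enat (card {i. i < l \<and> ?Y i \<noteq> ?Y (Suc i)}) \<le> len A E D"
      unfolding len_def
    proof (rule chain_len_weak_upper)
      fix i assume "i \<le> l"
      then show "stable A (?Y i) \<and> E \<subseteq> ?Y i \<and> ?Y i \<subseteq> D"
        using N[of i] set_sum_upper2[of "N i" E] stableD(1)[of A "N i"] set_sum_least[OF st(3), of "N i" E]
          stable_set_sum[OF A _ st(2), of "N i"] sub by blast
    next
      fix i assume "i < l" then show "?Y i \<subseteq> ?Y (Suc i)" using lt set_sum_mono by blast
    qed
    have "{i. i < l} \<subseteq> {i. i < l \<and> ?X i \<noteq> ?X (Suc i)} \<union> {i. i < l \<and> ?Y i \<noteq> ?Y (Suc i)}"
    proof
      fix i assume "i \<in> {i. i < l}"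
      then show "i \<in> {i. i < l \<and> ?X i \<noteq> ?X (Suc i)} \<union> {i. i < l \<and> ?Y i \<noteq> ?Y (Suc i)}"
        using stable_modular[of A "N i" "N (Suc i)" E] N[of i] N[of "Suc i"] lt[of i] st by auto
    qed
    then have "card {i. i < l} \<le> card ({i. i < l \<and> ?X i \<noteq> ?X (Suc i)} \<union> {i. i < l \<and> ?Y i \<noteq> ?Y (Suc i)})"
      by (intro card_mono) auto
    also have "\<dots> \<le> card {i. i < l \<and> ?X i \<noteq> ?X (Suc i)} + card {i. i < l \<and> ?Y i \<noteq> ?Y (Suc i)}"
      by (rule card_Un_le)
    finally have "enat l \<le> enat (card {i. i < l \<and> ?X i \<noteq> ?X (Suc i)}) + enat (card {i. i < l \<and> ?Y i \<noteq> ?Y (Suc i)})"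
      by simp
    also have "\<dots> \<le> len A K E + len A E D" using X Y by (rule add_mono)
    finally show "enat l \<le> len A K E + len A E D" .
  qed
  show "len A K E + len A E D \<le> len A K D"
  proof (cases "len A K D")
    case (enat n)
    have "len A K E \<le> len A K D" "len A E D \<le> len A K D" by (rule len_mono; use sub in blast)+
    then obtain p q where pq: "len A K E = enat p" "len A E D = enat q" using enat by (metis enat_ile)
    obtain N where N: "\<And>i. i \<le> p \<Longrightarrow> stable A (N i) \<and> K \<subseteq> N i \<and> N i \<subseteq> E" "\<And>i. i < p \<Longrightarrow> N i \<subset> N (Suc i)"
      by (rule chain_len_attained[OF _ pq(1)[unfolded len_def], of K]) (use st sub in auto)
    obtain N' where N': "\<And>i. i \<le> q \<Longrightarrow> stable A (N' i) \<and> E \<subseteq> N' i \<and> N' i \<subseteq> D" "\<And>i. i < q \<Longrightarrow> N' i \<subset> N' (Suc i)"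
      by (rule chain_len_attained[OF _ pq(2)[unfolded len_def], of E]) (use st sub in auto)
    \<comment> \<open>\<open>N p\<close> is left out: it lies in \<open>E\<close>, hence in
      \<open>N' 0\<close>. The members \<open>N 0\<close>, ..., \<open>N (p - 1)\<close>,
      \<open>N' 0\<close>, ..., \<open>N' q\<close> already have p + q jumps, whether or not the two
      ends meet.\<close>
    let ?M = "\<lambda>i. if i < p then N i else N' (i - p)"
    have "enat (p + q) \<le> len A K D"
      unfolding len_def
    proof (rule chain_len_upper[where N = ?M])
      fix i assume i: "i \<le> p + q"
      show "stable A (?M i) \<and> K \<subseteq> ?M i \<and> ?M i \<subseteq> D"
      proof (cases "i < p")
        case True
        then show ?thesis using N(1)[of i] sub by auto
      next
        case False
        then have "i - p \<le> q" using i by simp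
        then show ?thesis using N'(1)[of "i - p"] sub False by auto
      qed
    next
      fix i assume i: "i < p + q"
      consider "Suc i < p" | "Suc i = p" | "i \<ge> p" by linarith
      then show "?M i \<subset> ?M (Suc i)"
      proof cases
        case 2
        then show ?thesis using N(2)[of i] N(1)[of p] N'(1)[of 0] by auto
      next
        case 3
        then show ?thesis using N'(2)[of "i - p"] i by (simp add: Suc_diff_le)
      qed (use N(2)[of i] in auto)
    qed
    then show ?thesis using pq by simp
  qed simp
qed

lemma len_refl [simp]: "len A K K = 0"
proof -
  have "chain_len (\<lambda>N. stable A N \<and> K \<subseteq> N \<and> N \<subseteq> K) \<le> 0"
  proof (rule chain_len_least, rule ccontr)
    fix l and N :: "nat \<Rightarrow> 'a set"
    assume N: "\<And>i. i \<le> l \<Longrightarrow> stable A (N i) \<and> K \<subseteq> N i \<and> N i \<subseteq> K" "\<And>i. i < l \<Longrightarrow> N i \<subset> N (Suc i)"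
      and "\<not> enat l \<le> 0"
    then have "0 < l" by (cases l) (auto simp: zero_enat_def)
    then show False using N(1)[of 0] N(1)[of 1] N(2)[of 0] by auto
  qed
  then show ?thesis by (simp add: len_def)
qed

lemma len_eq_0:
  assumes "stable A K" "stable A D" "K \<subseteq> D" "len A K D = 0"
  shows "K = D"
proof (rule ccontr)
  assume ne: "K \<noteq> D"
  have "enat 1 \<le> len A K D" unfolding len_def
    by (rule chain_len_upper[where N = "\<lambda>i. if i = 0 then K else D"]) (use assms ne in auto)
  then show False using assms(4) by (simp add: zero_enat_def)
qed

lemma len_telescope:
  assumes "additive_ops A" "\<And>i. i \<le> t \<Longrightarrow> stable A (G i)" "\<And>i. i < t \<Longrightarrow> G i \<subseteq> G (Suc i)"
  shows "len A (G 0) (G t) = (\<Sum>i<t. len A (G i) (G (Suc i)))"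
  using assms(2,3)
proof (induction t)
  case (Suc t)
  have "G 0 \<subseteq> G i" if "i \<le> t" for i using that
  proof (induction i)
    case (Suc i)
    then show ?case using \<open>\<And>i. i < Suc t \<Longrightarrow> G i \<subseteq> G (Suc i)\<close>[of i] by auto
  qed simp
  then have "len A (G 0) (G (Suc t)) = len A (G 0) (G t) + len A (G t) (G (Suc t))"
    by (intro len_add[OF assms(1)]) (use Suc.prems in auto)
  then show ?case using Suc by simp
qed simp

lemma stable_image:
  fixes \<phi> :: "'a::ab_group_add \<Rightarrow> 'b::ab_group_add"
  assumes N: "stable A N" and add: "\<And>x y. x \<in> N \<Longrightarrow> y \<in> N \<Longrightarrow> \<phi> (x + y) = \<phi> x + \<phi> y"
    and op: "\<And>h'. h' \<in> A' \<Longrightarrow> \<exists>h\<in>A. \<forall>x\<in>N. \<phi> (h x) = h' (\<phi> x)"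
  shows "stable A' (\<phi> ` N)"
proof (rule stableI)
  have z: "\<phi> 0 = 0" using add[of 0 0] stableD(1)[OF N] by simp
  show "0 \<in> \<phi> ` N" using z stableD(1)[OF N] by (intro image_eqI[of _ _ 0]) auto
  fix x assume "x \<in> \<phi> ` N"
  then obtain x' where x: "x = \<phi> x'" "x' \<in> N" by auto
  show "x + y \<in> \<phi> ` N" if y: "y \<in> \<phi> ` N" for y
  proof -
    obtain y' where "y = \<phi> y'" "y' \<in> N" using y by auto
    then show ?thesis using x add[of x' y'] stableD(2)[OF N, of x' y']
      by (intro image_eqI[of _ _ "x' + y'"]) simp_all
  qed
  have "\<phi> x' + \<phi> (- x') = 0" using add[of x' "- x'"] x(2) z stableD(3)[OF N] by simp
  then have "- x = \<phi> (- x')" unfolding x(1) by (rule minus_unique)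
  then show "- x \<in> \<phi> ` N" using x(2) stableD(3)[OF N, of x'] by (intro image_eqI[of _ _ "- x'"])
  fix h' assume "h' \<in> A'"
  then obtain h where "h \<in> A" "\<forall>x\<in>N. \<phi> (h x) = h' (\<phi> x)" using op by blast
  then show "h' x \<in> \<phi> ` N" using x stableD(4)[OF N, of h x'] by (intro image_eqI[of _ _ "h x'"]) simp_all
qed

text \<open>The correspondence theorem for a map D to D'/K' that is onto with kernel K: the inverse
  bijections are N to K' + \<phi>(N) and the preimage. The operators of the two sides may belong to
  different rings; \<open>op1\<close> and \<open>op2\<close> only match their actions.\<close>

lemma len_iso:
  fixes \<phi> :: "'a::ab_group_add \<Rightarrow> 'b::ab_group_add"
  assumes A: "additive_ops A'"
    and D: "stable A D" and K': "stable A' K'" and D': "stable A' D'"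
    and add: "\<And>x y. x \<in> D \<Longrightarrow> y \<in> D \<Longrightarrow> \<phi> (x + y) = \<phi> x + \<phi> y"
    and op1: "\<And>h. h \<in> A \<Longrightarrow> \<exists>h'\<in>A'. \<forall>x\<in>D. \<phi> (h x) = h' (\<phi> x)"
    and op2: "\<And>h'. h' \<in> A' \<Longrightarrow> \<exists>h\<in>A. \<forall>x\<in>D. \<phi> (h x) = h' (\<phi> x)"
    and onto: "D' = set_sum K' (\<phi> ` D)"
    and ker: "\<And>x. x \<in> D \<Longrightarrow> \<phi> x \<in> K' \<longleftrightarrow> x \<in> K" and KD: "K \<subseteq> D"
  shows "len A K D = len A' K' D'"
proof -
  have z: "\<phi> 0 = 0" using add[of 0 0] stableD(1)[OF D] by simp
  have neg: "\<phi> (- x) = - \<phi> x" if "x \<in> D" for x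
    using add[of x "- x"] stableD(3)[OF D] that z by (metis add.right_inverse minus_unique)
  have img: "stable A' (\<phi> ` N)" if "stable A N" "N \<subseteq> D" for N
  proof (rule stable_image[OF that(1)])
    show "\<phi> (x + y) = \<phi> x + \<phi> y" if "x \<in> N" "y \<in> N" for x y
      using that \<open>N \<subseteq> D\<close> by (intro add) auto
    show "\<exists>h\<in>A. \<forall>x\<in>N. \<phi> (h x) = h' (\<phi> x)" if "h' \<in> A'" for h'
      using op2[OF that] \<open>N \<subseteq> D\<close> by blast
  qed
  have pre: "stable A {x \<in> D. \<phi> x \<in> N}" if N: "stable A' N" for N
  proof (rule stableI)
    show "0 \<in> {x \<in> D. \<phi> x \<in> N}" using z stableD(1)[OF D] stableD(1)[OF N] by simp
  next
    fix h x assume "h \<in> A" "x \<in> {x \<in> D. \<phi> x \<in> N}"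
    then show "h x \<in> {x \<in> D. \<phi> x \<in> N}" using op1[of h] stableD(4)[OF D] stableD(4)[OF N] by auto
  qed (use add neg stableD[OF D] stableD[OF N] in auto)
  have pull_push: "{x \<in> D. \<phi> x \<in> set_sum K' (\<phi> ` N)} = N" if N: "stable A N" "K \<subseteq> N" "N \<subseteq> D" for N
  proof (intro antisym subsetI)
    fix x assume "x \<in> {x \<in> D. \<phi> x \<in> set_sum K' (\<phi> ` N)}"
    then obtain k y where *: "x \<in> D" "\<phi> x = k + \<phi> y" "k \<in> K'" "y \<in> N" by (auto simp: set_sum_def)
    then have "\<phi> (x - y) = k" using add[of x "- y"] neg[of y] stableD(3)[OF D] N by auto
    then have "x - y \<in> K" using ker[of "x - y"] * stableD(5)[OF D] N by auto
    then show "x \<in> N" using N * stableD(2)[OF N(1), of "x - y" y] by auto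
  next
    fix x assume "x \<in> N"
    then show "x \<in> {x \<in> D. \<phi> x \<in> set_sum K' (\<phi> ` N)}"
      using N set_sum_upper2[of K' "\<phi> ` N"] stableD(1)[OF K'] by auto
  qed
  have push_pull: "set_sum K' (\<phi> ` {x \<in> D. \<phi> x \<in> N}) = N" if N: "stable A' N" "K' \<subseteq> N" "N \<subseteq> D'" for N
  proof (intro antisym subsetI)
    fix x assume "x \<in> set_sum K' (\<phi> ` {x \<in> D. \<phi> x \<in> N})"
    then show "x \<in> N" using N stableD(2)[OF N(1)] by (auto simp: set_sum_def)
  next
    fix x assume x: "x \<in> N"
    then obtain k y where *: "x = k + \<phi> y" "k \<in> K'" "y \<in> D" using N onto by (auto simp: set_sum_def)
    then have "\<phi> y = x - k" by simp
    then have "\<phi> y \<in> N" using x * N stableD(5)[OF N(1), of x k] by auto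
    then show "x \<in> set_sum K' (\<phi> ` {x \<in> D. \<phi> x \<in> N})" using * by (auto simp: set_sum_def)
  qed
  show ?thesis unfolding len_def
  proof (rule antisym)
    show "chain_len (\<lambda>N. stable A N \<and> K \<subseteq> N \<and> N \<subseteq> D) \<le> chain_len (\<lambda>N. stable A' N \<and> K' \<subseteq> N \<and> N \<subseteq> D')"
    proof (rule chain_len_map_le[where g = "\<lambda>N. set_sum K' (\<phi> ` N)"])
      fix X assume X: "stable A X \<and> K \<subseteq> X \<and> X \<subseteq> D"
      have "set_sum K' (\<phi> ` X) \<subseteq> D'" unfolding onto set_sum_def using X by blast
      moreover have "0 \<in> \<phi> ` X" using X stableD(1)[of A X] z by (intro image_eqI[of _ _ 0]) auto
      ultimately show "stable A' (set_sum K' (\<phi> ` X)) \<and> K' \<subseteq> set_sum K' (\<phi> ` X) \<and> set_sum K' (\<phi> ` X) \<subseteq> D'"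
        using img[of X] stable_set_sum[OF A K'] set_sum_upper1[of "\<phi> ` X" K'] X by blast
    next
      fix X Y assume "stable A X \<and> K \<subseteq> X \<and> X \<subseteq> D" "stable A Y \<and> K \<subseteq> Y \<and> Y \<subseteq> D" "X \<subset> Y"
      moreover from this have "set_sum K' (\<phi> ` X) \<subseteq> set_sum K' (\<phi> ` Y)" unfolding set_sum_def by blast
      moreover have "set_sum K' (\<phi> ` X) \<noteq> set_sum K' (\<phi> ` Y)"
        using pull_push[of X] pull_push[of Y] calculation by (metis less_irrefl)
      ultimately show "set_sum K' (\<phi> ` X) \<subset> set_sum K' (\<phi> ` Y)" by (simp add: psubset_eq)
    qed
    show "chain_len (\<lambda>N. stable A' N \<and> K' \<subseteq> N \<and> N \<subseteq> D') \<le> chain_len (\<lambda>N. stable A N \<and> K \<subseteq> N \<and> N \<subseteq> D)"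
    proof (rule chain_len_map_le[where g = "\<lambda>N. {x \<in> D. \<phi> x \<in> N}"])
      fix X assume X: "stable A' X \<and> K' \<subseteq> X \<and> X \<subseteq> D'"
      then show "stable A {x \<in> D. \<phi> x \<in> X} \<and> K \<subseteq> {x \<in> D. \<phi> x \<in> X} \<and> {x \<in> D. \<phi> x \<in> X} \<subseteq> D"
        using pre ker KD by auto
    next
      fix X Y assume "stable A' X \<and> K' \<subseteq> X \<and> X \<subseteq> D'" "stable A' Y \<and> K' \<subseteq> Y \<and> Y \<subseteq> D'" "X \<subset> Y"
      moreover from this have "{x \<in> D. \<phi> x \<in> X} \<subseteq> {x \<in> D. \<phi> x \<in> Y}" by blast
      moreover have "{x \<in> D. \<phi> x \<in> X} \<noteq> {x \<in> D. \<phi> x \<in> Y}"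
        using push_pull[of X] push_pull[of Y] calculation by (metis less_irrefl)
      ultimately show "{x \<in> D. \<phi> x \<in> X} \<subset> {x \<in> D. \<phi> x \<in> Y}" by (simp add: psubset_eq)
    qed
  qed
qed

section \<open>Polynomials, gradings and slices\<close>

abbreviation lookup :: "('a \<Rightarrow>\<^sub>0 'b::zero) \<Rightarrow> 'a \<Rightarrow> 'b" where "lookup \<equiv> Poly_Mapping.lookup"
abbreviation keys :: "('a \<Rightarrow>\<^sub>0 'b::zero) \<Rightarrow> 'a set" where "keys \<equiv> Poly_Mapping.keys"
abbreviation single :: "'a \<Rightarrow> 'b \<Rightarrow> ('a \<Rightarrow>\<^sub>0 'b::zero)" where "single \<equiv> Poly_Mapping.single"

lemma single_sum: "single m (sum g S) = (\<Sum>i\<in>S. single m (g i))"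
  by (induction S rule: infinite_finite_induct) (auto simp: single_add)

lemma poly_mapping_sum_single:
  fixes F :: "'a \<Rightarrow>\<^sub>0 'b::comm_monoid_add"
  shows "F = (\<Sum>m\<in>keys F. single m (lookup F m))"
proof (rule poly_mapping_eqI)
  fix k
  have "lookup (\<Sum>m\<in>keys F. single m (lookup F m)) k = (\<Sum>m\<in>keys F. if m = k then lookup F m else 0)"
    by (simp add: lookup_sum lookup_single when_def)
  also have "\<dots> = lookup F k" by (auto simp: sum.delta in_keys_iff)
  finally show "lookup F k = lookup (\<Sum>m\<in>keys F. single m (lookup F m)) k" ..
qed

lemma poly_mapping_induct [case_names single add]:
  fixes F :: "'a \<Rightarrow>\<^sub>0 'b::comm_monoid_add"
  assumes "\<And>m a. P (single m a)" "\<And>F G. P F \<Longrightarrow> P G \<Longrightarrow> P (F + G)"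
  shows "P F"
proof -
  have "P (\<Sum>m\<in>S. single m (lookup F m))" if "finite S" for S
    using that
  proof (induction S rule: finite_induct)
    case empty
    then show ?case using assms(1)[of undefined 0] by simp
  qed (simp add: assms)
  from this[OF finite_keys[of F]] show ?thesis unfolding poly_mapping_sum_single[symmetric] .
qed

definition edeg :: "('v \<Rightarrow>\<^sub>0 nat) \<Rightarrow> nat" where
  "edeg m = (\<Sum>v\<in>keys m. lookup m v)"

lemma edeg_superset: "finite S \<Longrightarrow> keys m \<subseteq> S \<Longrightarrow> edeg m = (\<Sum>v\<in>S. lookup m v)"
  unfolding edeg_def by (rule sum.mono_neutral_left) (auto simp: in_keys_iff)

lemma edeg_add: "edeg (m + m') = edeg m + edeg m'"
proof -
  have "keys (m + m') \<subseteq> keys m \<union> keys m'" by (rule keys_add)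
  then show ?thesis
    by (simp add: edeg_superset[of "keys m \<union> keys m'"] lookup_add sum.distrib)
qed

lemma edeg_single [simp]: "edeg (single v e) = e"
  by (simp add: edeg_def)

lemma edeg_zero [simp]: "edeg 0 = 0"
  by (simp add: edeg_def)

lemma edeg_eq_0_iff [simp]: "edeg m = 0 \<longleftrightarrow> m = 0"
  by (metis edeg_def edeg_zero finite_keys in_keys_iff poly_mapping_eqI lookup_zero sum_eq_0_iff)

lemma keys_exponent_add: "keys (m + m' :: 'v \<Rightarrow>\<^sub>0 nat) = keys m \<union> keys m'"
  by (auto simp: in_keys_iff lookup_add)

section \<open>Polynomials with prescribed coefficients and variables\<close>

definition is_subring :: "'a::comm_ring_1 set \<Rightarrow> bool" where
  "is_subring K \<longleftrightarrow> 0 \<in> K \<and> 1 \<in> K \<and> (\<forall>x\<in>K. \<forall>y\<in>K. x + y \<in> K \<and> x * y \<in> K) \<and> (\<forall>x\<in>K. - x \<in> K)"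

lemma is_subringD:
  assumes "is_subring K"
  shows "0 \<in> K" "1 \<in> K" "x \<in> K \<Longrightarrow> y \<in> K \<Longrightarrow> x + y \<in> K" "x \<in> K \<Longrightarrow> y \<in> K \<Longrightarrow> x * y \<in> K"
    "x \<in> K \<Longrightarrow> - x \<in> K" "x \<in> K \<Longrightarrow> y \<in> K \<Longrightarrow> x - y \<in> K"
  using assms unfolding is_subring_def by (auto simp: diff_conv_add_uminus simp del: add_uminus_conv_diff)

lemma is_subring_UNIV [simp]: "is_subring UNIV"
  by (simp add: is_subring_def)

text \<open>\<open>K\<close> may be an ideal of the coefficient ring, and the result is then the
  extended ideal. Since all exponents are tested and not only \<open>keys\<close>, this agrees with
  the carrier of \<open>mpoly_ring\<close> when 0 lies in \<open>K\<close>.\<close>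

definition polys :: "'a::comm_ring_1 set \<Rightarrow> 'v set \<Rightarrow> (('v \<Rightarrow>\<^sub>0 nat) \<Rightarrow>\<^sub>0 'a) set" where
  "polys K V = {p. \<forall>m. lookup p m \<in> K \<and> (lookup p m \<noteq> 0 \<longrightarrow> keys m \<subseteq> V)}"

lemma carrier_mpoly_ring: "0 \<in> K \<Longrightarrow> carrier (mpoly_ring K V) = polys K V"
  unfolding mpoly_ring_def polys_def by (auto simp: in_keys_iff)

lemma polys_add: "stable {} K \<Longrightarrow> F \<in> polys K V \<Longrightarrow> G \<in> polys K V \<Longrightarrow> F + G \<in> polys K V"
  unfolding polys_def
proof (intro CollectI allI conjI impI)
  fix m
  assume *: "stable {} K" "F \<in> {p. \<forall>m. lookup p m \<in> K \<and> (lookup p m \<noteq> 0 \<longrightarrow> keys m \<subseteq> V)}"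
    "G \<in> {p. \<forall>m. lookup p m \<in> K \<and> (lookup p m \<noteq> 0 \<longrightarrow> keys m \<subseteq> V)}"
  then show "lookup (F + G) m \<in> K" by (simp add: lookup_add stableD(2))
  assume "lookup (F + G) m \<noteq> 0"
  then have "lookup F m \<noteq> 0 \<or> lookup G m \<noteq> 0" by (auto simp: lookup_add)
  then show "keys m \<subseteq> V" using * by auto
qed

lemma polys_uminus: "stable {} K \<Longrightarrow> F \<in> polys K V \<Longrightarrow> - F \<in> polys K V"
  unfolding polys_def by (auto simp: stableD)

lemma polys_zero: "stable {} K \<Longrightarrow> 0 \<in> polys K V"
  unfolding polys_def by (auto simp: stableD)

lemma polys_sum: "stable {} K \<Longrightarrow> (\<And>i. i \<in> S \<Longrightarrow> g i \<in> polys K V) \<Longrightarrow> sum g S \<in> polys K V"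
  by (induction S rule: infinite_finite_induct) (auto simp: polys_zero polys_add)

lemma polys_single: "stable {} K \<Longrightarrow> a \<in> K \<Longrightarrow> keys m \<subseteq> V \<Longrightarrow> single m a \<in> polys K V"
  unfolding polys_def by (auto simp: lookup_single when_def stableD)

lemma is_subring_stable: "is_subring K \<Longrightarrow> stable {} K"
  by (auto simp: stable_def is_subringD)

lemma polys_induct [consumes 2, case_names single add]:
  assumes K: "stable {} K" and F: "F \<in> polys K V"
    and s: "\<And>m a. a \<in> K \<Longrightarrow> keys m \<subseteq> V \<Longrightarrow> P (single m a)"
    and add: "\<And>F G. F \<in> polys K V \<Longrightarrow> G \<in> polys K V \<Longrightarrow> P F \<Longrightarrow> P G \<Longrightarrow> P (F + G)"
  shows "P F"
proof -
  have sg: "single m a \<in> polys K V" if "a \<in> K" "keys m \<subseteq> V" for m a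
    using that stableD(1)[OF K] by (auto simp: polys_def lookup_single when_def)
  have *: "lookup F m \<in> K" "keys m \<subseteq> V" if "m \<in> keys F" for m
    using F that by (auto simp: polys_def in_keys_iff)
  have z: "P 0" using s[of 0 0] stableD(1)[OF K] by simp
  have "P (\<Sum>m\<in>S. single m (lookup F m)) \<and> (\<Sum>m\<in>S. single m (lookup F m)) \<in> polys K V"
    if "finite S" "S \<subseteq> keys F" for S
    using that
  proof (induction S rule: finite_induct)
    case empty
    then show ?case using z stableD(1)[OF K] by (simp add: polys_def)
  next
    case (insert m S)
    then have "P (single m (lookup F m) + (\<Sum>m\<in>S. single m (lookup F m)))"
      using * by (intro add s sg) auto
    moreover have "single m (lookup F m) + (\<Sum>m\<in>S. single m (lookup F m)) \<in> polys K V"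
      using insert * by (intro polys_add[OF K] sg) auto
    ultimately show ?case using insert.hyps by simp
  qed
  from this[OF finite_keys[of F] subset_refl] show ?thesis unfolding poly_mapping_sum_single[symmetric] by simp
qed

lemma polys_mult_coeffs:
  assumes X: "is_subring X" and K: "stable {} K" and XK: "\<And>r a. r \<in> X \<Longrightarrow> a \<in> K \<Longrightarrow> r * a \<in> K"
    and F: "F \<in> polys X V" and G: "G \<in> polys K V"
  shows "F * G \<in> polys K V"
  using is_subring_stable[OF X] F
proof (induction rule: polys_induct)
  case F: (single m a)
  show ?case using K G
  proof (induction rule: polys_induct)
    case (single m' b)
    then show ?case using F XK
      by (auto simp: mult_single keys_exponent_add intro!: polys_single[OF K])
  next
    case (add G H)
    then show ?case by (simp add: distrib_left polys_add[OF K])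
  qed
next
  case (add F H)
  then show ?case by (simp add: distrib_right polys_add[OF K])
qed

lemma polys_mult: "is_subring K \<Longrightarrow> F \<in> polys K V \<Longrightarrow> G \<in> polys K V \<Longrightarrow> F * G \<in> polys K V"
  by (rule polys_mult_coeffs) (auto simp: is_subring_stable is_subringD)

lemma is_subring_polys: "is_subring K \<Longrightarrow> is_subring (polys K V)"
  using polys_single[of K 1 0 V] is_subringD(2)[of K] unfolding is_subring_def[of "polys K V"]
  by (simp add: polys_zero polys_add polys_mult polys_uminus is_subring_stable)

lemma polys_mono: "V \<subseteq> V' \<Longrightarrow> polys K V \<subseteq> polys K V'"
  unfolding polys_def by blast

lemma polys_mVar: "is_subring K \<Longrightarrow> v \<in> V \<Longrightarrow> mVar v \<in> polys K V"
  unfolding mVar_def by (rule polys_single) (auto simp: is_subringD is_subring_stable)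

lemma polys_mConst: "stable {} K \<Longrightarrow> c \<in> K \<Longrightarrow> mConst c \<in> polys K V"
  unfolding mConst_def by (rule polys_single) auto

lemma mConst_add: "mConst (a + b) = mConst a + mConst b"
  by (simp add: mConst_def single_add)

lemma mConst_mult: "mConst (a * b) = mConst a * mConst b"
  by (simp add: mConst_def mult_single)

lemma mConst_zero [simp]: "mConst 0 = 0" by (simp add: mConst_def)
lemma mConst_one [simp]: "mConst 1 = 1" by (simp add: mConst_def)
lemma mConst_uminus: "mConst (- a) = - mConst a" by (simp add: mConst_def single_uminus)

lemma lookup_single_mult: "lookup (single m a * F) (m + m') = a * lookup F m'"
  for m :: "'v \<Rightarrow>\<^sub>0 nat"
proof (induction F rule: poly_mapping_induct)
  case (add F G)
  then show ?case by (simp add: distrib_left lookup_add)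
qed (auto simp: mult_single lookup_single when_def)

lemma lookup_mConst_mult: "lookup (mConst a * F) m = a * lookup F m"
  using lookup_single_mult[of 0 a F m] by (simp add: mConst_def)

section \<open>Evaluation homomorphisms\<close>

definition mon :: "('v \<Rightarrow> 'b::comm_ring_1) \<Rightarrow> ('v \<Rightarrow>\<^sub>0 nat) \<Rightarrow> 'b" where
  "mon \<sigma> m = (\<Prod>v\<in>keys m. \<sigma> v ^ lookup m v)"

lemma mon_superset: "finite S \<Longrightarrow> keys m \<subseteq> S \<Longrightarrow> mon \<sigma> m = (\<Prod>v\<in>S. \<sigma> v ^ lookup m v)"
  unfolding mon_def by (rule prod.mono_neutral_left) (auto simp: in_keys_iff)

lemma mon_add: "mon \<sigma> (m + m') = mon \<sigma> m * mon \<sigma> m'"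
  by (simp add: mon_superset[of "keys m \<union> keys m'"] keys_exponent_add lookup_add power_add prod.distrib)

lemma mon_zero [simp]: "mon \<sigma> 0 = 1" by (simp add: mon_def)

lemma mon_single [simp]: "mon \<sigma> (single v e) = \<sigma> v ^ e" by (simp add: mon_def)

lemma mon_mVar: "mon mVar m = single m 1"
proof -
  have pw: "(mVar v :: ('a \<Rightarrow>\<^sub>0 nat) \<Rightarrow>\<^sub>0 'b) ^ e = single (single v e) 1" for v e
    by (induction e) (auto simp: mVar_def mult_single single_add[symmetric])
  have "(\<Prod>v\<in>S. single (single v (lookup m v)) (1::'b)) = single (\<Sum>v\<in>S. single v (lookup m v)) 1" for S
    by (induction S rule: infinite_finite_induct) (auto simp: mult_single)
  then show ?thesis unfolding mon_def pw using poly_mapping_sum_single[of m] by (simp only:)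
qed

definition is_hom :: "('a::comm_ring_1 \<Rightarrow> 'b::comm_ring_1) \<Rightarrow> bool" where
  "is_hom \<kappa> \<longleftrightarrow> \<kappa> 1 = 1 \<and> (\<forall>x y. \<kappa> (x + y) = \<kappa> x + \<kappa> y \<and> \<kappa> (x * y) = \<kappa> x * \<kappa> y)"

lemma is_homD:
  assumes "is_hom \<kappa>"
  shows "\<kappa> 1 = 1" "\<kappa> (x + y) = \<kappa> x + \<kappa> y" "\<kappa> (x * y) = \<kappa> x * \<kappa> y" "\<kappa> 0 = 0"
    "\<kappa> (- x) = - \<kappa> x" "\<kappa> (x - y) = \<kappa> x - \<kappa> y"
proof -
  show h: "\<kappa> 1 = 1" "\<kappa> (x + y) = \<kappa> x + \<kappa> y" "\<kappa> (x * y) = \<kappa> x * \<kappa> y" for x y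
    using assms by (auto simp: is_hom_def)
  show z: "\<kappa> 0 = 0" using h(2)[of 0 0] by simp
  show n: "\<kappa> (- x) = - \<kappa> x" for x using h(2)[of x "- x"] z by (metis add.right_inverse minus_unique)
  show "\<kappa> (x - y) = \<kappa> x - \<kappa> y" using h(2)[of x "- y"] n[of y] by simp
qed

lemma is_hom_sum: "is_hom \<kappa> \<Longrightarrow> \<kappa> (sum g S) = (\<Sum>i\<in>S. \<kappa> (g i))"
  by (induction S rule: infinite_finite_induct) (auto simp: is_homD)

lemma is_hom_mConst: "is_hom mConst"
  by (simp add: is_hom_def mConst_add mConst_mult)

text \<open>Coefficients may change ring through \<kappa>: with \<open>mConst\<close> this is
  \<open>msubst\<close>, and with constant polynomials in t it yields the map to the Rees
  algebra.\<close>

definition evalh :: "('a::comm_ring_1 \<Rightarrow> 'b::comm_ring_1) \<Rightarrow> ('v \<Rightarrow> 'b) \<Rightarrow> (('v \<Rightarrow>\<^sub>0 nat) \<Rightarrow>\<^sub>0 'a) \<Rightarrow> 'b" where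
  "evalh \<kappa> \<sigma> F = (\<Sum>m\<in>keys F. \<kappa> (lookup F m) * mon \<sigma> m)"

lemma msubst_eq: "msubst \<sigma> = evalh mConst \<sigma>"
  by (auto simp: fun_eq_iff msubst_def evalh_def mon_def)

lemma evalh_single: "is_hom \<kappa> \<Longrightarrow> evalh \<kappa> \<sigma> (single m a) = \<kappa> a * mon \<sigma> m"
  by (simp add: evalh_def is_homD)

lemma evalh_add: "is_hom \<kappa> \<Longrightarrow> evalh \<kappa> \<sigma> (F + G) = evalh \<kappa> \<sigma> F + evalh \<kappa> \<sigma> G"
  unfolding evalh_def by (rule setsum_keys_plus_distrib) (auto simp: is_homD algebra_simps)

lemma is_hom_evalh:
  assumes \<kappa>: "is_hom \<kappa>"
  shows "is_hom (evalh \<kappa> \<sigma>)"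
proof -
  have 1: "evalh \<kappa> \<sigma> (single m a * G) = evalh \<kappa> \<sigma> (single m a) * evalh \<kappa> \<sigma> G" for m a G
    by (induction G rule: poly_mapping_induct)
      (auto simp: mult_single evalh_single[OF \<kappa>] is_homD[OF \<kappa>] mon_add evalh_add[OF \<kappa>] algebra_simps)
  have "evalh \<kappa> \<sigma> (F * G) = evalh \<kappa> \<sigma> F * evalh \<kappa> \<sigma> G" for F G
    by (induction F rule: poly_mapping_induct) (auto simp: 1 evalh_add[OF \<kappa>] distrib_right)
  moreover have "evalh \<kappa> \<sigma> 1 = 1"
    using evalh_single[OF \<kappa>, of \<sigma> 0 1] by (simp add: is_homD[OF \<kappa>])
  ultimately show ?thesis by (simp add: is_hom_def evalh_add[OF \<kappa>])
qed

text \<open>A grading by natural numbers, given by its projections rather than by its components.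
  \<open>cp_total\<close> speaks of all large bounds, so that several elements can share
  one.\<close>

locale grading =
  fixes cp :: "nat \<Rightarrow> 'a::comm_ring_1 \<Rightarrow> 'a"
  assumes cp_add: "cp u (x + y) = cp u x + cp u y"
    and cp_mult: "cp u (x * y) = (\<Sum>i\<le>u. cp i x * cp (u - i) y)"
    and cp_cp: "cp u (cp v x) = (if u = v then cp v x else 0)"
    and cp_total: "\<exists>N. \<forall>M\<ge>N. (\<Sum>i<M. cp i x) = x"
begin

lemma cp_zero [simp]: "cp u 0 = 0"
  using cp_add[of u 0 0] by simp

lemma cp_uminus: "cp u (- x) = - cp u x"
  using cp_add[of u x "- x"] by (metis add.right_inverse cp_zero minus_unique)

lemma cp_diff: "cp u (x - y) = cp u x - cp u y"
  using cp_add[of u x "- y"] by (simp add: cp_uminus)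

lemma cp_sum: "cp u (sum g S) = (\<Sum>i\<in>S. cp u (g i))"
  by (induction S rule: infinite_finite_induct) (auto simp: cp_add)

lemma cp_trunc: "cp u (\<Sum>i<M. cp i x) = (if u < M then cp u x else 0)"
  by (auto simp: cp_sum cp_cp)

lemma cp_homogeneous: "cp v h = h \<Longrightarrow> cp u h = (if u = v then h else 0)"
  using cp_cp[of u v h] by simp

lemma cp_mult_homogeneous:
  assumes "cp v h = h"
  shows "cp u (x * h) = (if v \<le> u then cp (u - v) x * h else 0)"
proof -
  have "cp u (x * h) = (\<Sum>i\<le>u. if u - i = v then cp i x * h else 0)"
    unfolding cp_mult by (intro sum.cong) (auto simp: cp_homogeneous[OF assms])
  also have "\<dots> = (\<Sum>i\<le>u. if i = u - v \<and> v \<le> u then cp i x * h else 0)"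
    by (intro sum.cong) auto
  also have "\<dots> = (if v \<le> u then cp (u - v) x * h else 0)"
    by auto
  finally show ?thesis .
qed

end

text \<open>The total degree: coefficients are graded by \<open>cp\<close>, variables have degree one.\<close>

definition lift_cp :: "(nat \<Rightarrow> 'a::comm_ring_1 \<Rightarrow> 'a) \<Rightarrow> nat \<Rightarrow> (('v \<Rightarrow>\<^sub>0 nat) \<Rightarrow>\<^sub>0 'a) \<Rightarrow> (('v \<Rightarrow>\<^sub>0 nat) \<Rightarrow>\<^sub>0 'a)" where
  "lift_cp cp u = Poly_Mapping.mapp (\<lambda>m a. if edeg m \<le> u then cp (u - edeg m) a else 0)"

context grading
begin

lemma lookup_lift_cp: "lookup (lift_cp cp u F) m = (if edeg m \<le> u then cp (u - edeg m) (lookup F m) else 0)"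
  by (auto simp: lift_cp_def lookup_mapp when_def in_keys_iff)

lemma lift_cp_add: "lift_cp cp u (F + G) = lift_cp cp u F + lift_cp cp u G"
  by (rule poly_mapping_eqI) (simp add: lookup_lift_cp lookup_add cp_add)

lemma lift_cp_single: "lift_cp cp u (single m a) = (if edeg m \<le> u then single m (cp (u - edeg m) a) else 0)"
  by (rule poly_mapping_eqI) (auto simp: lookup_lift_cp lookup_single when_def)

lemma lift_cp_mult_single:
  "lift_cp cp u (single m a * single m' b) = (\<Sum>i\<le>u. lift_cp cp i (single m a) * lift_cp cp (u - i) (single m' b))"
proof (cases "edeg m + edeg m' \<le> u")
  case True
  let ?w = "u - (edeg m + edeg m')"
  have "(\<Sum>i\<le>u. lift_cp cp i (single m a) * lift_cp cp (u - i) (single m' b)) =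
    (\<Sum>i\<in>{edeg m..edeg m + ?w}. single (m + m') (cp (i - edeg m) a * cp (u - i - edeg m') b))"
    by (rule sum.mono_neutral_cong_right) (use True in \<open>auto simp: lift_cp_single mult_single\<close>)
  also have "\<dots> = (\<Sum>i\<le>?w. single (m + m') (cp i a * cp (?w - i) b))"
    by (rule sum.reindex_bij_witness[of _ "\<lambda>i. i + edeg m" "\<lambda>i. i - edeg m"]) 
      (use True in \<open>auto simp: algebra_simps\<close>)
  also have "\<dots> = single (m + m') (cp ?w (a * b))"
    by (simp add: cp_mult single_sum)
  also have "\<dots> = lift_cp cp u (single m a * single m' b)"
    using True by (simp add: mult_single lift_cp_single edeg_add)
  finally show ?thesis ..
next
  case False
  then have "lift_cp cp i (single m a) * lift_cp cp (u - i) (single m' b) = 0" if "i \<le> u" for i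
    using that by (auto simp: lift_cp_single)
  then show ?thesis using False by (simp add: mult_single lift_cp_single edeg_add)
qed

lemma grading_lift_cp: "grading (lift_cp cp :: nat \<Rightarrow> (('v \<Rightarrow>\<^sub>0 nat) \<Rightarrow>\<^sub>0 'a) \<Rightarrow> _)"
proof
  fix u and F G :: "('v \<Rightarrow>\<^sub>0 nat) \<Rightarrow>\<^sub>0 'a"
  show "lift_cp cp u (F + G) = lift_cp cp u F + lift_cp cp u G" by (rule lift_cp_add)
  have 1: "lift_cp cp u (single m a * G) = (\<Sum>i\<le>u. lift_cp cp i (single m a) * lift_cp cp (u - i) G)" for m a
    by (induction G rule: poly_mapping_induct) (auto simp: lift_cp_mult_single lift_cp_add distrib_left sum.distrib)
  show "lift_cp cp u (F * G) = (\<Sum>i\<le>u. lift_cp cp i F * lift_cp cp (u - i) G)"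
    by (induction F rule: poly_mapping_induct) (auto simp: 1 lift_cp_add distrib_right sum.distrib)
  show "lift_cp cp u (lift_cp cp v F) = (if u = v then lift_cp cp v F else 0)" for v
    by (rule poly_mapping_eqI) (auto simp: lookup_lift_cp cp_cp)
  show "\<exists>N. \<forall>M\<ge>N. (\<Sum>i<M. lift_cp cp i F) = F"
  proof (induction F rule: poly_mapping_induct)
    case (single m a)
    obtain N where N: "\<And>M. M \<ge> N \<Longrightarrow> (\<Sum>i<M. cp i a) = a" using cp_total by blast
    have "(\<Sum>i<M. lift_cp cp i (single m a)) = single m a" if "M \<ge> N + edeg m" for M
    proof -
      have "(\<Sum>i<M. lift_cp cp i (single m a)) = (\<Sum>i\<in>{edeg m..<M}. single m (cp (i - edeg m) a))"
        by (rule sum.mono_neutral_cong_right) (auto simp: lift_cp_single)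
      also have "\<dots> = (\<Sum>i<M - edeg m. single m (cp i a))"
        by (rule sum.reindex_bij_witness[of _ "\<lambda>i. i + edeg m" "\<lambda>i. i - edeg m"]) auto
      also have "\<dots> = single m (\<Sum>i<M - edeg m. cp i a)"
        by (rule single_sum[symmetric])
      finally show ?thesis using N[of "M - edeg m"] that by simp
    qed
    then show ?case by blast
  next
    case (add F G)
    then obtain N N' where "\<forall>M\<ge>N. (\<Sum>i<M. lift_cp cp i F) = F" "\<forall>M\<ge>N'. (\<Sum>i<M. lift_cp cp i G) = G" by blast
    then show ?case by (intro exI[of _ "max N N'"]) (simp add: lift_cp_add sum.distrib)
  qed
qed

end

text \<open>The start of the tower of gradings: lifted once it gives the degree in the x variables,
  lifted twice the total degree in the x and T variables.\<close>

definition trivial_cp :: "nat \<Rightarrow> 'a::comm_ring_1 \<Rightarrow> 'a" where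
  "trivial_cp u x = (if u = 0 then x else 0)"

lemma grading_trivial_cp: "grading trivial_cp"
proof
  fix u and x y :: 'a
  show "trivial_cp u (x * y) = (\<Sum>i\<le>u. trivial_cp i x * trivial_cp (u - i) y)"
    by (cases u) (auto simp: trivial_cp_def intro!: sum.neutral[symmetric])
  show "\<exists>N. \<forall>M\<ge>N. (\<Sum>i<M. trivial_cp i x) = x"
    by (intro exI[of _ 1]) (auto simp: trivial_cp_def)
qed (auto simp: trivial_cp_def)

section \<open>Expansion in powers of one variable\<close>

definition var_pow :: "'v \<Rightarrow> nat \<Rightarrow> ('v \<Rightarrow>\<^sub>0 nat) \<Rightarrow>\<^sub>0 'a::comm_ring_1" where
  "var_pow v s = single (single v s) 1"

text \<open>The coefficient of \<open>v\<^sup>s\<close>, as a polynomial in the other variables.\<close>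

definition slice :: "'v \<Rightarrow> nat \<Rightarrow> (('v \<Rightarrow>\<^sub>0 nat) \<Rightarrow>\<^sub>0 'a::comm_ring_1) \<Rightarrow> (('v \<Rightarrow>\<^sub>0 nat) \<Rightarrow>\<^sub>0 'a)" where
  "slice v s F = Poly_Mapping.mapp (\<lambda>m a. if lookup m v = 0 then a else 0)
     (Poly_Mapping.map_key (\<lambda>m. m + single v s) F)"

lemma lookup_slice: "lookup (slice v s F) m = (if lookup m v = 0 then lookup F (m + single v s) else 0)"
proof -
  have "inj (\<lambda>m. m + single v s)" by (auto simp: inj_def)
  then show ?thesis by (auto simp: slice_def lookup_mapp when_def in_keys_iff map_key.rep_eq)
qed

lemma slice_add: "slice v s (F + G) = slice v s F + slice v s G"
  by (rule poly_mapping_eqI) (simp add: lookup_slice lookup_add)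

lemma slice_zero [simp]: "slice v s 0 = 0"
  by (rule poly_mapping_eqI) (simp add: lookup_slice)

lemma slice_uminus: "slice v s (- F) = - slice v s F"
  by (rule poly_mapping_eqI) (simp add: lookup_slice)

lemma slice_diff: "slice v s (F - G) = slice v s F - slice v s G"
  by (rule poly_mapping_eqI) (simp add: lookup_slice lookup_minus)

lemma slice_sum: "slice v s (sum g S) = (\<Sum>i\<in>S. slice v s (g i))"
  by (induction S rule: infinite_finite_induct) (auto simp: slice_add)

lemma slice_single:
  assumes "lookup m v = 0"
  shows "slice v s (single (m + single v r) a) = (if r = s then single m a else 0)"
proof (rule poly_mapping_eqI)
  fix k
  have "m + single v r = k + single v s \<longleftrightarrow> m = k \<and> r = s" if "lookup k v = 0"
  proof
    assume *: "m + single v r = k + single v s"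
    have "lookup (m + single v r) v = lookup (k + single v s) v" using * by simp
    then have "r = s" using assms that by (simp add: lookup_add)
    then show "m = k \<and> r = s" using * by simp
  qed simp
  then show "lookup (slice v s (single (m + single v r) a)) k = lookup (if r = s then single m a else 0) k"
    using assms by (auto simp: lookup_slice lookup_single when_def)
qed

lemma exponent_split:
  fixes m :: "'v \<Rightarrow>\<^sub>0 nat"
  obtains m' where "m = m' + single v (lookup m v)" "lookup m' v = 0"
    "keys m' = keys m - {v}"
proof -
  let ?m' = "m - single v (lookup m v)"
  have l: "lookup ?m' k = (if k = v then 0 else lookup m k)" for k
    by (simp add: lookup_minus lookup_single when_def)
  have "m = ?m' + single v (lookup m v)"
    by (rule poly_mapping_eqI) (simp add: lookup_add l lookup_single when_def)
  moreover have "keys ?m' = keys m - {v}" by (auto simp: in_keys_iff l split: if_splits)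
  ultimately show ?thesis using that[of ?m'] l by simp
qed

lemma slice_var_pow_mult:
  "slice v s (var_pow v r * F) = (if r \<le> s then slice v (s - r) F else 0)"
proof (induction F rule: poly_mapping_induct)
  case (single m a)
  obtain m' where m': "m = m' + single v (lookup m v)" "lookup m' v = 0" by (rule exponent_split[of m v]) blast
  have "var_pow v r * single m a = single (m' + single v (r + lookup m v)) a"
    by (subst m'(1)) (simp add: var_pow_def mult_single single_add add_ac)
  moreover have "slice v (s - r) (single m a) = (if lookup m v = s - r then single m' a else 0)"
    by (subst m'(1)) (simp add: slice_single[OF m'(2)])
  ultimately show ?case by (auto simp: slice_single[OF m'(2)])
next
  case (add F G)
  then show ?case by (auto simp: distrib_left slice_add)
qed

lemma slice_mult_free:
  assumes "\<And>m. lookup m v \<noteq> 0 \<Longrightarrow> lookup b m = 0"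
  shows "slice v s (b * F) = b * slice v s F"
proof -
  have single: "slice v s (single m c * F) = single m c * slice v s F" if "lookup m v = 0" for m c
  proof (induction F rule: poly_mapping_induct)
    case (single k a)
    obtain k' where k': "k = k' + single v (lookup k v)" "lookup k' v = 0" by (rule exponent_split[of k v]) blast
    have "single m c * single k a = single ((m + k') + single v (lookup k v)) (c * a)"
      by (subst k'(1)) (simp add: mult_single add_ac)
    moreover have "lookup (m + k') v = 0" using that k' by (simp add: lookup_add)
    moreover have "slice v s (single k a) = (if lookup k v = s then single k' a else 0)"
      by (subst k'(1)) (simp add: slice_single[OF k'(2)])
    ultimately show ?case by (auto simp: slice_single mult_single)
  next
    case (add F G)
    then show ?case by (auto simp: distrib_left slice_add)
  qed
  have "slice v s ((\<Sum>m\<in>keys b. single m (lookup b m)) * F) = (\<Sum>m\<in>keys b. single m (lookup b m)) * slice v s F"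
    unfolding sum_distrib_right slice_sum
  proof (rule sum.cong[OF refl])
    fix m assume "m \<in> keys b"
    then have "lookup m v = 0" using assms[of m] by (auto simp: in_keys_iff)
    then show "slice v s (single m (lookup b m) * F) = single m (lookup b m) * slice v s F" by (rule single)
  qed
  then show ?thesis unfolding poly_mapping_sum_single[symmetric] .
qed

lemma slice_expansion: "\<exists>N. \<forall>M\<ge>N. F = (\<Sum>s<M. var_pow v s * slice v s F)"
proof (induction F rule: poly_mapping_induct)
  case (single m a)
  obtain m' where m': "m = m' + single v (lookup m v)" "lookup m' v = 0" by (rule exponent_split[of m v]) blast
  have sl: "slice v s (single m a) = (if lookup m v = s then single m' a else 0)" for s
    by (subst m'(1)) (simp add: slice_single[OF m'(2)])
  have "single m a = (\<Sum>s<M. var_pow v s * slice v s (single m a))" if "M \<ge> Suc (lookup m v)" for M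
  proof -
    have "(\<Sum>s<M. var_pow v s * slice v s (single m a)) = (\<Sum>s<M. if s = lookup m v then var_pow v s * single m' a else 0)"
      by (intro sum.cong) (auto simp: sl)
    also have "\<dots> = var_pow v (lookup m v) * single m' a" using that by auto
    also have "\<dots> = single m a" by (subst (2) m'(1)) (simp add: var_pow_def mult_single add_ac)
    finally show ?thesis ..
  qed
  then show ?case by blast
next
  case (add F G)
  then obtain N N' where "\<forall>M\<ge>N. F = (\<Sum>s<M. var_pow v s * slice v s F)" "\<forall>M\<ge>N'. G = (\<Sum>s<M. var_pow v s * slice v s G)"
    by blast
  then have "F = (\<Sum>s<M. var_pow v s * slice v s F)" "G = (\<Sum>s<M. var_pow v s * slice v s G)" if "M \<ge> max N N'" for M
    using that by auto
  then show ?case unfolding slice_add distrib_left sum.distrib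
    by (intro exI[of _ "max N N'"] allI impI arg_cong2[where f = "(+)"])
qed

lemma slice_expansion_bounded:
  assumes "\<And>s. s > e \<Longrightarrow> slice v s F = 0"
  shows "F = (\<Sum>s\<le>e. var_pow v s * slice v s F)"
proof -
  obtain N where N: "\<And>M. M \<ge> N \<Longrightarrow> F = (\<Sum>s<M. var_pow v s * slice v s F)" using slice_expansion[of F v] by blast
  have "(\<Sum>s<max N (Suc e). var_pow v s * slice v s F) = (\<Sum>s\<le>e. var_pow v s * slice v s F)"
    by (rule sum.mono_neutral_right) (auto simp: assms not_le)
  then show ?thesis by (rule trans[OF N[OF max.cobounded1]])
qed

lemma slice_eventually_0: "\<exists>N. \<forall>s\<ge>N. slice v s F = 0"
proof -
  obtain N where N: "F = (\<Sum>s<N. var_pow v s * slice v s F)" using slice_expansion[of F v] by blast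
  have "slice v s (var_pow v r * slice v r F) = 0" if "r < N" "s \<ge> N" for r s
    using that by (auto simp: slice_var_pow_mult intro!: poly_mapping_eqI) (auto simp: lookup_slice lookup_add)
  then have "slice v s (\<Sum>s<N. var_pow v s * slice v s F) = 0" if "s \<ge> N" for s
    using that by (simp add: slice_sum)
  then show ?thesis unfolding N[symmetric] by blast
qed

lemma polys_slice:
  assumes "F \<in> polys K (insert v V)" "0 \<in> K"
  shows "slice v s F \<in> polys K V"
proof -
  have "keys m \<subseteq> V" if "lookup m v = 0" "lookup F (m + single v s) \<noteq> 0" for m
  proof -
    have "keys (m + single v s) \<subseteq> insert v V" using assms that by (auto simp: polys_def)
    then show ?thesis using that by (auto simp: in_keys_iff keys_exponent_add)
  qed
  then show ?thesis using assms by (auto simp: polys_def lookup_slice)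
qed

lemma polys_free:
  assumes "F \<in> polys K V" "v \<notin> V" "lookup m v \<noteq> 0"
  shows "lookup F m = 0"
proof (rule ccontr)
  assume "lookup F m \<noteq> 0"
  then have "keys m \<subseteq> V" using assms(1) by (simp add: polys_def)
  moreover have "v \<in> keys m" using assms(3) by (simp add: in_keys_iff)
  ultimately show False using assms(2) by blast
qed

lemma slice_free:
  assumes "F \<in> polys K V" "v \<notin> V"
  shows "slice v s F = (if s = 0 then F else 0)"
proof (rule poly_mapping_eqI)
  fix m
  show "lookup (slice v s F) m = lookup (if s = 0 then F else 0) m"
    using polys_free[OF assms, of m] polys_free[OF assms, of "m + single v s"]
    by (auto simp: lookup_slice lookup_add)
qed

lemma polys_var_pow: "is_subring K \<Longrightarrow> v \<in> V \<Longrightarrow> var_pow v s \<in> polys K V"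
  unfolding var_pow_def by (rule polys_single) (auto simp: is_subringD is_subring_stable)

lemma var_pow_add: "var_pow v (r + s) = var_pow v r * var_pow v s"
  by (simp add: var_pow_def mult_single single_add)

context grading
begin

text \<open>The split-off power \<open>v^s\<close> has degree s. Hence truncation by total degree
  commutes with slicing up to a shift by s, and it cannot raise the degree in v.\<close>

lemma slice_lift_cp: "slice v s (lift_cp cp u F) = (if s \<le> u then lift_cp cp (u - s) (slice v s F) else 0)"
  by (rule poly_mapping_eqI) (auto simp: lookup_slice lookup_lift_cp edeg_add intro!: arg_cong2[where f = cp])

lemma polys_lift_cp:
  assumes "F \<in> polys K V" "0 \<in> K" "\<And>u x. x \<in> K \<Longrightarrow> cp u x \<in> K"
  shows "lift_cp cp u F \<in> polys K V"
  unfolding polys_def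
proof (intro CollectI allI conjI impI)
  fix m
  show "lookup (lift_cp cp u F) m \<in> K" using assms by (auto simp: lookup_lift_cp polys_def)
  assume "lookup (lift_cp cp u F) m \<noteq> 0"
  then have "lookup F m \<noteq> 0" by (auto simp: lookup_lift_cp split: if_splits)
  then show "keys m \<subseteq> V" using assms(1) by (simp add: polys_def)
qed

lemma lift_cp_var_pow: "cp 0 1 = 1 \<Longrightarrow> lift_cp cp s (var_pow v s) = var_pow v s"
  by (simp add: var_pow_def lift_cp_single)

lemma lift_cp_mConst: "lift_cp cp u (mConst a) = mConst (cp u a)"
  by (simp add: mConst_def lift_cp_single)

end

section \<open>Hilbert functions\<close>

text \<open>Eventually a polynomial of degree at most \<open>D\<close> with \<open>D\<close>-th coefficient \<open>e / D!\<close>.\<close>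

fun evpoly :: "nat \<Rightarrow> int \<Rightarrow> (nat \<Rightarrow> int) \<Rightarrow> bool" where
  "evpoly 0 e h \<longleftrightarrow> (\<exists>N. \<forall>t\<ge>N. h t = e)"
| "evpoly (Suc D) e h \<longleftrightarrow> evpoly D e (\<lambda>t. h (Suc t) - h t)"

lemma evpoly_add: "evpoly D e h \<Longrightarrow> evpoly D e' h' \<Longrightarrow> evpoly D (e + e') (\<lambda>t. h t + h' t)"
proof (induction D arbitrary: h h')
  case 0
  then obtain N N' where "\<forall>t\<ge>N. h t = e" "\<forall>t\<ge>N'. h' t = e'" by auto
  then show ?case by (auto intro!: exI[of _ "max N N'"])
next
  case (Suc D)
  have "evpoly D (e + e') (\<lambda>t. (h (Suc t) - h t) + (h' (Suc t) - h' t))"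
    using Suc.prems by (intro Suc.IH) simp_all
  then show ?case by (simp add: algebra_simps)
qed

lemma evpoly_zero: "evpoly D 0 (\<lambda>t. 0)"
  by (induction D) auto

lemma evpoly_sum:
  "(\<And>i. i \<in> S \<Longrightarrow> evpoly D (e i) (h i)) \<Longrightarrow> evpoly D (\<Sum>i\<in>S. e i) (\<lambda>t. \<Sum>i\<in>S. h i t)"
  by (induction S rule: infinite_finite_induct) (auto simp: evpoly_zero intro!: evpoly_add)

lemma evpoly_shift_iff: "evpoly D e (\<lambda>t. h (t + n)) \<longleftrightarrow> evpoly D e h"
proof (induction D arbitrary: h)
  case 0
  have "(\<exists>N. \<forall>t\<ge>N. h (t + n) = e) \<longleftrightarrow> (\<exists>N. \<forall>t\<ge>N. h t = e)"
  proof
    assume "\<exists>N. \<forall>t\<ge>N. h (t + n) = e"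
    then obtain N where N: "\<And>t. t \<ge> N \<Longrightarrow> h (t + n) = e" by blast
    have "h t = e" if "t \<ge> N + n" for t using N[of "t - n"] that by simp
    then show "\<exists>N. \<forall>t\<ge>N. h t = e" by blast
  qed (meson trans_le_add1)
  then show ?case by simp
next
  case (Suc D)
  show ?case using Suc.IH[of "\<lambda>t. h (Suc t) - h t"] by simp
qed

lemma evpoly_raise: "evpoly D e h \<Longrightarrow> evpoly (Suc D) 0 h"
proof (induction D arbitrary: h)
  case 0
  then obtain N where "\<forall>t\<ge>N. h t = e" by auto
  then show ?case by (auto intro!: exI[of _ N])
next
  case (Suc D)
  have "evpoly (Suc D) 0 (\<lambda>t. h (Suc t) - h t)" by (rule Suc.IH) (use Suc.prems in simp)
  then show ?case by (simp only: evpoly.simps(2))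
qed

lemma evpoly_psum: "evpoly D e h \<Longrightarrow> evpoly (Suc D) e (\<lambda>t. \<Sum>u<t. h u)"
  by simp

lemma evpoly_psum': "evpoly D e h \<Longrightarrow> evpoly (Suc D) e (\<lambda>t. \<Sum>u\<le>t. h u)"
  using evpoly_shift_iff[of D e h 1] by simp

text \<open>The difference is a sum of n consecutive first differences, each with the same leading
  term. This is the source of the factor n gained for each form of the regular sequence.\<close>

lemma evpoly_shift_diff: "evpoly (Suc D) e h \<Longrightarrow> evpoly D (int n * e) (\<lambda>t. h (t + n) - h t)"
proof (induction n)
  case 0
  then show ?case by (simp add: evpoly_zero)
next
  case (Suc n)
  have "evpoly D e (\<lambda>t. h (Suc (t + n)) - h (t + n))"
    using Suc.prems evpoly_shift_iff[of D e "\<lambda>t. h (Suc t) - h t" n] by simp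
  from evpoly_add[OF Suc.IH[OF Suc.prems] this] show ?case by (simp add: algebra_simps)
qed

lemma poly_antidifference:
  fixes p :: "real poly"
  assumes "Polynomial.degree p \<le> D"
  shows "\<exists>S. Polynomial.degree S \<le> Suc D \<and> coeff S (Suc D) * real (Suc D) = coeff p D \<and>
    (\<forall>x. poly S (x + 1) - poly S x = poly p x)"
  using assms
proof (induction D arbitrary: p)
  case 0
  then obtain a where a: "p = [:a:]" using degree_eq_zeroE[of p] by auto
  show ?case unfolding a by (intro exI[of _ "[:0, a:]"]) (simp add: algebra_simps)
next
  case (Suc D)
  let ?n = "Suc (Suc D)"
  \<comment> \<open>Q is the forward difference of x^(D+2). It has degree D + 1 and leading
    coefficient D + 2, so a multiple of it cancels the top coefficient of p.\<close>
  define Q :: "real poly" where "Q = [:1, 1:] ^ ?n - monom 1 ?n"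
  have cQ: "coeff Q i = real (?n choose i) - (if i = ?n then 1 else 0)" for i
  proof (cases "i \<le> ?n")
    case True
    then show ?thesis unfolding Q_def by (simp add: coeff_linear_poly_power del: power_Suc)
  next
    case False
    then have "Polynomial.degree ([:1, 1:] ^ ?n :: real poly) < i" unfolding degree_linear_power by simp
    then show ?thesis using False unfolding Q_def by (simp add: coeff_eq_0 del: power_Suc)
  qed
  have dQ: "coeff Q i = 0" if "i > Suc D" for i using that unfolding cQ by (cases "i = ?n") auto
  have lQ: "coeff Q (Suc D) = real ?n" unfolding cQ by simp
  define a where "a = coeff p (Suc D) / real ?n"
  define p' where "p' = p - Polynomial.smult a Q"
  have "coeff p' i = 0" if "i > D" for i
  proof (cases "i = Suc D")
    case True
    then show ?thesis by (simp add: p'_def lQ a_def)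
  next
    case False
    then have "i > Suc D" using that by simp
    then show ?thesis using Suc.prems dQ[of i] by (simp add: p'_def coeff_eq_0)
  qed
  then have "Polynomial.degree p' \<le> D" by (intro degree_le) auto
  from Suc.IH[OF this] obtain S where S: "Polynomial.degree S \<le> Suc D"
    "\<And>x. poly S (x + 1) - poly S x = poly p' x" by blast
  let ?S = "S + monom a ?n"
  have "Polynomial.degree ?S \<le> ?n" using S(1) by (intro degree_add_le degree_monom_le) auto
  moreover have "coeff ?S ?n * real ?n = coeff p (Suc D)" using S(1) by (simp add: coeff_eq_0 a_def)
  moreover have "poly ?S (x + 1) - poly ?S x = poly p x" for x
  proof -
    have Q: "poly Q x = (1 + x) ^ ?n - x ^ ?n" by (simp add: Q_def poly_monom del: power_Suc)
    have "poly ?S (x + 1) - poly ?S x = (poly S (x + 1) - poly S x) + a * ((1 + x) ^ ?n - x ^ ?n)"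
      by (simp add: poly_monom add.commute[of x 1] right_diff_distrib del: power_Suc)
    also have "\<dots> = poly p' x + a * poly Q x" by (simp only: S(2) Q)
    finally show ?thesis by (simp add: p'_def)
  qed
  ultimately show ?case by blast
qed

text \<open>An antidifference of the polynomial for the first difference recovers h up to a
  constant, which cannot touch the coefficient in degree D + 1. Each antidifference divides the top
  coefficient by the new degree, which accumulates to the factorial.\<close>

lemma evpoly_poly:
  "evpoly D e h \<Longrightarrow> \<exists>p :: real poly. Polynomial.degree p \<le> D \<and> fact D * coeff p D = real_of_int e \<and>
     (\<exists>N. \<forall>t\<ge>N. real_of_int (h t) = poly p (real t))"
proof (induction D arbitrary: h)
  case 0
  then obtain N where "\<forall>t\<ge>N. h t = e" by auto
  then show ?case by (intro exI[of _ "[:real_of_int e:]"] conjI exI[of _ N]) simp_all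
next
  case (Suc D)
  from Suc.IH[OF Suc.prems[unfolded evpoly.simps(2)]]
  obtain p :: "real poly" and N where p: "Polynomial.degree p \<le> D" "fact D * coeff p D = real_of_int e"
    "\<And>t. t \<ge> N \<Longrightarrow> real_of_int (h (Suc t) - h t) = poly p (real t)" by blast
  obtain S where S: "Polynomial.degree S \<le> Suc D" "coeff S (Suc D) * real (Suc D) = coeff p D"
    "\<And>x. poly S (x + 1) - poly S x = poly p x" using poly_antidifference[OF p(1)] by blast
  define c where "c = real_of_int (h N) - poly S (real N)"
  have eq: "real_of_int (h t) = poly S (real t) + c" if "t \<ge> N" for t
    using that
  proof (induction t rule: dec_induct)
    case base
    then show ?case by (simp add: c_def)
  next
    case (step t)
    then show ?case using p(3)[of t] S(3)[of "real t"] by (simp add: algebra_simps)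
  qed
  have "Polynomial.degree (S + [:c:]) \<le> Suc D" using S(1) by (intro degree_add_le) auto
  moreover have "fact (Suc D) * coeff (S + [:c:]) (Suc D) = real_of_int e"
    unfolding p(2)[symmetric] S(2)[symmetric] by (simp add: algebra_simps)
  moreover have "\<forall>t\<ge>N. real_of_int (h t) = poly (S + [:c:]) (real t)" using eq by simp
  ultimately show ?case by (intro exI[of _ "S + [:c:]"] conjI exI[of _ N])
qed

lemma real_poly_eqI_eventually:
  fixes p q :: "real poly"
  assumes "\<And>t. t \<ge> N \<Longrightarrow> poly p (real t) = poly q (real t)"
  shows "p = q"
proof (rule ccontr)
  assume "p \<noteq> q"
  then have "finite {x. poly (p - q) x = 0}" by (intro poly_roots_finite) simp
  moreover have "real ` {N..} \<subseteq> {x. poly (p - q) x = 0}" using assms by auto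
  ultimately have "finite (real ` {N..})" by (rule finite_subset[rotated])
  then have "finite {N..}" by (rule finite_imageD) (simp add: inj_on_def)
  then show False by (simp add: infinite_Ici)
qed

section \<open>Lengths of polynomial rings under conditions on the coefficients\<close>

definition mulops :: "'a::comm_ring_1 set \<Rightarrow> ('a \<Rightarrow> 'a) set" where
  "mulops C = (*) ` C"

lemma additive_mulops [simp]: "additive_ops (mulops C)"
  by (auto simp: additive_ops_def mulops_def distrib_left)

lemma stable_mulops_mult: "stable (mulops C) N \<Longrightarrow> c \<in> C \<Longrightarrow> x \<in> N \<Longrightarrow> c * x \<in> N"
  by (auto simp: stable_def mulops_def)

lemma stable_mulopsI:
  assumes "0 \<in> N" "\<And>x y. x \<in> N \<Longrightarrow> y \<in> N \<Longrightarrow> x + y \<in> N" "\<And>x. x \<in> N \<Longrightarrow> - x \<in> N"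
    "\<And>c x. c \<in> C \<Longrightarrow> x \<in> N \<Longrightarrow> c * x \<in> N"
  shows "stable (mulops C) N"
  using assms by (auto simp: stable_def mulops_def)

lemma stable_mulops_mono: "stable (mulops C) N \<Longrightarrow> C' \<subseteq> C \<Longrightarrow> stable (mulops C') N"
  by (auto simp: stable_def mulops_def)

lemma stable_is_subring: "is_subring X \<Longrightarrow> C \<subseteq> X \<Longrightarrow> stable (mulops C) X"
  by (rule stable_mulopsI) (auto simp: is_subringD)

definition coefset :: "(('v \<Rightarrow>\<^sub>0 nat) \<Rightarrow> 'a::comm_ring_1 set) \<Rightarrow> (('v \<Rightarrow>\<^sub>0 nat) \<Rightarrow>\<^sub>0 'a) set" where
  "coefset W = {F. \<forall>m. lookup F m \<in> W m}"

lemma stable_coefset: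
  assumes "\<And>m. stable (mulops C) (W m)"
  shows "stable (mulops (mConst ` C)) (coefset W)"
  by (rule stable_mulopsI)
    (use stableD(1-3)[OF assms] stable_mulops_mult[OF assms] in
      \<open>auto simp: coefset_def lookup_add lookup_mConst_mult\<close>)

text \<open>The conditions are relaxed one exponent at a time. Relaxing the one at \<open>b\<close>
  gives a quotient isomorphic to U b / W b through \<open>single b\<close>, and
  \<open>len_add\<close> adds up the contributions.\<close>

lemma len_coefset:
  assumes "finite \<Lambda>" "\<And>m. stable (mulops C) (W m)" "\<And>m. stable (mulops C) (U m)"
    "\<And>m. W m \<subseteq> U m" "\<And>m. m \<notin> \<Lambda> \<Longrightarrow> W m = U m"
  shows "len (mulops (mConst ` C)) (coefset W) (coefset U) = (\<Sum>m\<in>\<Lambda>. len (mulops C) (W m) (U m))"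
  using assms
proof (induction \<Lambda> arbitrary: W rule: finite_induct)
  case empty
  then have "W = U" by auto
  then show ?case by simp
next
  case (insert b \<Lambda>)
  define W' where "W' = W(b := U b)"
  note W = insert.prems(1) and U = insert.prems(2)
  have W': "stable (mulops C) (W' m)" for m using W U by (simp add: W'_def)
  have sub: "coefset W \<subseteq> coefset W'" "coefset W' \<subseteq> coefset U"
    using insert.prems(3) by (auto simp: coefset_def W'_def) blast+
  have "len (mulops (mConst ` C)) (coefset W) (coefset U) =
    len (mulops (mConst ` C)) (coefset W) (coefset W') + len (mulops (mConst ` C)) (coefset W') (coefset U)"
    by (rule len_add) (use sub W' W U in \<open>auto intro: stable_coefset\<close>)
  also have "len (mulops (mConst ` C)) (coefset W') (coefset U) = (\<Sum>m\<in>\<Lambda>. len (mulops C) (W' m) (U m))"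
    by (rule insert.IH) (use W' U insert.prems(3,4) in \<open>auto simp: W'_def\<close>)
  also have "\<dots> = (\<Sum>m\<in>\<Lambda>. len (mulops C) (W m) (U m))"
    by (intro sum.cong) (use insert.hyps in \<open>auto simp: W'_def\<close>)
  also have "len (mulops (mConst ` C)) (coefset W) (coefset W') = len (mulops C) (W b) (U b)"
  proof (rule len_iso[symmetric, where \<phi> = "single b"])
    show "coefset W' = set_sum (coefset W) (single b ` U b)"
    proof (intro antisym subsetI)
      fix F assume F: "F \<in> coefset W'"
      have "lookup F m \<in> W m" if "m \<noteq> b" for m
        using F that by (auto simp: coefset_def W'_def dest!: spec[of _ m])
      then have "F - single b (lookup F b) \<in> coefset W"
        using stableD(1)[OF W] by (auto simp: coefset_def lookup_minus lookup_single when_def)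
      moreover have "single b (lookup F b) \<in> single b ` U b" using F by (auto simp: coefset_def W'_def split: if_splits)
      ultimately show "F \<in> set_sum (coefset W) (single b ` U b)"
        unfolding set_sum_def by (intro CollectI exI[of _ "F - single b (lookup F b)"] exI[of _ "single b (lookup F b)"]) simp
    next
      fix F assume "F \<in> set_sum (coefset W) (single b ` U b)"
      then obtain G a where "F = G + single b a" "G \<in> coefset W" "a \<in> U b" by (auto simp: set_sum_def)
      then show "F \<in> coefset W'"
        using insert.prems(3)[of b] stableD(2)[OF U, of "lookup G b" b a]
        by (auto simp: coefset_def W'_def lookup_add lookup_single when_def)
    qed
    show "single b x \<in> coefset W \<longleftrightarrow> x \<in> W b" for x
      using stableD(1)[OF W] by (auto simp: coefset_def lookup_single when_def split: if_splits)
    show "\<exists>h'\<in>mulops (mConst ` C). \<forall>x\<in>U b. single b (h x) = h' (single b x)" if "h \<in> mulops C" for h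
      using that by (auto simp: mulops_def mConst_def mult_single)
    show "\<exists>h\<in>mulops C. \<forall>x\<in>U b. single b (h x) = h' (single b x)" if "h' \<in> mulops (mConst ` C)" for h'
      using that by (auto simp: mulops_def mConst_def mult_single)
  qed (use W W' U insert.prems(3) in \<open>auto intro: stable_coefset simp: single_add\<close>)
  finally show ?case using insert.hyps by simp
qed

definition expos :: "'v set \<Rightarrow> nat \<Rightarrow> ('v \<Rightarrow>\<^sub>0 nat) set" where
  "expos V u = {m. keys m \<subseteq> V \<and> edeg m \<le> u}"

lemma expos_empty: "expos {} u = {0}"
  by (auto simp: expos_def)

lemma expos_insert:
  assumes "v \<notin> V"
  shows "expos (insert v V) u = (\<Union>s\<le>u. (\<lambda>m. m + single v (u - s)) ` expos V s)"
proof (intro antisym subsetI)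
  fix m assume m: "m \<in> expos (insert v V) u"
  obtain m' where m': "m = m' + single v (lookup m v)" "lookup m' v = 0" "keys m' = keys m - {v}"
    by (rule exponent_split[of m v]) blast
  have "edeg m = edeg m' + lookup m v" by (subst m'(1)) (simp add: edeg_add)
  then have *: "edeg m' \<le> u - lookup m v" "lookup m v \<le> u" "keys m' \<subseteq> V"
    using m m'(3) by (auto simp: expos_def)
  show "m \<in> (\<Union>s\<le>u. (\<lambda>m. m + single v (u - s)) ` expos V s)"
    by (rule UN_I[of "u - lookup m v"], simp, rule image_eqI[of _ _ m'])
      (use * m'(1) in \<open>simp_all add: expos_def\<close>)
next
  fix m assume "m \<in> (\<Union>s\<le>u. (\<lambda>m. m + single v (u - s)) ` expos V s)"
  then show "m \<in> expos (insert v V) u"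
    by (auto simp: expos_def edeg_add keys_exponent_add split: if_splits)
qed

lemma finite_expos: "finite V \<Longrightarrow> finite (expos V u)"
proof (induction V arbitrary: u rule: finite_induct)
  case empty
  show ?case by (simp add: expos_empty)
qed (simp add: expos_insert)

text \<open>Exponents are sorted by the power u - s of the new variable; what remains has degree at
  most s and u minus the full degree becomes s minus the remaining one. A new variable therefore
  amounts to taking partial sums, which raises the degree of growth by one and keeps the leading
  term.\<close>

lemma sum_expos_insert:
  fixes g :: "nat \<Rightarrow> 'b::comm_monoid_add"
  assumes "finite V" "v \<notin> V"
  shows "(\<Sum>m\<in>expos (insert v V) u. g (u - edeg m)) = (\<Sum>s\<le>u. \<Sum>m\<in>expos V s. g (s - edeg m))"
proof -
  have lv: "lookup m v = 0" if "m \<in> expos V s" for m s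
    using that assms(2) by (metis (mono_tags, lifting) expos_def in_keys_iff mem_Collect_eq subsetD)
  have "(\<Sum>m\<in>expos (insert v V) u. g (u - edeg m)) =
      (\<Sum>s\<le>u. \<Sum>m\<in>(\<lambda>m. m + single v (u - s)) ` expos V s. g (u - edeg m))"
    unfolding expos_insert[OF assms(2)]
  proof (rule sum.UNION_disjoint)
    show "\<forall>i\<in>{..u}. \<forall>j\<in>{..u}. i \<noteq> j \<longrightarrow>
       (\<lambda>m. m + single v (u - i)) ` expos V i \<inter> (\<lambda>m. m + single v (u - j)) ` expos V j = {}"
    proof (intro ballI impI, rule ccontr)
      fix i j assume ij: "i \<in> {..u}" "j \<in> {..u}" "i \<noteq> j"
        "(\<lambda>m. m + single v (u - i)) ` expos V i \<inter> (\<lambda>m. m + single v (u - j)) ` expos V j \<noteq> {}"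
      then obtain m m' where mm: "m \<in> expos V i" "m' \<in> expos V j" "m + single v (u - i) = m' + single v (u - j)"
        by auto
      have "lookup (m + single v (u - i)) v = lookup (m' + single v (u - j)) v" using mm(3) by simp
      then show False using lv[OF mm(1)] lv[OF mm(2)] ij by (simp add: lookup_add)
    qed
  qed (use assms(1) finite_expos in auto)
  also have "\<dots> = (\<Sum>s\<le>u. \<Sum>m\<in>expos V s. g (s - edeg m))"
  proof (rule sum.cong[OF refl])
    fix s assume s: "s \<in> {..u}"
    have "(\<Sum>m\<in>(\<lambda>m. m + single v (u - s)) ` expos V s. g (u - edeg m)) =
        (\<Sum>m\<in>expos V s. g (u - edeg (m + single v (u - s))))"
      by (subst sum.reindex) (auto simp: inj_on_def)
    also have "\<dots> = (\<Sum>m\<in>expos V s. g (s - edeg m))"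
      by (rule sum.cong) (use s in \<open>auto simp: edeg_add expos_def intro!: arg_cong[of _ _ g]\<close>)
    finally show "(\<Sum>m\<in>(\<lambda>m. m + single v (u - s)) ` expos V s. g (u - edeg m)) =
        (\<Sum>m\<in>expos V s. g (s - edeg m))" .
  qed
  finally show ?thesis .
qed

lemma evpoly_expos:
  assumes "evpoly D e g"
  shows "evpoly (D + j) e (\<lambda>u. \<Sum>m\<in>expos {1..j::nat} u. g (u - edeg m))"
proof (induction j)
  case 0
  then show ?case using assms by (simp add: expos_empty)
next
  case (Suc j)
  have "{1..Suc j} = insert (Suc j) {1..j}" by auto
  then show ?case using evpoly_psum'[OF Suc.IH] by (simp add: sum_expos_insert)
qed

text \<open>By truncated subtraction the condition at an exponent of degree at least u is membership
  in \<open>W 0 = X\<close>, hence void, so finitely many exponents contribute.\<close>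

lemma len_polys:
  assumes X: "is_subring X" and C: "C \<subseteq> X" and V: "finite V"
    and W: "\<And>u. stable (mulops C) (W u)" "\<And>u. W u \<subseteq> X" "W 0 = X"
  shows "len (mulops (mConst ` C)) {F \<in> polys X V. \<forall>m. lookup F m \<in> W (u - edeg m)} (polys X V) =
    (\<Sum>m\<in>expos V u. len (mulops C) (W (u - edeg m)) X)"
proof -
  \<comment> \<open>Restriction to the variables in \<open>V\<close> is turned into a coefficient
    condition: elsewhere both sides admit only the coefficient 0.\<close>
  let ?U = "\<lambda>m. if keys m \<subseteq> V then X else {0}"
  let ?W = "\<lambda>m. if keys m \<subseteq> V then W (u - edeg m) else {0}"
  have z: "stable (mulops C) {0}" by (rule stable_mulopsI) auto
  have "polys X V = coefset ?U" using is_subringD(1)[OF X]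
    unfolding polys_def coefset_def by (intro Collect_cong all_cong1) auto
  moreover have "{F \<in> polys X V. \<forall>m. lookup F m \<in> W (u - edeg m)} = coefset ?W"
    using stableD(1)[OF W(1)] W(2) is_subringD(1)[OF X]
    unfolding polys_def coefset_def mem_Collect_eq all_conj_distrib[symmetric]
    by (intro Collect_cong all_cong1) (auto split: if_splits)
  moreover have "len (mulops (mConst ` C)) (coefset ?W) (coefset ?U) =
      (\<Sum>m\<in>expos V u. len (mulops C) (?W m) (?U m))"
    by (rule len_coefset)
      (use V W z stable_is_subring[OF X C] finite_expos[OF V, of u] in \<open>auto simp: expos_def\<close>)
  moreover have "\<dots> = (\<Sum>m\<in>expos V u. len (mulops C) (W (u - edeg m)) X)"
    by (rule sum.cong) (auto simp: expos_def)
  ultimately show ?thesis by simp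
qed

text \<open>The filtration by order. For polynomial rings with the total degree it is the filtration
  by powers of the homogeneous maximal ideal, see \<open>ideal_pow_eq_hi\<close>.\<close>

definition (in grading) hi :: "'a set \<Rightarrow> nat \<Rightarrow> 'a set" where
  "hi X i = {x \<in> X. \<forall>u<i. cp u x = 0}"

context grading
begin

lemma hi_0 [simp]: "hi X 0 = X"
  by (simp add: hi_def)

lemma hi_mono: "i \<le> j \<Longrightarrow> hi X j \<subseteq> hi X i"
  by (auto simp: hi_def)

lemma hi_subset: "hi X i \<subseteq> X"
  by (auto simp: hi_def)

lemma hi_mult:
  assumes "is_subring X" "x \<in> hi X i" "y \<in> hi X j"
  shows "x * y \<in> hi X (i + j)"
proof -
  have "cp u (x * y) = 0" if "u < i + j" for u
    unfolding cp_mult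
  proof (rule sum.neutral, intro ballI)
    fix a assume "a \<in> {..u}"
    then have "a < i \<or> u - a < j" using that by auto
    then show "cp a x * cp (u - a) y = 0" using assms(2,3) by (auto simp: hi_def)
  qed
  then show ?thesis using assms by (auto simp: hi_def is_subringD)
qed

lemma stable_hi: "is_subring X \<Longrightarrow> stable (mulops X) (hi X i)"
  by (rule stable_mulopsI) (use hi_mult[of X _ 0 _ i] in \<open>auto simp: hi_def is_subringD cp_add cp_uminus\<close>)

lemma diff_trunc_hi:
  assumes "is_subring X" "\<And>u x. x \<in> X \<Longrightarrow> cp u x \<in> X" "x \<in> X"
  shows "(\<Sum>i<t. cp i x) \<in> X" "x - (\<Sum>i<t. cp i x) \<in> hi X t"
proof -
  have st: "stable (mulops X) X" by (rule stable_is_subring) (use assms in auto)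
  show 1: "(\<Sum>i<t. cp i x) \<in> X" by (rule stable_sum[OF st]) (use assms in auto)
  show "x - (\<Sum>i<t. cp i x) \<in> hi X t" using 1 assms by (auto simp: hi_def is_subringD cp_diff cp_trunc)
qed

end

text \<open>\<open>X\<close> is a graded subring and \<open>C\<close> contains its elements of
  degree zero; in the application \<open>C\<close> consists of the field constants. Lengths over
  \<open>X\<close> will be traded for lengths over \<open>C\<close>.\<close>

locale connected_grading = grading +
  fixes X C
  assumes X: "is_subring X" and CX: "C \<subseteq> X"
    and cp_X: "x \<in> X \<Longrightarrow> cp u x \<in> X" and cp_0_C: "x \<in> X \<Longrightarrow> cp 0 x \<in> C"
begin

lemma stable_hi_sum:
  assumes "stable (mulops X) I"
  shows "stable (mulops X) (set_sum I (hi X i))" "stable (mulops C) (set_sum I (hi X i))"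
  using stable_set_sum[OF additive_mulops assms stable_hi[OF X]] stable_mulops_mono[OF _ CX] by auto

text \<open>An element c - cp 0 c has order at least 1, so it maps I + hi X i into I + hi X (i+1),
  which lies in N. Only the action of cp 0 c, an element of C, remains to be tested.\<close>

lemma stable_between_iff:
  assumes I: "stable (mulops X) I" and N: "set_sum I (hi X (Suc i)) \<subseteq> N" "N \<subseteq> set_sum I (hi X i)"
  shows "stable (mulops X) N \<longleftrightarrow> stable (mulops C) N"
proof
  assume "stable (mulops X) N"
  then show "stable (mulops C) N" by (rule stable_mulops_mono[OF _ CX])
next
  assume st: "stable (mulops C) N"
  show "stable (mulops X) N"
  proof (rule stable_mulopsI)
    fix c x assume c: "c \<in> X" and x: "x \<in> N"
    obtain a h where ah: "x = a + h" "a \<in> I" "h \<in> hi X i" using x N(2) by (auto simp: set_sum_def)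
    have c0: "cp 0 c \<in> C" "cp 0 c \<in> X" using cp_0_C[OF c] CX by auto
    have c1: "c - cp 0 c \<in> hi X 1"
      using c c0(2) X by (auto simp: hi_def is_subringD cp_diff cp_cp)
    have "(c - cp 0 c) * a \<in> I" using c1 ah(2) hi_subset by (intro stable_mulops_mult[OF I]) auto
    moreover have "(c - cp 0 c) * h \<in> hi X (Suc i)" using hi_mult[OF X c1 ah(3)] by simp
    ultimately have "(c - cp 0 c) * x \<in> set_sum I (hi X (Suc i))"
      unfolding set_sum_def ah(1) distrib_left by blast
    then have "(c - cp 0 c) * x \<in> N" using N(1) by auto
    moreover have "cp 0 c * x \<in> N" using stable_mulops_mult[OF st c0(1) x] .
    ultimately have "cp 0 c * x + (c - cp 0 c) * x \<in> N" using stableD(2)[OF st] by blast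
    then show "c * x \<in> N" by (simp add: algebra_simps)
  qed (use stableD[OF st] in auto)
qed

lemma len_graded_step:
  assumes I: "stable (mulops X) I"
  shows "len (mulops X) (set_sum I (hi X (Suc i))) (set_sum I (hi X i)) =
    len (mulops C) (set_sum I (hi X (Suc i))) (set_sum I (hi X i))"
proof -
  have "(\<lambda>N. stable (mulops X) N \<and> set_sum I (hi X (Suc i)) \<subseteq> N \<and> N \<subseteq> set_sum I (hi X i)) =
    (\<lambda>N. stable (mulops C) N \<and> set_sum I (hi X (Suc i)) \<subseteq> N \<and> N \<subseteq> set_sum I (hi X i))"
    using stable_between_iff[OF I] by (intro ext) metis
  then show ?thesis by (simp add: len_def)
qed

lemma hi_sum_mono: "set_sum I (hi X (Suc i)) \<subseteq> set_sum I (hi X i)"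
proof
  fix z assume "z \<in> set_sum I (hi X (Suc i))"
  then obtain x y where "z = x + y" "x \<in> I" "y \<in> hi X (Suc i)" by (auto simp: set_sum_def)
  moreover from this have "y \<in> hi X i" using hi_mono[of i "Suc i" X] by auto
  ultimately show "z \<in> set_sum I (hi X i)" by (auto simp: set_sum_def)
qed

lemma len_graded_aux:
  assumes I: "stable (mulops X) I" "I \<subseteq> X" and C': "stable (mulops X) X" "C' \<subseteq> X"
  shows "len (mulops C') (set_sum I (hi X t)) X =
    (\<Sum>i<t. len (mulops C') (set_sum I (hi X (Suc i))) (set_sum I (hi X i)))"
proof (induction t)
  case 0
  have "set_sum I X = X" using set_sum_least[OF C'(1) I(2)] set_sum_upper2[of I X] stableD(1)[OF I(1)] by auto
  then show ?case by simp
next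
  case (Suc t)
  have "len (mulops C') (set_sum I (hi X (Suc t))) X =
    len (mulops C') (set_sum I (hi X (Suc t))) (set_sum I (hi X t)) + len (mulops C') (set_sum I (hi X t)) X"
  proof (rule len_add)
    show "set_sum I (hi X t) \<subseteq> X" by (rule set_sum_least[OF C'(1) I(2) hi_subset])
  qed (use stable_mulops_mono[OF stable_hi_sum(1)[OF I(1)] C'(2)] stable_mulops_mono[OF C'] hi_sum_mono in auto)
  then show ?case using Suc by (simp add: add.commute)
qed

text \<open>Both lengths telescope along the filtration I + hi X i, and by
  \<open>stable_between_iff\<close> each step has the same submodules over \<open>X\<close> and over
  \<open>C\<close>. The first form converts the cumulative Hilbert function in the definition of
  multiplicity into one length over the constants.\<close>

lemma len_graded:
  assumes I: "stable (mulops X) I" "I \<subseteq> X"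
  shows "len (mulops C) (set_sum I (hi X t)) X =
      (\<Sum>i<t. len (mulops X) (set_sum I (hi X (Suc i))) (set_sum I (hi X i)))"
    and "len (mulops X) (set_sum I (hi X t)) X = len (mulops C) (set_sum I (hi X t)) X"
  using len_graded_aux[OF I stable_is_subring[OF X subset_refl], of C t]
    len_graded_aux[OF I stable_is_subring[OF X subset_refl], of X t] CX
  by (simp_all add: len_graded_step[OF I(1)])

end

section \<open>Linear syzygies of a regular sequence\<close>

text \<open>The ideal is formed relative to a subset \<open>X\<close> of the type, which will be a
  polynomial subring. The second rule yields an induction that adds one multiple of a generator at a
  time.\<close>

inductive_set ideal_hull :: "'a::comm_ring_1 set \<Rightarrow> 'a set \<Rightarrow> 'a set" for X G where
  hull_zero: "0 \<in> ideal_hull X G"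
| hull_add: "b \<in> X \<Longrightarrow> g \<in> G \<Longrightarrow> y \<in> ideal_hull X G \<Longrightarrow> b * g + y \<in> ideal_hull X G"

lemma stable_hull:
  assumes X: "is_subring X"
  shows "stable (mulops X) (ideal_hull X G)"
proof (rule stable_mulopsI)
  show mult: "c * x \<in> ideal_hull X G" if "c \<in> X" "x \<in> ideal_hull X G" for c x
    using that(2)
  proof induction
    case (hull_add b g y)
    have "(c * b) * g + c * y \<in> ideal_hull X G"
      by (rule ideal_hull.hull_add) (use hull_add that X in \<open>auto simp: is_subringD\<close>)
    then show ?case by (simp add: algebra_simps)
  qed (simp add: ideal_hull.hull_zero)
  show "x + y \<in> ideal_hull X G" if "x \<in> ideal_hull X G" "y \<in> ideal_hull X G" for x y
    using that by induction (auto simp: add.assoc intro: ideal_hull.hull_add)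
  show "- x \<in> ideal_hull X G" if "x \<in> ideal_hull X G" for x
    using mult[of "-1" x] that X by (simp add: is_subringD)
qed (rule ideal_hull.hull_zero)

lemma hull_least:
  assumes "stable (mulops X) N" "G \<subseteq> N"
  shows "ideal_hull X G \<subseteq> N"
proof
  fix x assume "x \<in> ideal_hull X G"
  then show "x \<in> N" by induction
    (use stableD(1,2)[OF assms(1)] stable_mulops_mult[OF assms(1)] assms(2) in auto)
qed

lemma hull_superset: "is_subring X \<Longrightarrow> G \<subseteq> ideal_hull X G"
  using hull_add[of 1 X _ G 0] by (auto simp: is_subringD hull_zero)

lemma hull_mono: "X \<subseteq> X' \<Longrightarrow> G \<subseteq> G' \<Longrightarrow> ideal_hull X G \<subseteq> ideal_hull X' G'"
proof
  fix x assume *: "X \<subseteq> X'" "G \<subseteq> G'" and "x \<in> ideal_hull X G"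
  from this(3) show "x \<in> ideal_hull X' G'" by induction (use * in \<open>auto intro: ideal_hull.intros\<close>)
qed

lemma stable_polys:
  assumes X: "is_subring X" and K: "stable (mulops X) K"
  shows "stable (mulops (polys X V)) (polys K V)"
proof -
  have K': "stable {} K" by (rule stable_subset[OF K]) simp
  show ?thesis
    by (rule stable_mulopsI)
      (use polys_mult_coeffs[OF X K'] stable_mulops_mult[OF K] in \<open>auto simp: polys_zero polys_add polys_uminus K'\<close>)
qed

lemma monom_power_eq: "monom a 1 ^ e = monom (a ^ e) e"
  for a :: "'a::comm_ring_1"
  by (induction e) (auto simp: mult_monom)

lemma monom_prod: "(\<Prod>v\<in>S. monom (g v) (e v)) = monom (\<Prod>v\<in>S. g v) (\<Sum>v\<in>S. e v)"
  for g :: "'v \<Rightarrow> 'a::comm_ring_1"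
  by (induction S rule: infinite_finite_induct) (auto simp: mult_monom)

lemma mon_monom: "mon (\<lambda>v. monom (f v) 1) m = monom (mon f m) (edeg m)"
  for f :: "'v \<Rightarrow> 'a::comm_ring_1"
  unfolding mon_def edeg_def monom_power_eq monom_prod ..

lemma exponent_pred:
  fixes m :: "'v \<Rightarrow>\<^sub>0 nat"
  assumes "i \<in> keys m"
  obtains m' where "m = m' + single i 1" "keys m' \<subseteq> keys m"
proof -
  have l: "lookup (m - single i 1) k = lookup m k - (if k = i then 1 else 0)" for k
    by (simp add: lookup_minus lookup_single when_def)
  have "m = (m - single i 1) + single i 1"
  proof (rule poly_mapping_eqI)
    fix k
    show "lookup m k = lookup ((m - single i 1) + single i 1) k"
      using assms by (auto simp: lookup_add l lookup_single when_def in_keys_iff simp del: One_nat_def)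
  qed
  moreover have "keys (m - single i 1) \<subseteq> keys m" by (auto simp: in_keys_iff l simp del: One_nat_def split: if_splits)
  ultimately show ?thesis using that by blast
qed

text \<open>Regularity is imposed on \<open>f 1\<close>, ..., \<open>f d\<close> while
  \<open>f (Suc d)\<close> is an arbitrary element of \<open>R\<close>. Membership in the ideals is
  spelled out through coefficient families.\<close>

locale reg_seq =
  fixes R :: "'a::comm_ring_1 set" and f :: "nat \<Rightarrow> 'a" and d :: nat
  assumes R: "is_subring R" and f_R: "i \<in> {1..Suc d} \<Longrightarrow> f i \<in> R"
    and regular: "j < d \<Longrightarrow> r \<in> R \<Longrightarrow> \<exists>a. (\<forall>i. a i \<in> R) \<and> r * f (Suc j) = (\<Sum>i\<in>{1..j}. a i * f i)
      \<Longrightarrow> \<exists>a. (\<forall>i. a i \<in> R) \<and> r = (\<Sum>i\<in>{1..j}. a i * f i)"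
begin

definition J :: "nat \<Rightarrow> 'a set" where
  "J j = {\<Sum>i\<in>{1..j}. a i * f i | a. \<forall>i. a i \<in> R}"

text \<open>This is also the colon of \<open>J j\<close> by \<open>J (Suc j)\<close>: multiples of
  \<open>f 1\<close>, ..., \<open>f j\<close> lie in \<open>J j\<close> in any case. For j = d it is
  J : I.\<close>

definition colon :: "nat \<Rightarrow> 'a set" where
  "colon j = {r \<in> R. r * f (Suc j) \<in> J j}"

definition B :: "nat \<Rightarrow> ((nat \<Rightarrow>\<^sub>0 nat) \<Rightarrow>\<^sub>0 'a) set" where
  "B j = polys R {1..j}"

text \<open>The map \<open>T\<^sub>i \<mapsto> f\<^sub>i t\<close> into \<open>R[t]\<close>, with image the Rees algebra.\<close>

definition ev :: "((nat \<Rightarrow>\<^sub>0 nat) \<Rightarrow>\<^sub>0 'a) \<Rightarrow> 'a poly" where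
  "ev = evalh (\<lambda>a. [:a:]) (\<lambda>i. monom (f i) 1)"

definition lin :: "nat \<Rightarrow> ((nat \<Rightarrow>\<^sub>0 nat) \<Rightarrow>\<^sub>0 'a) set" where
  "lin j = {\<Sum>i\<in>{1..j}. mConst (a i) * mVar i | a. (\<forall>i. a i \<in> R) \<and> (\<Sum>i\<in>{1..j}. a i * f i) = 0}"

definition L :: "nat \<Rightarrow> ((nat \<Rightarrow>\<^sub>0 nat) \<Rightarrow>\<^sub>0 'a) set" where
  "L j = ideal_hull (B j) (lin j)"

lemma R_stable: "stable (mulops R) R"
  by (rule stable_is_subring[OF R subset_refl])

lemma regular_J: "j < d \<Longrightarrow> r \<in> R \<Longrightarrow> r * f (Suc j) \<in> J j \<Longrightarrow> r \<in> J j"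
  using regular[of j r] by (auto simp: J_def)

lemma J_stable: "stable (mulops R) (J j)"
proof (rule stable_mulopsI)
  show "0 \<in> J j" unfolding J_def using is_subringD(1)[OF R] by (intro CollectI exI[of _ "\<lambda>_. 0"]) simp
next
  fix x y assume "x \<in> J j" "y \<in> J j"
  then obtain a b where "x = (\<Sum>i\<in>{1..j}. a i * f i)" "y = (\<Sum>i\<in>{1..j}. b i * f i)" "\<forall>i. a i \<in> R" "\<forall>i. b i \<in> R"
    by (auto simp: J_def)
  then show "x + y \<in> J j" unfolding J_def using is_subringD(3)[OF R]
    by (intro CollectI exI[of _ "\<lambda>i. a i + b i"]) (simp add: distrib_right sum.distrib)
next
  fix x assume "x \<in> J j"
  then obtain a where "x = (\<Sum>i\<in>{1..j}. a i * f i)" "\<forall>i. a i \<in> R" by (auto simp: J_def)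
  then show "- x \<in> J j" unfolding J_def using is_subringD(5)[OF R]
    by (intro CollectI exI[of _ "\<lambda>i. - a i"]) (simp add: sum_negf)
next
  fix c x assume "c \<in> R" "x \<in> J j"
  then obtain a where "x = (\<Sum>i\<in>{1..j}. a i * f i)" "\<forall>i. a i \<in> R" by (auto simp: J_def)
  then show "c * x \<in> J j" unfolding J_def using is_subringD(4)[OF R] \<open>c \<in> R\<close>
    by (intro CollectI exI[of _ "\<lambda>i. c * a i"]) (simp add: sum_distrib_left mult.assoc)
qed

lemma J_mult: "c \<in> R \<Longrightarrow> x \<in> J j \<Longrightarrow> c * x \<in> J j"
  by (rule stable_mulops_mult[OF J_stable])

lemma J_0: "J 0 = {0}"
  using is_subringD(1)[OF R] by (auto simp: J_def)

lemma J_Suc: "x \<in> J (Suc j) \<longleftrightarrow> (\<exists>y\<in>J j. \<exists>a\<in>R. x = y + a * f (Suc j))"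
proof
  assume "x \<in> J (Suc j)"
  then obtain a where "x = (\<Sum>i\<in>{1..Suc j}. a i * f i)" "\<forall>i. a i \<in> R" by (auto simp: J_def)
  then show "\<exists>y\<in>J j. \<exists>a\<in>R. x = y + a * f (Suc j)"
    by (intro bexI[of _ "\<Sum>i\<in>{1..j}. a i * f i"] bexI[of _ "a (Suc j)"]) (auto simp: J_def)
next
  assume "\<exists>y\<in>J j. \<exists>a\<in>R. x = y + a * f (Suc j)"
  then obtain a r where a: "\<forall>i. a i \<in> R" "r \<in> R" "x = (\<Sum>i\<in>{1..j}. a i * f i) + r * f (Suc j)" by (auto simp: J_def)
  have "(\<Sum>i\<in>{1..j}. (a(Suc j := r)) i * f i) = (\<Sum>i\<in>{1..j}. a i * f i)" by (rule sum.cong) auto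
  then show "x \<in> J (Suc j)" unfolding J_def using a
    by (intro CollectI exI[of _ "a(Suc j := r)"]) simp
qed

lemma J_mono: "J j \<subseteq> J (Suc j)"
  using is_subringD(1)[OF R] by (force simp: J_Suc)

lemma f_in_J: "i \<in> {1..j} \<Longrightarrow> f i \<in> J j"
proof (induction j)
  case (Suc j)
  show ?case
  proof (cases "i = Suc j")
    case True
    then show ?thesis using stableD(1)[OF J_stable] is_subringD(2)[OF R] by (force simp: J_Suc)
  qed (use Suc J_mono in auto)
qed simp

lemma J_subset: "j \<le> Suc d \<Longrightarrow> J j \<subseteq> R"
  unfolding J_def by (auto intro!: stable_sum[OF R_stable] is_subringD(4)[OF R] f_R)

lemma colon_stable: "stable (mulops R) (colon j)"
  by (rule stable_mulopsI)
    (use R J_mult in \<open>auto simp: colon_def is_subringD distrib_right mult.assoc stableD[OF J_stable]\<close>)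

lemma colon_subset: "colon j \<subseteq> R"
  by (auto simp: colon_def)

lemma J_subset_colon: "j \<le> d \<Longrightarrow> J j \<subseteq> colon j"
  using J_subset[of j] J_mult[of "f (Suc j)" _ j] f_R[of "Suc j"]
  by (auto simp: colon_def mult.commute)

lemma colon_eq_J: "j < d \<Longrightarrow> colon j = J j"
  using J_subset_colon[of j] regular_J by (auto simp: colon_def)

lemma is_subring_B: "is_subring (B j)"
  unfolding B_def by (rule is_subring_polys[OF R])

lemma B_stable: "stable (mulops (B j)) (B j)"
  by (rule stable_is_subring[OF is_subring_B subset_refl])

lemma B_mono: "B j \<subseteq> B (Suc j)"
  unfolding B_def by (rule polys_mono) auto

lemma stable_empty: "stable (mulops R) K \<Longrightarrow> stable {} K"
  by (rule stable_subset) auto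

lemmas K_stable = R_stable[THEN stable_empty] J_stable[THEN stable_empty] colon_stable[THEN stable_empty]

lemma polys_coeffs_mono: "K \<subseteq> K' \<Longrightarrow> polys K V \<subseteq> polys K' V"
  unfolding polys_def by blast

lemma mpJ_subset: "j \<le> Suc d \<Longrightarrow> polys (J j) {1..j} \<subseteq> B j"
  unfolding B_def by (rule polys_coeffs_mono[OF J_subset])

lemma mpJ_stable: "stable (mulops (B j)) (polys (J j) {1..j})"
  unfolding B_def by (rule stable_polys[OF R J_stable])

lemma mpcolon_stable: "stable (mulops (B j)) (polys (colon j) {1..j})"
  unfolding B_def by (rule stable_polys[OF R colon_stable])

lemma is_hom_pCons: "is_hom (\<lambda>a::'a. [:a:])"
  by (simp add: is_hom_def one_pCons)

lemma ev_hom: "is_hom ev"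
  unfolding ev_def by (rule is_hom_evalh[OF is_hom_pCons])

lemmas ev_simps = is_homD[OF ev_hom]

lemma ev_single: "ev (single m a) = monom (a * mon f m) (edeg m)"
  unfolding ev_def evalh_single[OF is_hom_pCons] mon_monom
  by (simp add: smult_monom)

lemma ev_mConst: "ev (mConst a) = [:a:]"
  by (simp add: mConst_def ev_single monom_0)

lemma ev_mVar: "ev (mVar i) = monom (f i) 1"
  by (simp add: mVar_def ev_single)

lemma ev_var_pow: "ev (var_pow v s) = monom (f v ^ s) s"
  by (simp add: var_pow_def ev_single)

lemma ev_lin: "ev (\<Sum>i\<in>{1..j}. mConst (a i) * mVar i) = monom (\<Sum>i\<in>{1..j}. a i * f i) 1"
proof -
  have "monom (\<Sum>i\<in>S. a i * f i) 1 = (\<Sum>i\<in>S. monom (a i * f i) 1)" for S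
    by (induction S rule: infinite_finite_induct) (auto simp: add_monom[symmetric])
  then show ?thesis by (simp add: is_hom_sum[OF ev_hom] ev_simps ev_mConst ev_mVar smult_monom)
qed

lemma lin_subset_B: "lin j \<subseteq> B j"
  unfolding lin_def B_def using R
  by (auto intro!: polys_sum polys_mult polys_mConst polys_mVar is_subring_stable)

lemma lin_ev: "x \<in> lin j \<Longrightarrow> ev x = 0"
  using ev_lin by (auto simp: lin_def)

lemma L_stable: "stable (mulops (B j)) (L j)"
  unfolding L_def by (rule stable_hull[OF is_subring_B])

lemma L_subset_B: "L j \<subseteq> B j"
  unfolding L_def by (rule hull_least[OF B_stable lin_subset_B])

lemma L_ev: "x \<in> L j \<Longrightarrow> ev x = 0"
  unfolding L_def by (induction rule: ideal_hull.induct) (auto simp: ev_simps lin_ev)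

lemma lin_mono: "lin j \<subseteq> lin (Suc j)"
proof
  fix x assume "x \<in> lin j"
  then obtain a where a: "x = (\<Sum>i\<in>{1..j}. mConst (a i) * mVar i)" "\<forall>i. a i \<in> R" "(\<Sum>i\<in>{1..j}. a i * f i) = 0"
    by (auto simp: lin_def)
  have "(\<Sum>i\<in>{1..j}. mConst ((a(Suc j := 0)) i) * mVar i) = x" unfolding a(1) by (rule sum.cong) auto
  moreover have "(\<Sum>i\<in>{1..j}. (a(Suc j := 0)) i * f i) = 0" unfolding a(3)[symmetric] by (rule sum.cong) auto
  ultimately show "x \<in> lin (Suc j)" unfolding lin_def
    using a(2) is_subringD(1)[OF R] by (intro CollectI exI[of _ "a(Suc j := 0)"]) simp
qed

lemma L_mono: "L j \<subseteq> L (Suc j)"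
  unfolding L_def by (rule hull_mono[OF B_mono lin_mono])

text \<open>The last coefficient lies in \<open>J j\<close> by regularity. Koszul syzygies then
  remove it and leave a syzygy of one form fewer, to which induction applies.\<close>

lemma syzygy_coeffs:
  assumes "j \<le> d" "\<And>i. a i \<in> R" "(\<Sum>i\<in>{1..j}. a i * f i) = 0" "i \<in> {1..j}"
  shows "a i \<in> J j"
  using assms
proof (induction j arbitrary: a i)
  case (Suc j)
  have eq: "(\<Sum>i\<in>{1..j}. a i * f i) + a (Suc j) * f (Suc j) = 0" using Suc.prems(3) by simp
  then have eq': "a (Suc j) * f (Suc j) = (\<Sum>i\<in>{1..j}. (- a i) * f i)"
    by (simp add: sum_negf eq_neg_iff_add_eq_0 add.commute)
  then have "a (Suc j) * f (Suc j) \<in> J j"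
    unfolding J_def using is_subringD(5)[OF R] Suc.prems(2) by (intro CollectI exI[of _ "\<lambda>i. - a i"]) simp
  then have aJ: "a (Suc j) \<in> J j" using regular_J[of j] Suc.prems(1,2) by simp
  then obtain b where b: "\<And>i. b i \<in> R" "a (Suc j) = (\<Sum>i\<in>{1..j}. b i * f i)" by (auto simp: J_def)
  have fR: "f (Suc j) \<in> R" using f_R Suc.prems(1) by simp
  \<comment> \<open>Adding b i times the Koszul syzygy between \<open>f i\<close> and
    \<open>f (Suc j)\<close>, for every i, cancels the coefficient of
    \<open>f (Suc j)\<close>.\<close>
  have "(\<Sum>i\<in>{1..j}. (a i + b i * f (Suc j)) * f i) = 0"
    using eq unfolding b(2) by (simp add: algebra_simps sum.distrib sum_distrib_left)
  then have *: "a i + b i * f (Suc j) \<in> J j" if "i \<in> {1..j}" for i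
    using Suc.IH[of "\<lambda>i. a i + b i * f (Suc j)" i] Suc.prems(1,2) that b(1) fR R
    by (simp add: is_subringD)
  show ?case
  proof (cases "i = Suc j")
    case True
    then show ?thesis using aJ J_mono by auto
  next
    case False
    then have "a i + b i * f (Suc j) \<in> J (Suc j)" using *[of i] Suc.prems(4) J_mono by auto
    moreover have "b i * f (Suc j) \<in> J (Suc j)" using b(1) J_mult f_in_J[of "Suc j" "Suc j"] by auto
    ultimately have "(a i + b i * f (Suc j)) - b i * f (Suc j) \<in> J (Suc j)" by (rule stableD(5)[OF J_stable])
    then show ?thesis by simp
  qed
qed simp

lemma L_subset_mpJ:
  assumes "j \<le> d"
  shows "L j \<subseteq> polys (J j) {1..j}"
  unfolding L_def
proof (rule hull_least[OF mpJ_stable], rule subsetI)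
  fix x assume "x \<in> lin j"
  then obtain a where a: "x = (\<Sum>i\<in>{1..j}. mConst (a i) * mVar i)" "\<And>i. a i \<in> R" "(\<Sum>i\<in>{1..j}. a i * f i) = 0"
    by (auto simp: lin_def)
  have "mConst (a i) * mVar i \<in> polys (J j) {1..j}" if "i \<in> {1..j}" for i
    unfolding mConst_def mVar_def mult_single
    using syzygy_coeffs[OF assms a(2,3) that] that by (intro polys_single K_stable) auto
  then show "x \<in> polys (J j) {1..j}" unfolding a(1) by (intro polys_sum K_stable)
qed

text \<open>Coefficients are placed in degree zero, so p counts the variables T alone. This is the
  degree that \<open>ev\<close> turns into the exponent of t.\<close>

definition T_comp :: "nat \<Rightarrow> ((nat \<Rightarrow>\<^sub>0 nat) \<Rightarrow>\<^sub>0 'a) \<Rightarrow> ((nat \<Rightarrow>\<^sub>0 nat) \<Rightarrow>\<^sub>0 'a)" where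
  "T_comp = lift_cp trivial_cp"

lemma lookup_T_comp: "lookup (T_comp p F) m = (if edeg m = p then lookup F m else 0)"
  unfolding T_comp_def grading.lookup_lift_cp[OF grading_trivial_cp] by (auto simp: trivial_cp_def)

lemma ev_T_comp: "ev (T_comp p F) = monom (coeff (ev F) p) p"
proof (induction F rule: poly_mapping_induct)
  case (single m a)
  have "T_comp p (single m a) = (if edeg m = p then single m a else 0)"
    by (rule poly_mapping_eqI) (auto simp: lookup_T_comp lookup_single when_def)
  then show ?case by (auto simp: ev_single ev_simps)
next
  case (add F G)
  have "T_comp p (F + G) = T_comp p F + T_comp p G" by (rule poly_mapping_eqI) (simp add: lookup_T_comp lookup_add)
  then show ?case using add by (simp add: ev_simps add_monom)
qed

lemma T_comp_polys: "stable {} K \<Longrightarrow> F \<in> polys K V \<Longrightarrow> T_comp p F \<in> polys K V"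
  using stableD(1)[of "{}" K] by (auto simp: polys_def lookup_T_comp)

text \<open>Apply \<open>QR\<close> to the part of F in one T-degree, which \<open>ev\<close> kills
  on its own. \<open>QR\<close> is the quasi-regularity of \<open>f 1\<close>, ...,
  \<open>f j\<close>; it is a hypothesis because the induction proving linear type supplies it for j
  while working on j + 1.\<close>

lemma coeff_vanish:
  assumes QR: "\<And>F. F \<in> B j \<Longrightarrow> ev F = 0 \<Longrightarrow> F \<in> polys (J j) {1..j}"
    and F: "F \<in> B j" "coeff (ev F) (edeg m) = 0"
  shows "lookup F m \<in> J j"
proof -
  have "T_comp (edeg m) F \<in> polys (J j) {1..j}"
    by (rule QR) (use F in \<open>auto simp: B_def T_comp_polys K_stable ev_T_comp\<close>)
  then have "lookup (T_comp (edeg m) F) m \<in> J j" by (simp add: polys_def)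
  then show ?thesis by (simp add: lookup_T_comp)
qed

text \<open>The power \<open>(J j)\<^sup>p\<close>, as the component of the Rees algebra in \<open>t\<close>-degree \<open>p\<close>.\<close>

definition J_pow :: "nat \<Rightarrow> nat \<Rightarrow> 'a set" where
  "J_pow j p = (\<lambda>F. coeff (ev F) p) ` B j"

text \<open>One factor f i is moved from the monomial into the coefficient, or back: a form of
  degree p + 1 over \<open>R\<close> and a form of degree p over \<open>J j\<close> take the same
  values at the f i.\<close>

lemma J_pow_Suc:
  assumes "j \<le> d"
  shows "J_pow j (Suc p) = (\<lambda>F. coeff (ev F) p) ` polys (J j) {1..j}"
proof (intro antisym subsetI)
  fix x assume "x \<in> J_pow j (Suc p)"
  then obtain F where F: "F \<in> B j" "x = coeff (ev F) (Suc p)" by (auto simp: J_pow_def)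
  have "\<exists>Y\<in>polys (J j) {1..j}. coeff (ev F) (Suc p) = coeff (ev Y) p"
    using K_stable(1) F(1)[unfolded B_def]
  proof (induction rule: polys_induct)
    case (single m a)
    show ?case
    proof (cases "edeg m = Suc p")
      case False
      then show ?thesis by (intro bexI[of _ 0]) (auto simp: ev_single ev_simps polys_zero K_stable)
    next
      case True
      then have "keys m \<noteq> {}" by (auto simp: edeg_def)
      then obtain i where i: "i \<in> keys m" by blast
      obtain m' where m': "m = m' + single i 1" "keys m' \<subseteq> keys m" by (rule exponent_pred[OF i])
      have ij: "i \<in> {1..j}" using i single by auto
      have "single m' (a * f i) \<in> polys (J j) {1..j}"
        using single m' J_mult[OF _ f_in_J[OF ij]] by (intro polys_single K_stable) auto
      moreover have "coeff (ev (single m a)) (Suc p) = coeff (ev (single m' (a * f i))) p"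
        using True unfolding m'(1) by (simp add: ev_single edeg_add mon_add mult_ac)
      ultimately show ?thesis by blast
    qed
  next
    case (add F G)
    then obtain Y Y' where "Y \<in> polys (J j) {1..j}" "coeff (ev F) (Suc p) = coeff (ev Y) p"
      "Y' \<in> polys (J j) {1..j}" "coeff (ev G) (Suc p) = coeff (ev Y') p" by blast
    then show ?case by (intro bexI[of _ "Y + Y'"]) (auto simp: ev_simps polys_add K_stable)
  qed
  then show "x \<in> (\<lambda>F. coeff (ev F) p) ` polys (J j) {1..j}" using F(2) by auto
next
  fix x assume "x \<in> (\<lambda>F. coeff (ev F) p) ` polys (J j) {1..j}"
  then obtain Y where Y: "Y \<in> polys (J j) {1..j}" "x = coeff (ev Y) p" by auto
  have "\<exists>F\<in>B j. coeff (ev Y) p = coeff (ev F) (Suc p)"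
    using K_stable(2) Y(1)
  proof (induction rule: polys_induct)
    case (single m a)
    then obtain b where b: "\<And>i. b i \<in> R" "a = (\<Sum>i\<in>{1..j}. b i * f i)" by (auto simp: J_def)
    let ?F = "\<Sum>i\<in>{1..j}. single (m + single i 1) (b i)"
    have "?F \<in> B j" unfolding B_def
      by (intro polys_sum polys_single K_stable) (use b single in \<open>auto simp: keys_exponent_add\<close>)
    moreover have "coeff (ev (single m a)) p = coeff (ev ?F) (Suc p)"
      unfolding b(2) is_hom_sum[OF ev_hom] coeff_sum
      by (simp add: ev_single edeg_add mon_add sum_distrib_left sum_distrib_right mult_ac)
    ultimately show ?case by blast
  next
    case (add F G)
    then obtain Y Y' where "Y \<in> B j" "coeff (ev F) p = coeff (ev Y) (Suc p)"
      "Y' \<in> B j" "coeff (ev G) p = coeff (ev Y') (Suc p)" by blast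
    then show ?case by (intro bexI[of _ "Y + Y'"]) (auto simp: ev_simps B_def polys_add K_stable)
  qed
  then show "x \<in> J_pow j (Suc p)" using Y(2) by (auto simp: J_pow_def)
qed

lemma J_pow_antimono: "j \<le> d \<Longrightarrow> p \<le> q \<Longrightarrow> J_pow j q \<subseteq> J_pow j p"
proof -
  assume j: "j \<le> d" and "p \<le> q"
  from this(2) show "J_pow j q \<subseteq> J_pow j p"
  proof (induction q rule: dec_induct)
    case (step q)
    have "J_pow j (Suc q) \<subseteq> J_pow j q" unfolding J_pow_Suc[OF j] unfolding J_pow_def using mpJ_subset[of j] j by auto
    then show ?case using step by blast
  qed simp
qed

lemma J_pow_stable: "stable (mulops R) (J_pow j p)"
  unfolding J_pow_def
proof (rule stable_image[OF B_stable])
  fix h assume "h \<in> mulops R"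
  then obtain c where c: "c \<in> R" "h = (*) c" by (auto simp: mulops_def)
  have "mConst c \<in> B j" unfolding B_def using c by (intro polys_mConst K_stable)
  then show "\<exists>h'\<in>mulops (B j). \<forall>F\<in>B j. coeff (ev (h' F)) p = h (coeff (ev F) p)"
    by (intro bexI[of _ "(*) (mConst c)"]) (auto simp: mulops_def c(2) ev_simps ev_mConst)
qed (simp add: ev_simps)

text \<open>Induction on p. If x is the value of a form X of degree p and x f (j+1) that of a form Y
  with coefficients in \<open>J j\<close>, then quasi-regularity puts the coefficients of f (j+1) X
  into \<open>J j\<close>; regularity modulo \<open>J j\<close> puts those of X there, which gains
  one power.\<close>

lemma regular_J_pow:
  assumes j: "j < d" and QR: "\<And>F. F \<in> B j \<Longrightarrow> ev F = 0 \<Longrightarrow> F \<in> polys (J j) {1..j}"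
    and x: "x \<in> R" "x * f (Suc j) \<in> J_pow j p"
  shows "x \<in> J_pow j p"
  using x(2)
proof (induction p)
  case 0
  have "mConst x \<in> B j" unfolding B_def using x by (intro polys_mConst K_stable)
  then show ?case unfolding J_pow_def by (intro image_eqI[of _ _ "mConst x"]) (simp_all add: ev_mConst)
next
  case (Suc p)
  have fR: "f (Suc j) \<in> R" using j f_R by simp
  have "x * f (Suc j) \<in> J_pow j p" using Suc.prems J_pow_antimono[of j p "Suc p"] j by auto
  then obtain X where X: "X \<in> B j" "x = coeff (ev X) p" using Suc.IH by (auto simp: J_pow_def)
  obtain Y where Y: "Y \<in> polys (J j) {1..j}" "x * f (Suc j) = coeff (ev Y) p"
    using Suc.prems j by (auto simp: J_pow_Suc)
  \<comment> \<open>Both parts of the difference have the value x f (j+1) in t-degree p, so its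
    coefficients in T-degree p fall under \<open>coeff_vanish\<close>.\<close>
  let ?W = "mConst (f (Suc j)) * X - Y"
  have cB: "mConst (f (Suc j)) \<in> B j" unfolding B_def using fR by (intro polys_mConst K_stable)
  have W: "?W \<in> B j"
    using is_subringD(6)[OF is_subring_B is_subringD(4)[OF is_subring_B cB X(1)]] Y(1) mpJ_subset[of j] j by auto
  have "coeff (ev ?W) p = 0" using X(2) Y(2) by (simp add: ev_simps ev_mConst mult.commute)
  then have *: "lookup ?W m \<in> J j" if "edeg m = p" for m
    using coeff_vanish[OF QR W, of m] that by simp
  have "lookup X m \<in> J j" if "edeg m = p" for m
  proof -
    have "lookup ?W m + lookup Y m \<in> J j"
      using *[OF that] Y(1) by (intro stableD(2)[OF J_stable]) (auto simp: polys_def)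
    then have "f (Suc j) * lookup X m \<in> J j"
      by (simp add: lookup_minus lookup_mConst_mult)
    then show ?thesis using regular_J[OF j] X(1) by (simp add: B_def polys_def mult.commute)
  qed
  then have "T_comp p X \<in> polys (J j) {1..j}"
    using X(1) stableD(1)[OF J_stable] by (auto simp: B_def polys_def lookup_T_comp)
  moreover have "x = coeff (ev (T_comp p X)) p" using X(2) by (simp add: ev_T_comp)
  ultimately show ?case using j by (auto simp: J_pow_Suc)
qed

section \<open>Leading coefficients in the last variable and linear type\<close>

lemma syzygy_lift:
  assumes "a \<in> colon j"
  obtains y where "y \<in> B j" "mConst a * mVar (Suc j) + y \<in> lin (Suc j)"
proof -
  obtain b where b: "\<And>i. b i \<in> R" "a * f (Suc j) = (\<Sum>i\<in>{1..j}. b i * f i)"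
    using assms by (auto simp: colon_def J_def)
  let ?e = "\<lambda>i. if i = Suc j then a else - b i"
  let ?y = "\<Sum>i\<in>{1..j}. mConst (- b i) * mVar i"
  have "?y \<in> B j" unfolding B_def
    by (intro polys_sum polys_mult polys_mConst polys_mVar K_stable R) (use b R in \<open>auto simp: is_subringD\<close>)
  moreover have "mConst a * mVar (Suc j) + ?y \<in> lin (Suc j)"
    unfolding lin_def
  proof (intro CollectI exI[of _ ?e] conjI allI)
    have "(\<Sum>i\<in>{1..j}. mConst (?e i) * mVar i) = ?y" by (rule sum.cong) auto
    then show "mConst a * mVar (Suc j) + ?y = (\<Sum>i\<in>{1..Suc j}. mConst (?e i) * mVar i)" by simp
    have "(\<Sum>i\<in>{1..j}. ?e i * f i) = (\<Sum>i\<in>{1..j}. - (b i * f i))" by (rule sum.cong) auto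
    then show "(\<Sum>i\<in>{1..Suc j}. ?e i * f i) = 0" using b(2) by (simp add: sum_negf)
    show "?e i \<in> R" for i using b(1) assms R by (auto simp: colon_def is_subringD)
  qed
  ultimately show ?thesis using that by blast
qed

lemma slice_B: "b \<in> B j \<Longrightarrow> slice (Suc j) s b = (if s = 0 then b else 0)"
  unfolding B_def by (rule slice_free) auto

lemma slice_mult_B: "b \<in> B j \<Longrightarrow> slice (Suc j) s (b * F) = b * slice (Suc j) s F"
  unfolding B_def by (rule slice_mult_free) (rule polys_free, auto)

lemma slice_in_B: "F \<in> B (Suc j) \<Longrightarrow> slice (Suc j) s F \<in> B j"
proof -
  assume "F \<in> B (Suc j)"
  moreover have "{1..Suc j} = insert (Suc j) {1..j}" by auto
  ultimately show ?thesis unfolding B_def using is_subringD(1)[OF R] by (intro polys_slice) simp_all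
qed

text \<open>A coefficient in the colon ideal extends to a linear syzygy, whose form has degree one
  in the last variable. Multiplying by the power s - 1 and a monomial puts it in place, hence the
  bound on s.\<close>

lemma colon_lead:
  assumes "b \<in> polys (colon j) {1..j}" "s \<ge> 1"
  shows "\<exists>l\<in>L (Suc j). slice (Suc j) s l = b \<and> (\<forall>s'>s. slice (Suc j) s' l = 0)"
  using K_stable(3) assms(1)
proof (induction rule: polys_induct)
  case (single m a)
  obtain y where y: "y \<in> B j" "mConst a * mVar (Suc j) + y \<in> lin (Suc j)"
    using syzygy_lift[OF single(1)] by blast
  have mB: "single m 1 \<in> B j" "single m a \<in> B j" unfolding B_def
    using single is_subringD(2)[OF R] colon_subset by (auto intro!: polys_single K_stable)
  let ?u = "var_pow (Suc j) (s - 1) * single m 1"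
  let ?l = "?u * (mConst a * mVar (Suc j) + y)"
  have "var_pow (Suc j) (s - 1) \<in> B (Suc j)" unfolding B_def by (intro polys_var_pow[OF R]) auto
  then have "?u \<in> B (Suc j)" using mB(1) B_mono is_subringD(4)[OF is_subring_B] by blast
  then have "?l \<in> L (Suc j)" unfolding L_def
    using ideal_hull.hull_add[OF _ y(2) hull_zero, of ?u] by simp
  moreover have "?l = var_pow (Suc j) s * single m a + var_pow (Suc j) (s - 1) * (single m 1 * y)"
  proof -
    have T: "var_pow (Suc j) (s - 1) * mVar (Suc j) = (var_pow (Suc j) s :: (nat \<Rightarrow>\<^sub>0 nat) \<Rightarrow>\<^sub>0 'a)"
    proof -
      have m: "mVar (Suc j) = var_pow (Suc j) 1" by (simp add: mVar_def var_pow_def)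
      show ?thesis unfolding m var_pow_add[symmetric] using assms(2) by simp
    qed
    have M: "single m 1 * mConst a = single m a" by (simp add: mConst_def mult_single)
    have "?l = (var_pow (Suc j) (s - 1) * mVar (Suc j)) * (single m 1 * mConst a) + var_pow (Suc j) (s - 1) * (single m 1 * y)"
      by (simp only: distrib_left mult_ac)
    then show ?thesis unfolding T M .
  qed
  moreover have my: "single m 1 * y \<in> B j" using mB y is_subringD(4)[OF is_subring_B] by blast
  ultimately show ?case using assms(2)
    by (intro bexI[of _ ?l]) (auto simp: slice_add slice_var_pow_mult slice_B[OF my] slice_B[OF mB(2)])
next
  case (add F G)
  then obtain l l' where "l \<in> L (Suc j)" "l' \<in> L (Suc j)" "slice (Suc j) s l = F" "slice (Suc j) s l' = G"
    "\<forall>s'>s. slice (Suc j) s' l = 0" "\<forall>s'>s. slice (Suc j) s' l' = 0" by blast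
  then show ?case using stableD(2)[OF L_stable] by (intro bexI[of _ "l + l'"]) (auto simp: slice_add)
qed

lemma ev_slices:
  assumes "\<And>s'. s' > s \<Longrightarrow> slice v s' F = 0"
  shows "ev F = (\<Sum>i\<le>s. monom (f v ^ i) i * ev (slice v i F))"
proof -
  have "ev F = ev (\<Sum>i\<le>s. var_pow v i * slice v i F)"
    by (rule arg_cong[OF slice_expansion_bounded[OF assms]])
  then show ?thesis by (simp add: is_hom_sum[OF ev_hom] ev_simps ev_var_pow)
qed

text \<open>With \<open>g = f (Suc j)\<close>, comparing \<open>t\<close>-coefficients in \<open>ev F = 0\<close> puts \<open>g\<^sup>s\<close> times a coefficient of the
  top slice into the next power of \<open>J j\<close>, and \<open>g\<close> is regular modulo these powers.\<close>

lemma kernel_lead: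
  assumes j: "j < d" and QR: "\<And>F. F \<in> B j \<Longrightarrow> ev F = 0 \<Longrightarrow> F \<in> polys (J j) {1..j}"
    and F: "F \<in> B (Suc j)" "ev F = 0" and s: "\<And>s'. s' > s \<Longrightarrow> slice (Suc j) s' F = 0"
  shows "slice (Suc j) s F \<in> polys (J j) {1..j}"
proof -
  let ?G = "\<lambda>i. slice (Suc j) i F" and ?g = "f (Suc j)"
  have gR: "?g ^ i \<in> R" for i
    using f_R[of "Suc j"] j by (induction i) (auto simp: is_subringD R)
  have GB: "?G i \<in> B j" for i by (rule slice_in_B[OF F(1)])
  have "lookup (?G s) m \<in> J j" for m
  proof -
    define p where "p = edeg m"
    have xPw: "coeff (ev (?G i)) q \<in> J_pow j q" for i q unfolding J_pow_def using GB by auto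
    have evF: "ev F = (\<Sum>i\<le>s. monom (?g ^ i) i * ev (?G i))" by (rule ev_slices[OF s])
    have "(\<Sum>i\<le>s. coeff (monom (?g ^ i) i * ev (?G i)) (p + s)) = coeff (ev F) (p + s)"
      by (simp only: evF coeff_sum)
    also have "\<dots> = 0" by (simp add: F(2))
    finally have "(\<Sum>i<s. coeff (monom (?g ^ i) i * ev (?G i)) (p + s)) + coeff (monom (?g ^ s) s * ev (?G s)) (p + s) = 0"
      by (simp add: lessThan_Suc_atMost[symmetric])
    then have eq: "?g ^ s * coeff (ev (?G s)) p = - (\<Sum>i<s. coeff (monom (?g ^ i) i * ev (?G i)) (p + s))"
      by (simp add: coeff_monom_mult eq_neg_iff_add_eq_0 add.commute)
    \<comment> \<open>The slice at i < s contributes its t-coefficient of index p + s - i, which is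
      at least p + 1, so it belongs to the next power of \<open>J j\<close>.\<close>
    have "coeff (monom (?g ^ i) i * ev (?G i)) (p + s) \<in> J_pow j (Suc p)" if "i < s" for i
    proof -
      have "coeff (ev (?G i)) (p + s - i) \<in> J_pow j (Suc p)"
      proof -
        have "Suc p \<le> p + s - i" using that by linarith
        then show ?thesis using xPw[of i "p + s - i"] J_pow_antimono[of j "Suc p" "p + s - i"] j by auto
      qed
      then show ?thesis using stable_mulops_mult[OF J_pow_stable gR] that by (simp add: coeff_monom_mult)
    qed
    then have "?g ^ s * coeff (ev (?G s)) p \<in> J_pow j (Suc p)"
      unfolding eq by (intro stableD(3)[OF J_pow_stable] stable_sum[OF J_pow_stable]) simp
    moreover have "x \<in> R \<Longrightarrow> ?g ^ e * x \<in> J_pow j (Suc p) \<Longrightarrow> x \<in> J_pow j (Suc p)" for e x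
    proof (induction e)
      case (Suc e)
      have "(?g ^ e * x) * f (Suc j) \<in> J_pow j (Suc p)" using Suc.prems by (simp add: mult_ac)
      then have "?g ^ e * x \<in> J_pow j (Suc p)"
        using regular_J_pow[OF j QR] gR Suc.prems R by (simp add: is_subringD)
      then show ?case using Suc by simp
    qed simp
    moreover have "coeff (ev (?G s)) p \<in> R"
    proof -
      have "J_pow j 0 \<subseteq> R"
      proof
        fix x assume "x \<in> J_pow j 0"
        then obtain F where F: "F \<in> B j" "x = coeff (ev F) 0" by (auto simp: J_pow_def)
        have "coeff (ev F) 0 \<in> R" using K_stable(1) F(1)[unfolded B_def]
          by (induction rule: polys_induct) (auto simp: ev_single ev_simps is_subringD R)
        then show "x \<in> R" using F by simp
      qed
      then show ?thesis using xPw[of s p] J_pow_antimono[of j 0 p] j by auto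
    qed
    ultimately have "coeff (ev (?G s)) p \<in> J_pow j (Suc p)" by blast
    then obtain Y where Y: "Y \<in> polys (J j) {1..j}" "coeff (ev (?G s)) p = coeff (ev Y) p"
      using j by (auto simp: J_pow_Suc)
    \<comment> \<open>Y has coefficients in \<open>J j\<close> and the same t-coefficient at p as
      the top slice, so quasi-regularity applies to the difference in T-degree p.\<close>
    have "?G s - Y \<in> B j" using is_subringD(6)[OF is_subring_B GB] Y(1) mpJ_subset[of j] j by auto
    then have "lookup (?G s - Y) m \<in> J j"
      using coeff_vanish[OF QR, of "?G s - Y" m] Y(2) by (simp add: ev_simps p_def)
    then have "lookup (?G s - Y) m + lookup Y m \<in> J j"
      using Y(1) by (intro stableD(2)[OF J_stable]) (auto simp: polys_def)
    then show ?thesis by (simp add: lookup_minus)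
  qed
  then show ?thesis using GB[of s] by (simp add: B_def polys_def)
qed

text \<open>Besides the induction on j there is one on the degree in the last variable:
  \<open>kernel_lead\<close> places the top slice over \<open>J j\<close>, \<open>colon_lead\<close>
  provides an element of \<open>L (Suc j)\<close> with the same top slice, and subtracting it lowers
  the degree.\<close>

lemma linear_type:
  assumes "j \<le> d" "F \<in> B j" "ev F = 0"
  shows "F \<in> L j"
  using assms
proof (induction j arbitrary: F)
  case 0
  have "F = mConst (lookup F 0)"
  proof (rule poly_mapping_eqI)
    fix m
    show "lookup F m = lookup (mConst (lookup F 0)) m"
      using 0(2) by (auto simp: B_def polys_def mConst_def lookup_single when_def)
  qed
  moreover from this have "[:lookup F 0:] = 0" using 0(3) ev_mConst by metis
  ultimately have "F = 0" by simp
  then show ?case using stableD(1)[OF L_stable] by simp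
next
  case (Suc j)
  have QR: "G \<in> polys (J j) {1..j}" if "G \<in> B j" "ev G = 0" for G
    using Suc.IH[of G] Suc.prems(1) that L_subset_mpJ[of j] by auto
  obtain s where "\<forall>s'\<ge>s. slice (Suc j) s' F = 0" using slice_eventually_0[of "Suc j" F] by blast
  then have "\<And>s'. s' > s \<Longrightarrow> slice (Suc j) s' F = 0" by simp
  then show ?case using Suc.prems(2,3)
  proof (induction s arbitrary: F)
    case 0
    have "F = slice (Suc j) 0 F" using slice_expansion_bounded[of 0 "Suc j" F] 0(1) by (simp add: var_pow_def)
    then have "F \<in> B j" using slice_in_B[OF 0(2), of 0] by simp
    then show ?case using Suc.IH[of F] Suc.prems(1) 0(3) L_mono by auto
  next
    case (Suc s)
    have "slice (Suc j) (Suc s) F \<in> polys (J j) {1..j}"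
      by (rule kernel_lead[OF _ QR Suc.prems(2,3)]) (use \<open>Suc j \<le> d\<close> Suc.prems(1) in auto)
    then have "slice (Suc j) (Suc s) F \<in> polys (colon j) {1..j}"
      using polys_coeffs_mono[OF J_subset_colon[of j], of "{1..j}"] \<open>Suc j \<le> d\<close> by auto
    then obtain l where l: "l \<in> L (Suc j)" "slice (Suc j) (Suc s) l = slice (Suc j) (Suc s) F"
      "\<And>s'. s' > Suc s \<Longrightarrow> slice (Suc j) s' l = 0" using colon_lead[of _ j "Suc s"] by auto
    have "F - l \<in> L (Suc j)"
    proof (rule Suc.IH)
      fix s' assume "s' > s"
      then show "slice (Suc j) s' (F - l) = 0"
        using l Suc.prems(1)[of s'] by (cases "s' = Suc s") (auto simp: slice_diff)
    next
      show "F - l \<in> B (Suc j)" using Suc.prems(2) l(1) L_subset_B is_subringD(6)[OF is_subring_B] by blast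
      show "ev (F - l) = 0" using Suc.prems(3) L_ev[OF l(1)] by (simp add: ev_simps)
    qed
    then have "(F - l) + l \<in> L (Suc j)" using l(1) by (rule stableD(2)[OF L_stable])
    then show ?case by simp
  qed
qed

lemma kernel_mpJ: "j \<le> d \<Longrightarrow> F \<in> B j \<Longrightarrow> ev F = 0 \<Longrightarrow> F \<in> polys (J j) {1..j}"
  using linear_type[of j F] L_subset_mpJ[of j] by auto

text \<open>With \<open>T\<close> the variable \<open>Suc j\<close>, this says that \<open>F\<close> is mapped into \<open>(T - f (Suc j) t) C\<close>, where the
  coefficients of \<open>C\<close> lie in the colon ideal. The coefficient of \<open>T\<^sup>s\<close> in \<open>C\<close> is stored as \<open>C (Suc s)\<close>.\<close>

definition admissible :: "nat \<Rightarrow> ((nat \<Rightarrow>\<^sub>0 nat) \<Rightarrow>\<^sub>0 'a) \<Rightarrow> bool" where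
  "admissible j F \<longleftrightarrow> (\<exists>C :: nat \<Rightarrow> ((nat \<Rightarrow>\<^sub>0 nat) \<Rightarrow>\<^sub>0 'a). (\<forall>s. C s \<in> polys (colon j) {1..j}) \<and> C 0 = 0 \<and> (\<exists>e. \<forall>s\<ge>e. C s = 0) \<and>
     (\<forall>s. ev (slice (Suc j) s F) = ev (C s) - monom (f (Suc j)) 1 * ev (C (Suc s))))"

lemma admissible_zero: "admissible j 0"
  unfolding admissible_def
  by (intro exI[of _ "\<lambda>_. 0"]) (simp add: ev_simps polys_zero K_stable)

lemma admissible_add:
  assumes "admissible j F" "admissible j G"
  shows "admissible j (F + G)"
proof -
  obtain C e where C: "\<forall>s. C s \<in> polys (colon j) {1..j}" "C 0 = 0" "\<forall>s\<ge>e. C s = 0"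
     "\<forall>s. ev (slice (Suc j) s F) = ev (C s) - monom (f (Suc j)) 1 * ev (C (Suc s))"
    using assms(1) unfolding admissible_def by blast
  obtain C' e' where C': "\<forall>s. C' s \<in> polys (colon j) {1..j}" "C' 0 = 0" "\<forall>s\<ge>e'. C' s = 0"
     "\<forall>s. ev (slice (Suc j) s G) = ev (C' s) - monom (f (Suc j)) 1 * ev (C' (Suc s))"
    using assms(2) unfolding admissible_def by blast
  show ?thesis unfolding admissible_def
  proof (intro exI[of _ "\<lambda>s. C s + C' s"] conjI allI)
    show "\<exists>e. \<forall>s\<ge>e. C s + C' s = 0" using C(3) C'(3) by (intro exI[of _ "max e e'"]) simp
    show "ev (slice (Suc j) s (F + G)) = ev (C s + C' s) - monom (f (Suc j)) 1 * ev (C (Suc s) + C' (Suc s))" for s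
      by (simp add: slice_add ev_simps C(4)[rule_format] C'(4)[rule_format] algebra_simps)
  qed (use C C' in \<open>simp_all add: polys_add K_stable\<close>)
qed

lemma admissible_mult_B:
  assumes b: "b \<in> B j" and "admissible j F"
  shows "admissible j (b * F)"
proof -
  obtain C e where C: "\<forall>s. C s \<in> polys (colon j) {1..j}" "C 0 = 0" "\<forall>s\<ge>e. C s = 0"
     "\<forall>s. ev (slice (Suc j) s F) = ev (C s) - monom (f (Suc j)) 1 * ev (C (Suc s))"
    using assms(2) unfolding admissible_def by blast
  show ?thesis unfolding admissible_def
  proof (intro exI[of _ "\<lambda>s. b * C s"] conjI allI)
    show "\<exists>e. \<forall>s\<ge>e. b * C s = 0" using C(3) by (intro exI[of _ e]) simp
    show "b * C s \<in> polys (colon j) {1..j}" for s using C(1) stable_mulops_mult[OF mpcolon_stable b] by simp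
    show "ev (slice (Suc j) s (b * F)) = ev (b * C s) - monom (f (Suc j)) 1 * ev (b * C (Suc s))" for s
      unfolding slice_mult_B[OF b] ev_simps C(4)[rule_format] by (simp add: algebra_simps)
  qed (use C in simp_all)
qed

lemma admissible_mult_var_pow: "admissible j F \<Longrightarrow> admissible j (var_pow (Suc j) r * F)"
proof -
  assume "admissible j F"
  then obtain C e where C: "\<forall>s. C s \<in> polys (colon j) {1..j}" "C 0 = 0" "\<forall>s\<ge>e. C s = 0"
     "\<forall>s. ev (slice (Suc j) s F) = ev (C s) - monom (f (Suc j)) 1 * ev (C (Suc s))"
    unfolding admissible_def by blast
  show ?thesis unfolding admissible_def
  proof (intro exI[of _ "\<lambda>s. if r \<le> s then C (s - r) else 0"] conjI allI)
    show "\<exists>e. \<forall>s\<ge>e. (if r \<le> s then C (s - r) else 0) = 0" using C(3) by (intro exI[of _ "e + r"]) simp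
    fix s
    consider "r \<le> s" | "r = Suc s" | "r > Suc s" by linarith
    then show "ev (slice (Suc j) s (var_pow (Suc j) r * F)) = ev (if r \<le> s then C (s - r) else 0)
        - monom (f (Suc j)) 1 * ev (if r \<le> Suc s then C (Suc s - r) else 0)"
      by cases (use C in \<open>simp_all add: slice_var_pow_mult Suc_diff_le ev_simps\<close>)
  qed (use C in \<open>simp_all add: polys_zero K_stable\<close>)
qed

lemma admissible_mult:
  assumes "b \<in> B (Suc j)" "admissible j F"
  shows "admissible j (b * F)"
proof -
  obtain N where N: "b = (\<Sum>s<N. var_pow (Suc j) s * slice (Suc j) s b)"
    using slice_expansion[of b "Suc j"] by blast
  have "admissible j (\<Sum>s<M. (var_pow (Suc j) s * slice (Suc j) s b) * F)" for M
  proof (induction M)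
    case (Suc M)
    have "admissible j (var_pow (Suc j) M * (slice (Suc j) M b * F))"
      by (intro admissible_mult_var_pow admissible_mult_B slice_in_B assms)
    then show ?case using admissible_add[OF Suc] by (simp add: mult.assoc)
  qed (simp add: admissible_zero)
  then have "admissible j ((\<Sum>s<N. var_pow (Suc j) s * slice (Suc j) s b) * F)" unfolding sum_distrib_right .
  then show ?thesis unfolding N[symmetric] .
qed

text \<open>In a syzygy the terms below the last one have the value -a (j+1) f (j+1) t, so the whole
  form is mapped to a (j+1) (T - f (j+1) t), with a (j+1) in the colon ideal.\<close>

lemma admissible_lin:
  assumes "j \<le> d" "x \<in> lin (Suc j)"
  shows "admissible j x"
proof -
  obtain a where a: "x = (\<Sum>i\<in>{1..Suc j}. mConst (a i) * mVar i)" "\<And>i. a i \<in> R" "(\<Sum>i\<in>{1..Suc j}. a i * f i) = 0"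
    using assms(2) by (auto simp: lin_def)
  let ?y = "\<Sum>i\<in>{1..j}. mConst (a i) * mVar i" and ?a = "mConst (a (Suc j)) :: (nat \<Rightarrow>\<^sub>0 nat) \<Rightarrow>\<^sub>0 'a"
  have yB: "?y \<in> B j" unfolding B_def
    by (intro polys_sum polys_mult polys_mConst polys_mVar K_stable R a(2)) auto
  have aB: "?a \<in> B j" unfolding B_def by (intro polys_mConst K_stable a(2))
  have eq: "(\<Sum>i\<in>{1..j}. a i * f i) = - (a (Suc j) * f (Suc j))"
    using a(3) by (simp add: eq_neg_iff_add_eq_0)
  have "a (Suc j) \<in> colon j"
  proof -
    have "a (Suc j) * f (Suc j) = - (\<Sum>i\<in>{1..j}. a i * f i)" unfolding eq by simp
    moreover have "(\<Sum>i\<in>{1..j}. a i * f i) \<in> J j" using a(2) by (auto simp: J_def)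
    ultimately show ?thesis using a(2) stableD(3)[OF J_stable] by (simp add: colon_def)
  qed
  then have aC: "?a \<in> polys (colon j) {1..j}" by (intro polys_mConst K_stable)
  have x: "x = ?y + var_pow (Suc j) 1 * ?a" unfolding a(1) by (simp add: var_pow_def mVar_def mult.commute)
  have sl: "slice (Suc j) s x = (if s = 0 then ?y else if s = 1 then ?a else 0)" for s
    unfolding x slice_add slice_var_pow_mult slice_B[OF yB] slice_B[OF aB] by auto
  have ey: "ev ?y = - monom (f (Suc j)) 1 * ev ?a"
    unfolding ev_lin eq by (simp add: ev_mConst smult_monom minus_monom mult.commute)
  show ?thesis unfolding admissible_def
  \<comment> \<open>The cofactor is the constant a (j+1); under the shifted indexing its only entry
    sits at 1.\<close>
  proof (intro exI[of _ "\<lambda>s. if s = 1 then ?a else 0"] conjI allI)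
    show "\<exists>e. \<forall>s\<ge>e::nat. (if s = 1 then ?a else 0) = 0" by (intro exI[of _ 2]) simp
    show "ev (slice (Suc j) s x) = ev (if s = 1 then ?a else 0) - monom (f (Suc j)) 1 * ev (if Suc s = 1 then ?a else 0)" for s
      unfolding sl using ey by (auto simp: ev_simps)
  qed (use aC in \<open>auto simp: polys_zero K_stable\<close>)
qed

lemma L_admissible: "j \<le> d \<Longrightarrow> F \<in> L (Suc j) \<Longrightarrow> admissible j F"
proof -
  assume j: "j \<le> d" and "F \<in> L (Suc j)"
  from this(2)[unfolded L_def] show "admissible j F"
  proof induction
    case (hull_add b g y)
    show ?case
      by (rule admissible_add[OF admissible_mult[OF hull_add(1) admissible_lin[OF j hull_add(2)]] hull_add(4)])
  qed (rule admissible_zero)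
qed

text \<open>Where slices vanish, the value of C s' is f (j+1) t times that of C (s'+1). Since C is
  eventually 0, descending induction kills all values above s, and the top slice has the value of C
  s. The convention C 0 = 0 settles s = 0.\<close>

lemma L_lead_ev:
  assumes "j \<le> d" "F \<in> L (Suc j)" "\<And>s'. s' > s \<Longrightarrow> slice (Suc j) s' F = 0"
  shows "\<exists>c\<in>polys (colon j) {1..j}. ev (slice (Suc j) s F) = ev c \<and> (s = 0 \<longrightarrow> c = 0)"
proof -
  obtain C e where C: "\<forall>s. C s \<in> polys (colon j) {1..j}" "C 0 = 0" "\<forall>s\<ge>e. C s = 0"
     "\<forall>s. ev (slice (Suc j) s F) = ev (C s) - monom (f (Suc j)) 1 * ev (C (Suc s))"
    using L_admissible[OF assms(1,2)] unfolding admissible_def by blast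
  have "ev (C s') = 0" if "s' > s" for s'
  proof (cases "s' \<ge> e")
    case False
    then have "s' \<le> e" by simp
    then show ?thesis using that
    proof (induction s' rule: inc_induct)
      case base
      then show ?case using C(3) by (simp add: ev_simps)
    next
      case (step i)
      then show ?case using C(4)[rule_format, of i] assms(3)[of i] by (simp add: ev_simps)
    qed
  qed (use C(3) in \<open>simp add: ev_simps\<close>)
  then have "ev (slice (Suc j) s F) = ev (C s)" using C(4) by simp
  then show ?thesis using C(1,2) by blast
qed

text \<open>\<open>L_lead_ev\<close> determines the slice only modulo the kernel of
  \<open>ev\<close>, but by linear type that kernel has coefficients in \<open>J j\<close>, inside
  the colon ideal.\<close>

lemma L_lead:
  assumes "j \<le> d" "F \<in> L (Suc j)" "\<And>s'. s' > s \<Longrightarrow> slice (Suc j) s' F = 0"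
  shows "slice (Suc j) s F \<in> polys (colon j) {1..j}"
proof -
  obtain c where c: "c \<in> polys (colon j) {1..j}" "ev (slice (Suc j) s F) = ev c" using L_lead_ev[OF assms] by blast
  have sB: "slice (Suc j) s F \<in> B j" using slice_in_B assms(2) L_subset_B by blast
  have cB: "c \<in> B j" using c(1) polys_coeffs_mono[OF colon_subset] by (auto simp: B_def)
  have "slice (Suc j) s F - c \<in> polys (J j) {1..j}"
    by (rule kernel_mpJ[OF assms(1)]) (use c sB cB is_subringD(6)[OF is_subring_B] in \<open>auto simp: ev_simps\<close>)
  then have "slice (Suc j) s F - c \<in> polys (colon j) {1..j}"
    using polys_coeffs_mono[OF J_subset_colon[OF assms(1)]] by auto
  then have "(slice (Suc j) s F - c) + c \<in> polys (colon j) {1..j}" using c(1) by (rule polys_add[OF K_stable(3)])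
  then show ?thesis by simp
qed

text \<open>Such an F is its own slice at 0, and the case s = 0 of \<open>L_lead_ev\<close> gives it
  the value 0; linear type for j concludes. The case j = d, where the last form is arbitrary, is
  included.\<close>

lemma L_contract:
  assumes "j \<le> d" "F \<in> L (Suc j)" "F \<in> B j"
  shows "F \<in> L j"
proof -
  have "\<exists>c\<in>polys (colon j) {1..j}. ev (slice (Suc j) 0 F) = ev c \<and> (0 = (0::nat) \<longrightarrow> c = 0)"
    by (rule L_lead_ev[OF assms(1,2)]) (simp add: slice_B[OF assms(3)])
  then have "ev F = 0" by (auto simp: slice_B[OF assms(3)] ev_simps)
  then show ?thesis using linear_type[OF assms(1,3)] by blast
qed

end

section \<open>The Hilbert function of the symmetric algebra\<close>

lemma sum_enat: "(\<Sum>i\<in>S. enat (g i)) = enat (\<Sum>i\<in>S. g i)"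
  by (simp add: of_nat_eq_enat[symmetric])

text \<open>Multiplication by \<open>cp 0 1\<close> fixes every homogeneous component, hence also
  their sum 1.\<close>

lemma (in grading) cp_0_1: "cp 0 1 = 1"
proof -
  have h: "cp v x * cp 0 1 = cp v x" for v x
  proof -
    have "cp v (1 * cp v x) = cp 0 1 * cp v x"
      using cp_mult_homogeneous[of v "cp v x" v 1] cp_cp[of v v x] by simp
    then show ?thesis using cp_cp[of v v x] by (simp add: mult.commute)
  qed
  obtain N where N: "(\<Sum>i<N. cp i 1) = 1" using cp_total[of 1] by blast
  have "(\<Sum>i<N. cp i 1) * cp 0 1 = (\<Sum>i<N. cp i 1)" by (simp add: sum_distrib_right h)
  then show ?thesis unfolding N by simp
qed

context connected_grading
begin

text \<open>The truncation below degree t ignores the part of order at least t, and it preserves a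
  homogeneous ideal. Membership modulo high order thus becomes membership of one explicit element in
  I.\<close>

lemma set_sum_hi_iff:
  assumes I: "stable (mulops X) I" "I \<subseteq> X" and gr: "\<And>x u. x \<in> I \<Longrightarrow> cp u x \<in> I"
  shows "x \<in> set_sum I (hi X t) \<longleftrightarrow> x \<in> X \<and> (\<Sum>i<t. cp i x) \<in> I"
proof
  assume "x \<in> set_sum I (hi X t)"
  then obtain a h where ah: "x = a + h" "a \<in> I" "h \<in> hi X t" by (auto simp: set_sum_def)
  have "(\<Sum>i<t. cp i x) = (\<Sum>i<t. cp i a)"
    by (rule sum.cong) (use ah(3) in \<open>auto simp: ah(1) cp_add hi_def\<close>)
  moreover have "(\<Sum>i<t. cp i a) \<in> I" by (rule stable_sum[OF I(1)]) (use gr ah in auto)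
  moreover have "x \<in> X" using ah I(2) hi_subset X by (auto simp: is_subringD subset_iff)
  ultimately show "x \<in> X \<and> (\<Sum>i<t. cp i x) \<in> I" by simp
next
  assume "x \<in> X \<and> (\<Sum>i<t. cp i x) \<in> I"
  then show "x \<in> set_sum I (hi X t)"
    unfolding set_sum_def using diff_trunc_hi(2)[OF X cp_X, of x t]
    by (intro CollectI exI[of _ "\<Sum>i<t. cp i x"] exI[of _ "x - (\<Sum>i<t. cp i x)"]) simp
qed

lemma set_sum_hi_trunc:
  assumes "x \<in> X" "(\<Sum>i<t. cp i x) \<in> I"
  shows "x \<in> set_sum I (hi X t)"
  unfolding set_sum_def using diff_trunc_hi(2)[OF X cp_X assms(1), of t] assms
  by (intro CollectI exI[of _ "\<Sum>i<t. cp i x"] exI[of _ "x - (\<Sum>i<t. cp i x)"]) simp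

lemma connected_grading_polys: "connected_grading (lift_cp cp) (polys X V) (mConst ` C)"
proof (intro connected_grading.intro connected_grading_axioms.intro grading_lift_cp)
  show "is_subring (polys X V)" by (rule is_subring_polys[OF X])
  show "mConst ` C \<subseteq> polys X V" using CX by (auto intro!: polys_mConst is_subring_stable X)
  show "lift_cp cp u F \<in> polys X V" if "F \<in> polys X V" for F u
    using that is_subringD(1)[OF X] cp_X by (rule polys_lift_cp)
  show "lift_cp cp 0 F \<in> mConst ` C" if "F \<in> polys X V" for F
  proof
    show "lift_cp cp 0 F = mConst (cp 0 (lookup F 0))"
      by (rule poly_mapping_eqI) (auto simp: lookup_lift_cp mConst_def lookup_single when_def)
    show "cp 0 (lookup F 0) \<in> C" using that cp_0_C by (simp add: polys_def)
  qed
qed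

text \<open>A variable has degree one, so a total order of at least t demands order at least t -
  edeg m of the coefficient at m. This is the kind of condition measured by
  \<open>len_polys\<close>.\<close>

lemma hi_polys:
  fixes V :: "'v set"
  shows "grading.hi (lift_cp cp) (polys X V) t = {F \<in> polys X V. \<forall>m. lookup F m \<in> hi X (t - edeg m)}"
proof -
  have "(\<forall>u<t. lift_cp cp u F = 0) \<longleftrightarrow> (\<forall>m. \<forall>u<t - edeg m. cp u (lookup F m) = 0)" for F :: "('v \<Rightarrow>\<^sub>0 nat) \<Rightarrow>\<^sub>0 'a"
  proof
    assume *: "\<forall>u<t. lift_cp cp u F = 0"
    show "\<forall>m. \<forall>u<t - edeg m. cp u (lookup F m) = 0"
    proof (intro allI impI)
      fix m :: "'v \<Rightarrow>\<^sub>0 nat" and u assume "u < t - edeg m"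
      then have "lookup (lift_cp cp (u + edeg m) F) m = 0" using * by simp
      then show "cp u (lookup F m) = 0" by (simp add: lookup_lift_cp)
    qed
  next
    assume *: "\<forall>m. \<forall>u<t - edeg m. cp u (lookup F m) = 0"
    show "\<forall>u<t. lift_cp cp u F = 0"
    proof (intro allI impI poly_mapping_eqI)
      fix u m assume "u < t"
      then show "lookup (lift_cp cp u F) m = lookup 0 m" using *[rule_format, of "u - edeg m" m]
        by (simp add: lookup_lift_cp)
    qed
  qed
  then show ?thesis unfolding grading.hi_def[OF grading_lift_cp] hi_def by (auto simp: polys_def)
qed

end

text \<open>\<open>hR\<close> is the cumulative Hilbert function of the base ring;
  \<open>evpoly_R\<close> says dimension d and multiplicity 1, with d also the length of the regular
  sequence.\<close>

locale graded_reg_seq = reg_seq R f d + connected_grading cp R C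
  for R :: "'a::comm_ring_1 set" and f d and cp and C +
  fixes n :: nat and hR :: "nat \<Rightarrow> nat"
  assumes f_homogeneous: "i \<in> {1..Suc d} \<Longrightarrow> cp n (f i) = f i"
    and len_R: "len (mulops C) (hi R u) R = enat (hR u)"
    and evpoly_R: "evpoly d 1 (\<lambda>u. int (hR u))"
begin

definition hiB :: "nat \<Rightarrow> nat \<Rightarrow> ((nat \<Rightarrow>\<^sub>0 nat) \<Rightarrow>\<^sub>0 'a) set" where
  "hiB j = grading.hi (lift_cp cp) (B j)"

abbreviation (input) KB where "KB \<equiv> mulops (mConst ` C :: ((nat \<Rightarrow>\<^sub>0 nat) \<Rightarrow>\<^sub>0 'a) set)"

definition E :: "nat \<Rightarrow> nat \<Rightarrow> ((nat \<Rightarrow>\<^sub>0 nat) \<Rightarrow>\<^sub>0 'a) set" where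
  "E j t = set_sum (L j) (hiB j t)"

text \<open>For an ideal c this is its extension to \<open>B j\<close> plus \<open>hiB j u\<close>,
  written coefficientwise so that its colength is a sum over exponents.\<close>

definition W :: "'a set \<Rightarrow> nat \<Rightarrow> nat \<Rightarrow> ((nat \<Rightarrow>\<^sub>0 nat) \<Rightarrow>\<^sub>0 'a) set" where
  "W c j u = {F \<in> B j. \<forall>m. lookup F m \<in> set_sum c (hi R (u - edeg m))}"

lemma cgB: "connected_grading (lift_cp cp) (B j) (mConst ` C)"
  unfolding B_def by (rule connected_grading_polys)

lemma KB_stable: "stable (mulops (B j)) N \<Longrightarrow> stable KB N"
  by (rule stable_mulops_mono[OF _ connected_grading.CX[OF cgB]])

lemma KB_stable_B: "stable KB (B j)"
  by (rule KB_stable[OF B_stable])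

lemma cp_mult_f: "i \<in> {1..Suc d} \<Longrightarrow> cp u (a * f i) = (if n \<le> u then cp (u - n) a * f i else 0)"
  by (rule cp_mult_homogeneous[OF f_homogeneous])

text \<open>The forms all have the same degree n, so the homogeneous components of the coefficients
  of a syzygy, taken in one common degree, form a syzygy again.\<close>

lemma L_graded:
  assumes "j \<le> Suc d" "x \<in> L j"
  shows "lift_cp cp u x \<in> L j"
proof -
  interpret G: connected_grading "lift_cp cp" "B j" "mConst ` C" by (rule cgB)
  have lin: "lift_cp cp u x \<in> lin j" if x: "x \<in> lin j" for u x
  proof -
    obtain a where a: "x = (\<Sum>i\<in>{1..j}. mConst (a i) * mVar i)" "\<forall>i. a i \<in> R" "(\<Sum>i\<in>{1..j}. a i * f i) = 0"
      using x by (auto simp: lin_def)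
    have mv: "lift_cp cp 1 (mVar i) = (mVar i :: (nat \<Rightarrow>\<^sub>0 nat) \<Rightarrow>\<^sub>0 'a)" for i :: nat
      using lift_cp_var_pow[OF cp_0_1, of 1 i] by (simp add: var_pow_def mVar_def)
    let ?b = "\<lambda>i. if 1 \<le> u then cp (u - 1) (a i) else 0"
    have "lift_cp cp u x = (\<Sum>i\<in>{1..j}. mConst (?b i) * mVar i)"
      unfolding a(1) G.cp_sum G.cp_mult_homogeneous[OF mv] by (intro sum.cong) (auto simp: lift_cp_mConst)
    moreover have "(\<Sum>i\<in>{1..j}. ?b i * f i) = 0"
    proof (cases "1 \<le> u")
      case True
      have "(\<Sum>i\<in>{1..j}. cp (u - 1) (a i) * f i) = (\<Sum>i\<in>{1..j}. cp (u - 1 + n) (a i * f i))"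
        by (intro sum.cong refl) (use assms(1) in \<open>auto simp: cp_mult_f\<close>)
      also have "\<dots> = 0" unfolding cp_sum[symmetric] a(3) by simp
      finally show ?thesis using True by simp
    qed simp
    moreover have "?b i \<in> R" for i using a(2) cp_X is_subringD(1)[OF R] by simp
    ultimately show ?thesis unfolding lin_def by (intro CollectI exI[of _ ?b]) simp
  qed
  show ?thesis using assms(2) unfolding L_def
  proof (induction arbitrary: u)
    case (hull_add b g y)
    have "lift_cp cp i b * lift_cp cp (u - i) g \<in> ideal_hull (B j) (lin j)" for i
    proof -
      have "lift_cp cp i b * lift_cp cp (u - i) g + 0 \<in> ideal_hull (B j) (lin j)"
        by (rule ideal_hull.hull_add[OF G.cp_X[OF hull_add(1)] lin[OF hull_add(2)] ideal_hull.hull_zero])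
      then show ?thesis by simp
    qed
    then have "lift_cp cp u (b * g) \<in> ideal_hull (B j) (lin j)"
      unfolding G.cp_mult by (intro stable_sum[OF stable_hull[OF is_subring_B]])
    then show ?case unfolding G.cp_add
      using hull_add.IH stableD(2)[OF stable_hull[OF is_subring_B]] by blast
  qed (simp add: ideal_hull.hull_zero)
qed

lemma E_iff:
  assumes "j \<le> Suc d"
  shows "x \<in> E j t \<longleftrightarrow> x \<in> B j \<and> (\<Sum>i<t. lift_cp cp i x) \<in> L j"
  unfolding E_def hiB_def
  by (rule connected_grading.set_sum_hi_iff[OF cgB L_stable L_subset_B L_graded[OF assms]])

lemma E_stable: "stable KB (E j t)"
  unfolding E_def hiB_def by (rule connected_grading.stable_hi_sum(2)[OF cgB L_stable])

lemma E_subset: "E j t \<subseteq> B j"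
  unfolding E_def hiB_def
  by (rule set_sum_least[OF B_stable L_subset_B]) (rule grading.hi_subset[OF grading_lift_cp])

lemma L_subset_E: "L j \<subseteq> E j t"
  unfolding E_def hiB_def
  by (rule set_sum_upper1) (use connected_grading.X[OF cgB] in \<open>auto simp: grading.hi_def[OF grading_lift_cp] is_subringD grading.cp_zero[OF grading_lift_cp]\<close>)

lemma hiB_subset_E: "hiB j t \<subseteq> E j t"
  unfolding E_def by (rule set_sum_upper2) (rule stableD(1)[OF L_stable])

text \<open>Bounding the degree in the last variable is compatible with multiplication by constants
  but not by that variable; this is why lengths over the constants are used.\<close>

definition U :: "nat \<Rightarrow> nat \<Rightarrow> ((nat \<Rightarrow>\<^sub>0 nat) \<Rightarrow>\<^sub>0 'a) set" where
  "U j s = {F \<in> B (Suc j). \<forall>s'>s. slice (Suc j) s' F = 0}"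

lemma U_stable: "stable KB (U j s)"
proof (rule stable_mulopsI)
  fix c F :: "(nat \<Rightarrow>\<^sub>0 nat) \<Rightarrow>\<^sub>0 'a" assume c: "c \<in> mConst ` C" and F: "F \<in> U j s"
  have cB: "c \<in> B i" for i using c connected_grading.CX[OF cgB] by blast
  show "c * F \<in> U j s"
    using F slice_mult_B[OF cB[of j]] is_subringD(4)[OF is_subring_B cB[of "Suc j"]] by (simp add: U_def)
qed (auto simp: U_def is_subringD[OF is_subring_B] slice_add slice_uminus)

lemma U_0: "U j 0 = B j"
proof (intro antisym subsetI)
  fix F assume F: "F \<in> U j 0"
  then have "F = slice (Suc j) 0 F" using slice_expansion_bounded[of 0 "Suc j" F] by (simp add: var_pow_def U_def)
  then show "F \<in> B j" using slice_in_B[of F j 0] F by (simp add: U_def)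
next
  fix F assume "F \<in> B j"
  then show "F \<in> U j 0" using B_mono slice_B[of F j] by (auto simp: U_def)
qed

lemma U_subset: "U j s \<subseteq> B (Suc j)"
  by (auto simp: U_def)

lemma U_mono: "U j s \<subseteq> U j (Suc s)"
  by (auto simp: U_def)

lemma var_pow_B: "var_pow (Suc j) s \<in> B (Suc j)"
  unfolding B_def by (rule polys_var_pow[OF R]) simp

lemma var_pow_mult_U:
  assumes "b \<in> B j"
  shows "var_pow (Suc j) s * b \<in> U j s"
  unfolding U_def using is_subringD(4)[OF is_subring_B var_pow_B subsetD[OF B_mono assms]]
  by (auto simp: slice_var_pow_mult slice_B[OF assms])

lemma U_Suc_decompose: 
  assumes "F \<in> U j (Suc s)"
  shows "F - var_pow (Suc j) (Suc s) * slice (Suc j) (Suc s) F \<in> U j s"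
proof -
  let ?b = "slice (Suc j) (Suc s) F"
  have b: "?b \<in> B j" using assms by (intro slice_in_B) (simp add: U_def)
  have "F - var_pow (Suc j) (Suc s) * ?b \<in> B (Suc j)"
    using assms var_pow_mult_U[OF b, of "Suc s"] is_subringD(6)[OF is_subring_B] by (auto simp: U_def)
  moreover have "slice (Suc j) s' (F - var_pow (Suc j) (Suc s) * ?b) = 0" if "s' > s" for s'
    using that assms by (cases "s' = Suc s") (auto simp: slice_diff slice_var_pow_mult slice_B[OF b] U_def)
  ultimately show ?thesis by (simp add: U_def)
qed

text \<open>The leading coefficients of L + M^t in degree s + 1. In one direction an element is
  truncated to land in L and \<open>L_lead\<close> is applied; in the other, colon parts are lifted
  by \<open>colon_lead\<close>, and high-order parts stay of high order after multiplication by the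
  power of the variable.\<close>

lemma lead_ideal:
  assumes j: "j \<le> d" and b: "b \<in> B j"
  shows "var_pow (Suc j) (Suc s) * b \<in> set_sum (E (Suc j) t) (U j s) \<longleftrightarrow> b \<in> W (colon j) j (t - Suc s)"
proof
  assume "var_pow (Suc j) (Suc s) * b \<in> set_sum (E (Suc j) t) (U j s)"
  then obtain e u where eu: "var_pow (Suc j) (Suc s) * b = e + u" "e \<in> E (Suc j) t" "u \<in> U j s"
    by (auto simp: set_sum_def)
  then have e: "e = var_pow (Suc j) (Suc s) * b - u" by simp
  \<comment> \<open>Truncating by total degree keeps the degree in the last variable at most s + 1,
    and the top slice becomes b truncated below degree t - (s + 1).\<close>
  let ?F = "\<Sum>i<t. lift_cp cp i e"
  have FL: "?F \<in> L (Suc j)" using eu(2) E_iff[of "Suc j" e t] j by simp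
  have sle: "slice (Suc j) s' e = (if s' = Suc s then b else 0)" if "s' > s" for s'
    using that eu(3) by (auto simp: e slice_diff slice_var_pow_mult slice_B[OF b] U_def)
  have slF: "slice (Suc j) s' ?F = (\<Sum>i<t. if s' \<le> i then lift_cp cp (i - s') (slice (Suc j) s' e) else 0)" for s'
    unfolding slice_sum slice_lift_cp ..
  have "slice (Suc j) s' ?F = 0" if "s' > Suc s" for s'
    unfolding slF using sle[of s'] that by (intro sum.neutral) (auto simp: grading.cp_zero[OF grading_lift_cp])
  then have "slice (Suc j) (Suc s) ?F \<in> polys (colon j) {1..j}" by (rule L_lead[OF j FL])
  then have F': "(\<Sum>i<t. if Suc s \<le> i then lift_cp cp (i - Suc s) b else 0) \<in> polys (colon j) {1..j}"
  proof -
    have sb: "slice (Suc j) (Suc s) e = b" using sle[of "Suc s"] by simp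
    show ?thesis using \<open>slice (Suc j) (Suc s) ?F \<in> polys (colon j) {1..j}\<close> unfolding slF sb .
  qed
  have "lookup b m \<in> set_sum (colon j) (hi R (t - Suc s - edeg m))" for m
  proof (rule set_sum_hi_trunc)
    show "lookup b m \<in> R" using b by (simp add: B_def polys_def)
    have "lookup (\<Sum>i<t. if Suc s \<le> i then lift_cp cp (i - Suc s) b else 0) m =
      (\<Sum>i<t. if Suc s + edeg m \<le> i then cp (i - (Suc s + edeg m)) (lookup b m) else 0)"
      unfolding lookup_sum by (intro sum.cong) (auto simp: lookup_lift_cp)
    also have "\<dots> = (\<Sum>i\<in>{Suc s + edeg m..<t}. cp (i - (Suc s + edeg m)) (lookup b m))"
      by (rule sum.mono_neutral_cong_right) auto
    also have "\<dots> = (\<Sum>i<t - Suc s - edeg m. cp i (lookup b m))"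
      by (rule sum.reindex_bij_witness[of _ "\<lambda>i. i + (Suc s + edeg m)" "\<lambda>i. i - (Suc s + edeg m)"]) auto
    finally have eq: "lookup (\<Sum>i<t. if Suc s \<le> i then lift_cp cp (i - Suc s) b else 0) m =
      (\<Sum>i<t - Suc s - edeg m. cp i (lookup b m))" .
    have "lookup (\<Sum>i<t. if Suc s \<le> i then lift_cp cp (i - Suc s) b else 0) m \<in> colon j"
      using F' unfolding polys_def by blast
    then show "(\<Sum>i<t - Suc s - edeg m. cp i (lookup b m)) \<in> colon j" unfolding eq .
  qed
  then show "b \<in> W (colon j) j (t - Suc s)" using b by (simp add: W_def)
next
  assume bW: "b \<in> W (colon j) j (t - Suc s)"
  let ?G = "set_sum (E (Suc j) t) (U j s)"
  have Gst: "stable KB ?G" by (rule stable_set_sum[OF additive_mulops E_stable U_stable])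
  have EG: "E (Suc j) t \<subseteq> ?G" by (rule set_sum_upper1) (rule stableD(1)[OF U_stable])
  have "var_pow (Suc j) (Suc s) * single m (lookup b m) \<in> ?G" if m: "m \<in> keys b" for m
  proof -
    obtain a h where ah: "lookup b m = a + h" "a \<in> colon j" "h \<in> hi R (t - Suc s - edeg m)"
      using bW unfolding W_def by (auto simp: set_sum_def) metis
    have mV: "keys m \<subseteq> {1..j}" using b m by (simp add: B_def polys_def in_keys_iff)
    have sB: "single m x \<in> B j" if "x \<in> R" for x
      unfolding B_def using that mV by (intro polys_single K_stable)
    have "single m a \<in> polys (colon j) {1..j}" using ah(2) mV by (intro polys_single K_stable)
    then obtain l where l: "l \<in> L (Suc j)" "slice (Suc j) (Suc s) l = single m a"
      "\<forall>s'>Suc s. slice (Suc j) s' l = 0" using colon_lead[of "single m a" j "Suc s"] by auto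
    have "l \<in> U j (Suc s)" using l L_subset_B by (auto simp: U_def)
    then have "l - var_pow (Suc j) (Suc s) * single m a \<in> U j s" using U_Suc_decompose[of l j s] l(2) by simp
    then have "- (l - var_pow (Suc j) (Suc s) * single m a) \<in> U j s" by (rule stableD(3)[OF U_stable])
    moreover have "l \<in> E (Suc j) t" using l(1) L_subset_E by blast
    ultimately have "l + - (l - var_pow (Suc j) (Suc s) * single m a) \<in> ?G" unfolding set_sum_def by blast
    then have a: "var_pow (Suc j) (Suc s) * single m a \<in> ?G" by simp
    have hR: "h \<in> R" using ah(3) hi_subset by blast
    have "var_pow (Suc j) (Suc s) * single m h \<in> hiB (Suc j) t"
      unfolding hiB_def grading.hi_def[OF grading_lift_cp]
    proof (intro CollectI conjI allI impI)
      show "var_pow (Suc j) (Suc s) * single m h \<in> B (Suc j)" using var_pow_mult_U[OF sB[OF hR]] U_subset by blast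
      fix u assume "u < t"
      then show "lift_cp cp u (var_pow (Suc j) (Suc s) * single m h) = 0"
        using ah(3) by (auto simp: var_pow_def mult_single lift_cp_single edeg_add hi_def)
    qed
    then have "var_pow (Suc j) (Suc s) * single m h \<in> ?G" using hiB_subset_E EG by blast
    then show ?thesis using stableD(2)[OF Gst a] by (simp add: ah(1) single_add distrib_left)
  qed
  then have "var_pow (Suc j) (Suc s) * (\<Sum>m\<in>keys b. single m (lookup b m)) \<in> ?G"
    unfolding sum_distrib_left by (intro stable_sum[OF Gst])
  then show "var_pow (Suc j) (Suc s) * b \<in> ?G" unfolding poly_mapping_sum_single[symmetric] .
qed

lemma W_subset: "W c j u \<subseteq> B j"
  by (auto simp: W_def)

lemma KB_op:
  assumes "\<And>c x. c \<in> mConst ` C \<Longrightarrow> \<phi> (c * x) = c * (\<phi> x :: (nat \<Rightarrow>\<^sub>0 nat) \<Rightarrow>\<^sub>0 'a)" "h \<in> KB"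
  shows "\<exists>h'\<in>KB. \<forall>x\<in>D. \<phi> (h x) = h' (\<phi> x)" "\<exists>h'\<in>KB. \<forall>x\<in>D. \<phi> (h' x) = h (\<phi> x)"
  using assms by (auto simp: mulops_def)

text \<open>The quotient is filtered by the degree in the last variable. The bottom piece is the
  quotient for j, and multiplication by the power s + 1 identifies the next ones with quotients of
  \<open>B j\<close> through \<open>lead_ideal\<close>. The sum is reindexed by u = t - (s +
  1).\<close>

lemma len_E_Suc:
  assumes j: "j \<le> d"
  shows "len KB (E (Suc j) t) (B (Suc j)) =
    len KB (E j t) (B j) + (\<Sum>u<t. len KB (W (colon j) j u) (B j))"
proof -
  define G where "G s = set_sum (E (Suc j) t) (U j s)" for s
  have Gst: "stable KB (G s)" for s
    unfolding G_def by (rule stable_set_sum[OF additive_mulops E_stable U_stable])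
  have EG: "E (Suc j) t \<subseteq> G s" for s
    unfolding G_def by (rule set_sum_upper1) (rule stableD(1)[OF U_stable])
  have UG: "U j s \<subseteq> G s" for s
    unfolding G_def by (rule set_sum_upper2) (rule stableD(1)[OF E_stable])
  have GB: "G s \<subseteq> B (Suc j)" for s
    unfolding G_def by (rule set_sum_least[OF B_stable E_subset U_subset])
  have Gmono: "G s \<subseteq> G (Suc s)" for s
    unfolding G_def[of s] by (rule set_sum_least[OF Gst EG]) (use U_mono UG in blast)
  interpret Gr: connected_grading "lift_cp cp" "B (Suc j)" "mConst ` C" by (rule cgB)
  \<comment> \<open>An element of total degree below t has degree below t in the last variable, and
    the rest has order at least t: the filtration ends at t.\<close>
  have Gt: "G t = B (Suc j)"
  proof (rule antisym[OF GB], rule subsetI)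
    fix F assume F: "F \<in> B (Suc j)"
    let ?F = "\<Sum>i<t. lift_cp cp i F"
    have "F - ?F \<in> E (Suc j) t" using Gr.diff_trunc_hi(2)[OF Gr.X Gr.cp_X F, of t] hiB_subset_E
      unfolding hiB_def by blast
    moreover have "?F \<in> U j t"
      unfolding U_def using Gr.diff_trunc_hi(1)[OF Gr.X Gr.cp_X F, of t]
      by (auto simp: slice_sum slice_lift_cp intro!: sum.neutral)
    ultimately have "(F - ?F) + ?F \<in> G t" unfolding G_def set_sum_def by blast
    then show "F \<in> G t" by simp
  qed
  have "len KB (E (Suc j) t) (B (Suc j)) = len KB (E (Suc j) t) (G 0) + len KB (G 0) (B (Suc j))"
    by (rule len_add[OF additive_mulops E_stable Gst KB_stable_B EG GB])
  \<comment> \<open>Injectivity is \<open>L_contract\<close>, applied to the truncation of an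
    element of \<open>B j\<close>.\<close>
  also have "len KB (E (Suc j) t) (G 0) = len KB (E j t) (B j)"
  proof (rule len_iso[symmetric, where \<phi> = "\<lambda>x. x"])
    show "G 0 = set_sum (E (Suc j) t) ((\<lambda>x. x) ` B j)" by (simp add: G_def U_0)
    fix x assume x: "x \<in> B j"
    have "(\<Sum>i<t. lift_cp cp i x) \<in> B j"
      by (rule grading.diff_trunc_hi(1)[OF grading_lift_cp connected_grading.X[OF cgB] connected_grading.cp_X[OF cgB] x])
    then show "x \<in> E (Suc j) t \<longleftrightarrow> x \<in> E j t"
      using E_iff[of "Suc j" x t] E_iff[of j x t] j x B_mono L_mono L_contract[OF j] by auto
  qed (use E_stable Gst KB_stable_B E_subset in auto)
  also have "len KB (G 0) (B (Suc j)) = (\<Sum>s<t. len KB (G s) (G (Suc s)))"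
    unfolding Gt[symmetric] by (rule len_telescope[where G = G]) (simp_all add: Gst Gmono)
  also have "\<dots> = (\<Sum>s<t. len KB (W (colon j) j (t - Suc s)) (B j))"
  proof (rule sum.cong[OF refl])
    fix s
    show "len KB (G s) (G (Suc s)) = len KB (W (colon j) j (t - Suc s)) (B j)"
    proof (rule len_iso[symmetric, where \<phi> = "\<lambda>b. var_pow (Suc j) (Suc s) * b"])
      show "G (Suc s) = set_sum (G s) ((*) (var_pow (Suc j) (Suc s)) ` B j)"
      proof (intro antisym subsetI)
        fix F assume "F \<in> G (Suc s)"
        then obtain e u where eu: "F = e + u" "e \<in> E (Suc j) t" "u \<in> U j (Suc s)"
          by (auto simp: G_def set_sum_def)
        let ?b = "slice (Suc j) (Suc s) u"
        have b: "?b \<in> B j" using eu(3) U_subset by (intro slice_in_B) blast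
        have "e + (u - var_pow (Suc j) (Suc s) * ?b) \<in> G s"
          using eu(2) U_Suc_decompose[OF eu(3)] unfolding G_def set_sum_def by blast
        then have "(e + (u - var_pow (Suc j) (Suc s) * ?b)) + var_pow (Suc j) (Suc s) * ?b
            \<in> set_sum (G s) ((*) (var_pow (Suc j) (Suc s)) ` B j)"
          using b unfolding set_sum_def by blast
        then show "F \<in> set_sum (G s) ((*) (var_pow (Suc j) (Suc s)) ` B j)" by (simp add: eu(1))
      next
        fix F assume "F \<in> set_sum (G s) ((*) (var_pow (Suc j) (Suc s)) ` B j)"
        then obtain g b where "F = g + var_pow (Suc j) (Suc s) * b" "g \<in> G s" "b \<in> B j" by (auto simp: set_sum_def)
        then show "F \<in> G (Suc s)" using Gmono UG var_pow_mult_U[of b j "Suc s"] stableD(2)[OF Gst] by blast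
      qed
      show "var_pow (Suc j) (Suc s) * x \<in> G s \<longleftrightarrow> x \<in> W (colon j) j (t - Suc s)" if "x \<in> B j" for x
        unfolding G_def by (rule lead_ideal[OF j that])
      show "\<exists>h'\<in>KB. \<forall>x\<in>B j. var_pow (Suc j) (Suc s) * h x = h' (var_pow (Suc j) (Suc s) * x)" if "h \<in> KB" for h
        using KB_op(1)[of "(*) (var_pow (Suc j) (Suc s))" h] that by (auto simp: mult_ac)
      show "\<exists>h\<in>KB. \<forall>x\<in>B j. var_pow (Suc j) (Suc s) * h x = h' (var_pow (Suc j) (Suc s) * x)" if "h' \<in> KB" for h'
        using KB_op(2)[of "(*) (var_pow (Suc j) (Suc s))" h'] that by (auto simp: mult_ac)
    qed (use Gst KB_stable_B W_subset in \<open>auto simp: distrib_left\<close>)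
  qed
  also have "\<dots> = (\<Sum>u<t. len KB (W (colon j) j u) (B j))"
    by (rule sum.nat_diff_reindex)
  finally show ?thesis .
qed

lemma hi_stable: "stable (mulops R) (hi R u)" "stable (mulops C) (hi R u)"
  using stable_hi[OF R] stable_mulops_mono[OF _ CX] by auto

lemma len_W:
  assumes c: "stable (mulops R) c" "c \<subseteq> R"
  shows "len KB (W c j u) (B j) = (\<Sum>m\<in>expos {1..j} u. len (mulops C) (set_sum c (hi R (u - edeg m))) R)"
  unfolding W_def B_def
proof (rule len_polys[OF R CX])
  show "set_sum c (hi R v) \<subseteq> R" for v by (rule set_sum_least[OF R_stable c(2) hi_subset])
  show "set_sum c (hi R 0) = R" unfolding hi_0
    by (rule antisym[OF set_sum_least[OF R_stable c(2) subset_refl] set_sum_upper2[OF stableD(1)[OF c(1)]]])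
qed (use stable_hi_sum(2)[OF c(1)] in auto)

lemma len_E_0: "len KB (E 0 t) (B 0) = enat (hR t)"
proof -
  have "lin 0 = {0}" using is_subringD(1)[OF R] by (auto simp: lin_def)
  then have "L 0 \<subseteq> {0}" unfolding L_def by (intro hull_least stable_mulopsI) auto
  then have "L 0 = {0}" using stableD(1)[OF L_stable[of 0]] by auto
  then have "E 0 t = hiB 0 t" by (simp add: E_def set_sum_def)
  also have "\<dots> = {F \<in> polys R {1..0}. \<forall>m. lookup F m \<in> hi R (t - edeg m)}"
    unfolding hiB_def B_def by (rule hi_polys)
  finally have "len KB (E 0 t) (B 0) = (\<Sum>m\<in>expos {1..0::nat} t. len (mulops C) (hi R (t - edeg m)) R)"
    unfolding B_def using hi_stable hi_subset CX
    by (simp only:) (rule len_polys[OF R], auto)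
  then show ?thesis by (simp add: expos_empty len_R)
qed

lemma J_graded:
  assumes "j \<le> d" "x \<in> J j"
  shows "cp u x \<in> J j"
proof -
  obtain a where a: "x = (\<Sum>i\<in>{1..j}. a i * f i)" "\<forall>i. a i \<in> R" using assms(2) by (auto simp: J_def)
  let ?b = "\<lambda>i. if n \<le> u then cp (u - n) (a i) else 0"
  have "cp u x = (\<Sum>i\<in>{1..j}. ?b i * f i)"
    unfolding a(1) cp_sum
    by (intro sum.cong refl) (use assms(1) in \<open>auto simp: cp_mult_f\<close>)
  moreover have "?b i \<in> R" for i using a(2) cp_X is_subringD(1)[OF R] by simp
  ultimately show ?thesis unfolding J_def by (intro CollectI exI[of _ ?b]) simp
qed

section \<open>Hilbert functions modulo the regular sequence\<close>

abbreviation (input) H where "H c u \<equiv> len (mulops C) (set_sum c (hi R u)) R"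

lemma H_finite:
  assumes "stable (mulops R) c"
  obtains h where "H c u = enat h"
proof -
  have "H c u \<le> len (mulops C) (hi R u) R"
    by (rule len_mono[OF set_sum_upper2 subset_refl]) (rule stableD(1)[OF assms])
  then show ?thesis using that unfolding len_R by (metis enat_ile)
qed

definition hc :: "'a set \<Rightarrow> nat \<Rightarrow> nat" where
  "hc c u = the_enat (H c u)"

lemma H_eq: "stable (mulops R) c \<Longrightarrow> H c u = enat (hc c u)"
  using H_finite[of c u] by (metis hc_def the_enat.simps)

lemma CR_stable: "stable (mulops C) R"
  by (rule stable_mulops_mono[OF R_stable CX])

text \<open>Multiplication by f (j+1), of degree n, is injective modulo \<open>J j\<close> with
  cokernel R / J (j+1). Cutting at order u in the source and u + n in the target keeps the sequence
  exact, because truncation commutes with the multiplication.\<close>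

lemma H_J_Suc:
  assumes j: "j < d"
  shows "H (J j) (u + n) = H (J j) u + H (J (Suc j)) (u + n)"
proof -
  let ?K = "set_sum (J j) (hi R (u + n))" and ?K' = "set_sum (J (Suc j)) (hi R (u + n))"
  have fR: "f (Suc j) \<in> R" using j f_R by simp
  have JR: "J j \<subseteq> R" "J (Suc j) \<subseteq> R" using j J_subset by auto
  have "H (J j) (u + n) = len (mulops C) ?K ?K' + len (mulops C) ?K' R"
  proof (rule len_add)
    show "?K \<subseteq> ?K'" by (rule set_sum_mono[OF J_mono])
    show "?K' \<subseteq> R" by (rule set_sum_least[OF R_stable JR(2) hi_subset])
  qed (use stable_hi_sum(2)[OF J_stable] CR_stable in auto)
  also have "len (mulops C) ?K ?K' = H (J j) u"
  proof (rule len_iso[symmetric, where \<phi> = "\<lambda>x. x * f (Suc j)"])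
    show "?K' = set_sum ?K ((\<lambda>x. x * f (Suc j)) ` R)"
    proof (intro antisym subsetI)
      fix x assume "x \<in> ?K'"
      then obtain y h where "x = y + h" "y \<in> J (Suc j)" "h \<in> hi R (u + n)" by (auto simp: set_sum_def)
      then obtain z a where *: "x = (z + a * f (Suc j)) + h" "z \<in> J j" "a \<in> R" "h \<in> hi R (u + n)" by (auto simp: J_Suc)
      then have "(z + h) + a * f (Suc j) \<in> set_sum ?K ((\<lambda>x. x * f (Suc j)) ` R)"
        unfolding set_sum_def by blast
      then show "x \<in> set_sum ?K ((\<lambda>x. x * f (Suc j)) ` R)" by (simp add: *(1) add_ac)
    next
      fix x assume "x \<in> set_sum ?K ((\<lambda>x. x * f (Suc j)) ` R)"
      then obtain z h a where *: "x = (z + h) + a * f (Suc j)" "z \<in> J j" "h \<in> hi R (u + n)" "a \<in> R"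
        by (auto simp: set_sum_def)
      then have "(z + a * f (Suc j)) + h \<in> ?K'" unfolding set_sum_def using J_Suc by blast
      then show "x \<in> ?K'" by (simp add: *(1) add_ac)
    qed
    fix x assume x: "x \<in> R"
    have "(\<Sum>i<u + n. cp i (x * f (Suc j))) = (\<Sum>i<u + n. if n \<le> i then cp (i - n) x * f (Suc j) else 0)"
      using cp_mult_homogeneous[OF f_homogeneous, of "Suc j"] j by (intro sum.cong) auto
    also have "\<dots> = (\<Sum>i\<in>{n..<u + n}. cp (i - n) x * f (Suc j))"
      by (rule sum.mono_neutral_cong_right) auto
    also have "\<dots> = (\<Sum>i<u. cp i x * f (Suc j))"
      by (rule sum.reindex_bij_witness[of _ "\<lambda>i. i + n" "\<lambda>i. i - n"]) auto
    finally have eq: "(\<Sum>i<u + n. cp i (x * f (Suc j))) = (\<Sum>i<u. cp i x) * f (Suc j)" by (simp add: sum_distrib_right)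
    have tR: "(\<Sum>i<u. cp i x) \<in> R" by (rule diff_trunc_hi(1)[OF R cp_X x])
    have iff: "y \<in> set_sum (J j) (hi R v) \<longleftrightarrow> y \<in> R \<and> (\<Sum>i<v. cp i y) \<in> J j" for y v
      using J_graded[of j] j by (intro set_sum_hi_iff J_stable JR) auto
    have "(\<Sum>i<u. cp i x) * f (Suc j) \<in> J j \<longleftrightarrow> (\<Sum>i<u. cp i x) \<in> J j"
      using regular_J[OF j tR] J_mult[OF fR, of "\<Sum>i<u. cp i x" j] by (metis mult.commute)
    then show "x * f (Suc j) \<in> ?K \<longleftrightarrow> x \<in> set_sum (J j) (hi R u)"
      unfolding iff eq using x fR is_subringD(4)[OF R] by auto
  next
    show "set_sum (J j) (hi R u) \<subseteq> R" by (rule set_sum_least[OF R_stable JR(1) hi_subset])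
  next
    show "\<exists>h'\<in>mulops C. \<forall>x\<in>R. h x * f (Suc j) = h' (x * f (Suc j))" if "h \<in> mulops C" for h
      using that by (auto simp: mulops_def mult.assoc)
    show "\<exists>h\<in>mulops C. \<forall>x\<in>R. h x * f (Suc j) = h' (x * f (Suc j))" if "h' \<in> mulops C" for h'
      using that by (auto simp: mulops_def mult.assoc)
  qed (use stable_hi_sum(2)[OF J_stable] CR_stable in \<open>auto simp: distrib_right\<close>)
  finally show ?thesis .
qed

text \<open>By \<open>H_J_Suc\<close> the next Hilbert function, shifted by n, is the n-step
  difference of the present one. Each step costs one degree and multiplies the leading term by n,
  down to the constant n^d at j = d.\<close>

lemma evpoly_J: "j \<le> d \<Longrightarrow> evpoly (d - j) (int (n ^ j)) (\<lambda>u. int (hc (J j) u))"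
proof (induction j)
  case 0
  have "hc (J 0) u = hR u" for u
    unfolding hc_def J_0 by (simp add: set_sum_def len_R)
  then show ?case using evpoly_R by simp
next
  case (Suc j)
  have "hc (J j) (u + n) = hc (J j) u + hc (J (Suc j)) (u + n)" for u
    using H_J_Suc[of j u] Suc.prems unfolding H_eq[OF J_stable] by simp
  then have eq: "int (hc (J (Suc j)) (u + n)) = int (hc (J j) (u + n)) - int (hc (J j) u)" for u
    by simp
  have "evpoly (Suc (d - Suc j)) (int (n ^ j)) (\<lambda>u. int (hc (J j) u))"
    using Suc by (simp add: Suc_diff_Suc)
  from evpoly_shift_diff[OF this, of n]
  have "evpoly (d - Suc j) (int (n ^ Suc j)) (\<lambda>u. int (hc (J (Suc j)) (u + n)))"
    unfolding eq by simp
  then show ?case by (simp only: evpoly_shift_iff[of _ _ "\<lambda>u. int (hc (J (Suc j)) u)"])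
qed

text \<open>Finite colength is obtained numerically: the Hilbert function of R/J is eventually
  constant, so J + hi R t no longer shrinks.\<close>

lemma hi_subset_J: "\<exists>N. hi R N \<subseteq> J d"
proof -
  obtain N where N: "\<And>t. t \<ge> N \<Longrightarrow> int (hc (J d) t) = int (n ^ d)" using evpoly_J[of d] by auto
  let ?S = "\<lambda>t. set_sum (J d) (hi R t)"
  have SR: "?S t \<subseteq> R" for t by (rule set_sum_least[OF R_stable J_subset hi_subset]) simp
  have eq: "?S (Suc t) = ?S t" if "t \<ge> N" for t
  proof (rule len_eq_0[of "mulops C"])
    have "H (J d) (Suc t) = len (mulops C) (?S (Suc t)) (?S t) + H (J d) t"
      by (rule len_add) (use stable_hi_sum(2)[OF J_stable] CR_stable hi_sum_mono SR in auto)
    moreover have "hc (J d) (Suc t) = hc (J d) t" using N[of t] N[of "Suc t"] that by simp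
    ultimately have "enat (hc (J d) t) = len (mulops C) (?S (Suc t)) (?S t) + enat (hc (J d) t)"
      by (simp add: H_eq[OF J_stable])
    then show "len (mulops C) (?S (Suc t)) (?S t) = 0"
      by (cases "len (mulops C) (?S (Suc t)) (?S t)") (auto simp: zero_enat_def)
  qed (use stable_hi_sum(2)[OF J_stable] hi_sum_mono in auto)
  have iff: "y \<in> ?S v \<longleftrightarrow> y \<in> R \<and> (\<Sum>i<v. cp i y) \<in> J d" for y v
    using J_graded[of d] J_subset[of d] by (intro set_sum_hi_iff J_stable) auto
  \<comment> \<open>A homogeneous element of degree t lies in J + hi R t = J + hi R (t+1), and its
    truncation below t + 1 is the element itself.\<close>
  have cpJ: "cp t x \<in> J d" if "t \<ge> N" "x \<in> R" for t x
  proof -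
    have "cp t x \<in> hi R t" using that cp_X by (auto simp: hi_def cp_cp)
    then have "cp t x \<in> ?S t" using set_sum_upper2[of "J d" "hi R t"] stableD(1)[OF J_stable] by blast
    then have "(\<Sum>i<Suc t. cp i (cp t x)) \<in> J d" using eq[OF that(1)] iff[of "cp t x" "Suc t"] by simp
    moreover have "(\<Sum>i<t. cp i (cp t x)) = 0" by (rule sum.neutral) (auto simp: cp_cp)
    ultimately show ?thesis by (simp add: cp_cp)
  qed
  have "x \<in> J d" if x: "x \<in> hi R N" for x
  proof -
    obtain M where M: "(\<Sum>i<M. cp i x) = x" using cp_total[of x] by blast
    have "cp i x \<in> J d" for i
      using x cpJ[of i x] stableD(1)[OF J_stable] by (cases "i < N") (auto simp: hi_def)
    then have "(\<Sum>i<M. cp i x) \<in> J d" by (intro stable_sum[OF J_stable])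
    then show ?thesis unfolding M .
  qed
  then show ?thesis by blast
qed

text \<open>The colon ideal contains J and so all elements of high order; adding them changes
  nothing, and its Hilbert function is eventually its colength. \<open>len_graded\<close> makes this
  a length over R.\<close>

lemma colon_length:
  obtains cl where "len (mulops R) (colon d) R = enat cl" "evpoly 0 (int cl) (\<lambda>u. int (hc (colon d) u))"
proof -
  obtain N where N: "hi R N \<subseteq> J d" using hi_subset_J by blast
  have S: "set_sum (colon d) (hi R u) = colon d" if "u \<ge> N" for u
  proof -
    have "hi R u \<subseteq> colon d" using hi_mono[OF that] N J_subset_colon[of d] by blast
    then show ?thesis
      by (intro set_sum_absorb[OF colon_stable]) (auto intro: stableD(1)[OF hi_stable(1)])
  qed
  have lenR: "len (mulops R) (colon d) R = enat (hc (colon d) N)"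
    using len_graded(2)[OF colon_stable colon_subset, of d N] H_eq[OF colon_stable, of d N] S[of N] by simp
  have const: "hc (colon d) u = hc (colon d) N" if "u \<ge> N" for u
    unfolding hc_def S[OF that] S[OF order_refl] ..
  have "evpoly 0 (int (hc (colon d) N)) (\<lambda>u. int (hc (colon d) u))"
    unfolding evpoly.simps by (intro exI[of _ N] allI impI arg_cong[of _ _ int] const)
  from that[OF lenR this] show ?thesis .
qed

text \<open>For each j the colon ideal has growth of degree d - j in R, hence d in
  \<open>B j\<close> after adding j variables, and d + 1 after summing over u. The leading terms are
  n^j for j < d, where the colon ideal is \<open>J j\<close>, and the colength of the colon ideal
  for j = d.\<close>

theorem hilbert_sum:
  obtains cl h where "len (mulops R) (colon d) R = enat cl"
    "\<And>t. (\<Sum>i<t. len (mulops (B (Suc d))) (E (Suc d) (Suc i)) (E (Suc d) i)) = enat (h t)"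
    "evpoly (Suc d) (int ((\<Sum>j<d. n ^ j) + cl)) (\<lambda>t. int (h t))"
proof -
  obtain cl where cl: "len (mulops R) (colon d) R = enat cl" "evpoly 0 (int cl) (\<lambda>u. int (hc (colon d) u))"
    by (rule colon_length)
  define e where "e j = (if j < d then int (n ^ j) else int cl)" for j
  define q where "q j u = (\<Sum>m\<in>expos {1..j} u. hc (colon j) (u - edeg m))" for j :: nat and u
  have q: "len KB (W (colon j) j u) (B j) = enat (q j u)" for j u
    unfolding len_W[OF colon_stable colon_subset] H_eq[OF colon_stable] sum_enat q_def ..
  have qe: "evpoly d (e j) (\<lambda>u. int (q j u))" if "j \<le> d" for j
  proof -
    have "evpoly (d - j) (e j) (\<lambda>u. int (hc (colon j) u))"
      using that cl(2) evpoly_J[of j] colon_eq_J[of j] by (cases "j = d") (auto simp: e_def)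
    from evpoly_expos[OF this, of j] show ?thesis using that by (simp add: q_def)
  qed
  define h where "h t = hR t + (\<Sum>j\<le>d. \<Sum>u<t. q j u)" for t
  have "len KB (E j t) (B j) = enat (hR t + (\<Sum>i<j. \<Sum>u<t. q i u))" if "j \<le> Suc d" for j t
    using that
  proof (induction j)
    case 0
    then show ?case by (simp add: len_E_0)
  next
    case (Suc j)
    then show ?case using len_E_Suc[of j t] by (simp add: q sum_enat add.assoc)
  qed
  then have lenE: "len KB (E (Suc d) t) (B (Suc d)) = enat (h t)" for t
    by (simp add: h_def lessThan_Suc_atMost)
  have "(\<Sum>i<t. len (mulops (B (Suc d))) (E (Suc d) (Suc i)) (E (Suc d) i)) = enat (h t)" for t
    using connected_grading.len_graded(1)[OF cgB L_stable L_subset_B, of "Suc d" t] lenE[of t]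
    unfolding E_def hiB_def by simp
  \<comment> \<open>The summand 0 belongs to \<open>hR\<close>, whose growth has only degree
    d.\<close>
  moreover have "evpoly (Suc d) (0 + (\<Sum>j\<le>d. e j)) (\<lambda>t. int (hR t) + (\<Sum>j\<le>d. \<Sum>u<t. int (q j u)))"
    by (intro evpoly_add evpoly_sum evpoly_raise[OF evpoly_R] evpoly_psum qe) auto
  moreover have "(\<Sum>j\<le>d. e j) = int ((\<Sum>j<d. n ^ j) + cl)"
    by (simp add: lessThan_Suc_atMost[symmetric] e_def)
  ultimately show ?thesis using cl(1) that[of cl h] by (simp add: h_def)
qed

end

section \<open>Comparison with modules over HOL-Algebra rings\<close>

lemma mpoly_ring_sel [simp]:
  "mult (mpoly_ring K V) = (*)" "one (mpoly_ring K V) = 1" "zero (mpoly_ring K V) = 0" "add (mpoly_ring K V) = (+)"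
  by (simp_all add: mpoly_ring_def)

lemma cring_mpoly_ring:
  assumes K: "is_subring K"
  shows "cring (mpoly_ring K V)"
proof -
  note M = is_subringD[OF is_subring_polys[OF K, of V]]
  note c = carrier_mpoly_ring[OF is_subringD(1)[OF K], of V]
  show ?thesis
  proof (rule cringI)
    show "abelian_group (mpoly_ring K V)"
      by (rule abelian_groupI) (auto simp: c M add_ac intro: bexI[of _ "- x" for x])
    show "Group.comm_monoid (mpoly_ring K V)"
      by (rule comm_monoidI) (auto simp: c M mult_ac)
  qed (auto simp: distrib_right)
qed

lemma ideal_mpoly_ring_iff:
  assumes K: "is_subring K"
  shows "ideal N (mpoly_ring K V) \<longleftrightarrow> N \<subseteq> polys K V \<and> stable (mulops (polys K V)) N"
proof -
  note M = is_subringD[OF is_subring_polys[OF K, of V]]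
  note c = carrier_mpoly_ring[OF is_subringD(1)[OF K], of V]
  interpret cring "mpoly_ring K V" by (rule cring_mpoly_ring[OF K])
  have neg: "a_inv (mpoly_ring K V) x = - x" if "x \<in> polys K V" for x
    by (rule minus_equality) (use that in \<open>auto simp: c M\<close>)
  show ?thesis
  proof
    assume "ideal N (mpoly_ring K V)"
    then interpret I: ideal N "mpoly_ring K V" .
    have sub: "N \<subseteq> polys K V" using I.a_subset c by simp
    have "stable (mulops (polys K V)) N"
    proof (rule stable_mulopsI)
      show "0 \<in> N" using I.zero_closed by simp
      show "x + y \<in> N" if "x \<in> N" "y \<in> N" for x y using I.a_closed[OF that] by simp
      show "- x \<in> N" if "x \<in> N" for x 
        using I.I_l_closed[OF that, of "- 1"] M(2) M(5)[of 1] c by simp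
      show "r * x \<in> N" if "r \<in> polys K V" "x \<in> N" for r x using I.I_l_closed[of x r] that c by simp
    qed
    then show "N \<subseteq> polys K V \<and> stable (mulops (polys K V)) N" using sub by simp
  next
    assume N: "N \<subseteq> polys K V \<and> stable (mulops (polys K V)) N"
    note st = stableD[OF conjunct2[OF N]]
    show "ideal N (mpoly_ring K V)"
    proof (rule idealI[OF ring_axioms])
      show "subgroup N (add_monoid (mpoly_ring K V))"
      proof (rule subgroup.intro)
        show "N \<subseteq> carrier (add_monoid (mpoly_ring K V))" using N c by simp
        show "\<one>\<^bsub>add_monoid (mpoly_ring K V)\<^esub> \<in> N" using st(1) by simp
        fix x assume x: "x \<in> N"
        show "x \<otimes>\<^bsub>add_monoid (mpoly_ring K V)\<^esub> y \<in> N" if "y \<in> N" for y using st(2)[OF x that] by simp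
        have "x \<in> polys K V" using N x by auto
        from st(3)[OF x] show "m_inv (add_monoid (mpoly_ring K V)) x \<in> N"
          unfolding neg[OF \<open>x \<in> polys K V\<close>, unfolded a_inv_def] .
      qed
      show "x \<otimes>\<^bsub>mpoly_ring K V\<^esub> a \<in> N" "a \<otimes>\<^bsub>mpoly_ring K V\<^esub> x \<in> N"
        if "a \<in> N" "x \<in> carrier (mpoly_ring K V)" for a x
        using stable_mulops_mult[OF conjunct2[OF N], of x a] that c by (auto simp: mult.commute)
    qed
  qed
qed

lemma genideal_mpoly_ring:
  assumes K: "is_subring K" and G: "G \<subseteq> polys K V"
  shows "genideal (mpoly_ring K V) G = ideal_hull (polys K V) G"
proof (rule antisym)
  note Ms = is_subring_polys[OF K, of V]
  show "genideal (mpoly_ring K V) G \<subseteq> ideal_hull (polys K V) G"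
    unfolding genideal_def
  proof (rule Inter_lower, rule CollectI, rule conjI)
    show "ideal (ideal_hull (polys K V) G) (mpoly_ring K V)"
      unfolding ideal_mpoly_ring_iff[OF K]
      by (intro conjI stable_hull[OF Ms] hull_least[OF _ G] stable_is_subring[OF Ms subset_refl])
    show "G \<subseteq> ideal_hull (polys K V) G" by (rule hull_superset[OF Ms])
  qed
  show "ideal_hull (polys K V) G \<subseteq> genideal (mpoly_ring K V) G"
    unfolding genideal_def
    by (rule Inter_greatest, rule hull_least) (auto simp: ideal_mpoly_ring_iff[OF K])
qed

text \<open>Describes a module of cosets by a map from a subset of an ordinary type, so that lengths
  become values of \<open>len\<close>. Everything about Q, down to additive inverses, is transported
  along \<phi>.\<close>

locale module_cover =
  fixes Q :: "('r::comm_ring_1, 'q, 'e) module_scheme" and S :: "('r, 'z) ring_scheme" and \<phi> :: "'r \<Rightarrow> 'q" and D :: "'r set"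
  assumes D: "stable (mulops (carrier S)) D"
    and onto: "\<phi> ` D = carrier Q"
    and add: "x \<in> D \<Longrightarrow> y \<in> D \<Longrightarrow> \<phi> (x + y) = \<phi> x \<oplus>\<^bsub>Q\<^esub> \<phi> y"
    and smult: "r \<in> carrier S \<Longrightarrow> x \<in> D \<Longrightarrow> \<phi> (r * x) = r \<odot>\<^bsub>Q\<^esub> \<phi> x"
    and zero: "\<phi> 0 = \<zero>\<^bsub>Q\<^esub>"
begin

definition ker :: "'r set" where
  "ker = {x \<in> D. \<phi> x = \<zero>\<^bsub>Q\<^esub>}"

lemma ker_add:
  assumes "x \<in> ker" "y \<in> D"
  shows "\<phi> (x + y) = \<phi> y"
proof -
  \<comment> \<open>With the zero of Q written as \<phi> 0, its unit law becomes an instance of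
    additivity of \<phi>.\<close>
  have "\<phi> (x + y) = \<phi> 0 \<oplus>\<^bsub>Q\<^esub> \<phi> y" using assms by (simp add: ker_def add zero)
  also have "\<dots> = \<phi> (0 + y)" using stableD(1)[OF D] assms(2) by (rule add[symmetric])
  finally show ?thesis by simp
qed

lemma ker_stable: "stable (mulops (carrier S)) ker"
proof (rule stable_mulopsI)
  show "0 \<in> ker" using stableD(1)[OF D] by (simp add: ker_def zero)
  fix x assume x: "x \<in> ker"
  then have xD: "x \<in> D" "- x \<in> D" using stableD(3)[OF D] by (auto simp: ker_def)
  show "x + y \<in> ker" if "y \<in> ker" for y
    using that xD ker_add[OF x, of y] stableD(2)[OF D] by (simp add: ker_def)
  show "- x \<in> ker" using xD ker_add[OF x, of "- x"] by (simp add: ker_def zero)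
  show "r * x \<in> ker" if r: "r \<in> carrier S" for r
    using smult[OF r xD(1)] smult[OF r stableD(1)[OF D]] x r stable_mulops_mult[OF D r xD(1)]
    by (simp add: ker_def zero)
qed

lemma eq_iff:
  assumes x: "x \<in> D" and y: "y \<in> D"
  shows "\<phi> x = \<phi> y \<longleftrightarrow> x - y \<in> ker"
proof
  have d: "x - y \<in> D" "- y \<in> D" using stableD(3,5)[OF D] x y by auto
  assume "\<phi> x = \<phi> y"
  then have "\<phi> (x + - y) = \<phi> (y + - y)" using add[OF x d(2)] add[OF y d(2)] by simp
  then show "x - y \<in> ker" using d by (simp add: ker_def zero)
next
  assume "x - y \<in> ker"
  from ker_add[OF this y] show "\<phi> x = \<phi> y" by simp
qed

lemma inv_eq:
  assumes x: "x \<in> D"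
  shows "m_inv (add_monoid Q) (\<phi> x) = \<phi> (- x)"
  unfolding m_inv_def
proof (rule the_equality)
  have "- x \<in> D" by (rule stableD(3)[OF D x])
  then show "\<phi> (- x) \<in> carrier (add_monoid Q) \<and> \<phi> x \<otimes>\<^bsub>add_monoid Q\<^esub> \<phi> (- x) = \<one>\<^bsub>add_monoid Q\<^esub> \<and>
      \<phi> (- x) \<otimes>\<^bsub>add_monoid Q\<^esub> \<phi> x = \<one>\<^bsub>add_monoid Q\<^esub>"
    using onto x by (simp add: add[symmetric] zero[symmetric] image_iff) blast
next
  fix y assume "y \<in> carrier (add_monoid Q) \<and> \<phi> x \<otimes>\<^bsub>add_monoid Q\<^esub> y = \<one>\<^bsub>add_monoid Q\<^esub> \<and>
      y \<otimes>\<^bsub>add_monoid Q\<^esub> \<phi> x = \<one>\<^bsub>add_monoid Q\<^esub>"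
  then have "y \<in> \<phi> ` D" "y \<oplus>\<^bsub>Q\<^esub> \<phi> x = \<zero>\<^bsub>Q\<^esub>" by (simp_all add: onto)
  then obtain c where c: "c \<in> D" "y = \<phi> c" "c + x \<in> ker" using x stableD(2)[OF D] by (auto simp: ker_def add)
  then show "y = \<phi> (- x)" using ker_add[OF c(3) stableD(3)[OF D x]] by simp
qed

lemma submodule_iff:
  "submodule N S Q \<longleftrightarrow> N \<subseteq> carrier Q \<and> stable (mulops (carrier S)) {x \<in> D. \<phi> x \<in> N}"
proof
  assume "submodule N S Q"
  then interpret N: submodule N S Q .
  have sub: "N \<subseteq> carrier Q" using N.subset by simp
  have "stable (mulops (carrier S)) {x \<in> D. \<phi> x \<in> N}"
  proof (rule stable_mulopsI)
    show "0 \<in> {x \<in> D. \<phi> x \<in> N}" using N.one_closed stableD(1)[OF D] by (simp add: zero)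
    show "x + y \<in> {x \<in> D. \<phi> x \<in> N}" if "x \<in> {x \<in> D. \<phi> x \<in> N}" "y \<in> {x \<in> D. \<phi> x \<in> N}" for x y
      using N.m_closed[of "\<phi> x" "\<phi> y"] stableD(2)[OF D] that by (simp add: add)
    show "- x \<in> {x \<in> D. \<phi> x \<in> N}" if "x \<in> {x \<in> D. \<phi> x \<in> N}" for x
    proof -
      have "m_inv (add_monoid Q) (\<phi> x) \<in> N" by (rule N.m_inv_closed) (use that in simp)
      then show ?thesis using stableD(3)[OF D, of x] inv_eq[of x] that by auto
    qed
    show "r * x \<in> {x \<in> D. \<phi> x \<in> N}" if "r \<in> carrier S" "x \<in> {x \<in> D. \<phi> x \<in> N}" for r x
      using N.smult_closed[of r "\<phi> x"] stable_mulops_mult[OF D] that by (simp add: smult)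
  qed
  then show "N \<subseteq> carrier Q \<and> stable (mulops (carrier S)) {x \<in> D. \<phi> x \<in> N}" using sub by simp
next
  assume N: "N \<subseteq> carrier Q \<and> stable (mulops (carrier S)) {x \<in> D. \<phi> x \<in> N}"
  note st = conjunct2[OF N]
  have lift: "\<exists>x\<in>D. y = \<phi> x" if "y \<in> N" for y using N that onto by auto
  show "submodule N S Q"
  proof (intro submodule.intro subgroup.intro submodule_axioms.intro)
    show "N \<subseteq> carrier (add_monoid Q)" using N by simp
    show "\<one>\<^bsub>add_monoid Q\<^esub> \<in> N" using stableD(1)[OF st] by (simp add: zero)
    fix y assume y: "y \<in> N"
    then obtain x where x: "x \<in> D" "y = \<phi> x" using lift by blast
    show "m_inv (add_monoid Q) y \<in> N"
      using stableD(3)[OF st, of x] x y by (simp add: inv_eq)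
    show "y \<otimes>\<^bsub>add_monoid Q\<^esub> y' \<in> N" if y': "y' \<in> N" for y'
    proof -
      obtain x' where x': "x' \<in> D" "y' = \<phi> x'" using lift[OF y'] by blast
      then show ?thesis using stableD(2)[OF st, of x x'] x y y' by (simp add: add)
    qed
    show "r \<odot>\<^bsub>Q\<^esub> y \<in> N" if "r \<in> carrier S" for r
      using stable_mulops_mult[OF st that, of x] x y that by (simp add: smult)
  qed
qed

lemma module_length_eq: "module_length S Q = len (mulops (carrier S)) ker D"
proof -
  have eq: "module_length S Q = chain_len (\<lambda>N. submodule N S Q)"
    by (simp add: module_length_def chain_len_def)
  have img: "\<phi> ` {x \<in> D. \<phi> x \<in> N} = N" if "N \<subseteq> carrier Q" for N using that onto by auto
  have pre: "{x \<in> D. \<phi> x \<in> \<phi> ` X} = X" if X: "stable (mulops (carrier S)) X" "ker \<subseteq> X" "X \<subseteq> D" for X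
  proof (intro antisym subsetI)
    fix x assume "x \<in> {x \<in> D. \<phi> x \<in> \<phi> ` X}"
    then obtain y where y: "x \<in> D" "y \<in> X" "\<phi> x = \<phi> y" by auto
    then have "x - y \<in> ker" using eq_iff[of x y] X(3) by auto
    then have "(x - y) + y \<in> X" using X y by (intro stableD(2)[OF X(1)]) auto
    then show "x \<in> X" by simp
  qed (use X in auto)
  show ?thesis unfolding eq len_def
  proof (rule antisym)
    show "chain_len (\<lambda>N. submodule N S Q) \<le> chain_len (\<lambda>N. stable (mulops (carrier S)) N \<and> ker \<subseteq> N \<and> N \<subseteq> D)"
    proof (rule chain_len_map_le[where g = "\<lambda>N. {x \<in> D. \<phi> x \<in> N}"])
      fix X assume "submodule X S Q"
      then have X: "X \<subseteq> carrier Q" "stable (mulops (carrier S)) {x \<in> D. \<phi> x \<in> X}" by (auto simp: submodule_iff)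
      have "\<zero>\<^bsub>Q\<^esub> \<in> X" using stableD(1)[OF X(2)] by (simp add: zero)
      then show "stable (mulops (carrier S)) {x \<in> D. \<phi> x \<in> X} \<and> ker \<subseteq> {x \<in> D. \<phi> x \<in> X} \<and> {x \<in> D. \<phi> x \<in> X} \<subseteq> D"
        using X(2) by (auto simp: ker_def)
    next
      fix X Y assume XY: "submodule X S Q" "submodule Y S Q" "X \<subset> Y"
      then have "X \<subseteq> carrier Q" "Y \<subseteq> carrier Q" by (auto simp: submodule_iff)
      then have "{x \<in> D. \<phi> x \<in> X} \<noteq> {x \<in> D. \<phi> x \<in> Y}" using img XY(3) by (metis less_irrefl)
      then show "{x \<in> D. \<phi> x \<in> X} \<subset> {x \<in> D. \<phi> x \<in> Y}" using XY(3) by auto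
    qed
    show "chain_len (\<lambda>N. stable (mulops (carrier S)) N \<and> ker \<subseteq> N \<and> N \<subseteq> D) \<le> chain_len (\<lambda>N. submodule N S Q)"
    proof (rule chain_len_map_le[where g = "\<lambda>X. \<phi> ` X"])
      fix X assume "stable (mulops (carrier S)) X \<and> ker \<subseteq> X \<and> X \<subseteq> D"
      then show "submodule (\<phi> ` X) S Q" unfolding submodule_iff using pre[of X] onto by auto
    next
      fix X Y assume "stable (mulops (carrier S)) X \<and> ker \<subseteq> X \<and> X \<subseteq> D"
        "stable (mulops (carrier S)) Y \<and> ker \<subseteq> Y \<and> Y \<subseteq> D" "X \<subset> Y"
      then have "\<phi> ` X \<noteq> \<phi> ` Y" "\<phi> ` X \<subseteq> \<phi> ` Y" using pre[of X] pre[of Y] by (metis less_irrefl, blast)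
      then show "\<phi> ` X \<subset> \<phi> ` Y" by auto
    qed
  qed
qed

end

lemma a_r_coset_image: "H +>\<^bsub>G\<^esub> a = (\<lambda>h. h \<oplus>\<^bsub>G\<^esub> a) ` H"
  by (auto simp: a_r_coset_def')

locale cyclic_cover = module_cover A S \<pi> "carrier S"
  for A :: "('r::comm_ring_1, 'm) module" and S :: "('r, 'z) ring_scheme" and \<pi> +
  assumes S: "is_subring (carrier S)"
begin

text \<open>The covering map identifies \<open>A\<close> with \<open>S/ker\<close>, so \<open>I A\<close> corresponds to \<open>ker + I\<close>.\<close>

lemma ideal_smult_eq:
  assumes I: "stable (mulops (carrier S)) I" "I \<subseteq> carrier S"
  shows "ideal_smult S I A = \<pi> ` set_sum ker I"
proof (rule antisym)
  have kS: "ker \<subseteq> carrier S" by (auto simp: ker_def)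
  have st: "stable (mulops (carrier S)) (set_sum ker I)"
    by (rule stable_set_sum[OF additive_mulops ker_stable I(1)])
  have sub: "set_sum ker I \<subseteq> carrier S" by (rule set_sum_least[OF D kS I(2)])
  have ksub: "ker \<subseteq> set_sum ker I" by (rule set_sum_upper1[OF stableD(1)[OF I(1)]])
  have Isub: "I \<subseteq> set_sum ker I" by (rule set_sum_upper2[OF stableD(1)[OF ker_stable]])
  have sat: "{x \<in> carrier S. \<pi> x \<in> \<pi> ` set_sum ker I} = set_sum ker I"
  proof (intro antisym subsetI)
    fix x assume "x \<in> {x \<in> carrier S. \<pi> x \<in> \<pi> ` set_sum ker I}"
    then obtain y where y: "x \<in> carrier S" "y \<in> set_sum ker I" "\<pi> x = \<pi> y" by auto
    then have "x - y \<in> ker" using eq_iff[of x y] sub by auto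
    then have "(x - y) + y \<in> set_sum ker I" using ksub y(2) by (intro stableD(2)[OF st]) auto
    then show "x \<in> set_sum ker I" by simp
  qed (use sub in auto)
  show "ideal_smult S I A \<subseteq> \<pi> ` set_sum ker I"
    unfolding ideal_smult_def
  proof (rule Inter_lower, intro CollectI conjI ballI)
    show "submodule (\<pi> ` set_sum ker I) S A"
      unfolding submodule_iff sat using st sub onto by auto
    fix r x assume r: "r \<in> I" and "x \<in> carrier A"
    then obtain b where b: "b \<in> carrier S" "x = \<pi> b" using onto by auto
    have "r * b \<in> I" using stable_mulops_mult[OF I(1) b(1) r] by (simp add: mult.commute)
    moreover have "r \<odot>\<^bsub>A\<^esub> x = \<pi> (r * b)" using smult[of r b] r b I(2) by auto
    ultimately show "r \<odot>\<^bsub>A\<^esub> x \<in> \<pi> ` set_sum ker I" using Isub by auto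
  qed
  show "\<pi> ` set_sum ker I \<subseteq> ideal_smult S I A"
    unfolding ideal_smult_def
  proof (rule Inter_greatest)
    fix N assume "N \<in> {N. submodule N S A \<and> (\<forall>r\<in>I. \<forall>x\<in>carrier A. r \<odot>\<^bsub>A\<^esub> x \<in> N)}"
    then have N: "stable (mulops (carrier S)) {x \<in> carrier S. \<pi> x \<in> N}" "\<And>r x. r \<in> I \<Longrightarrow> x \<in> carrier A \<Longrightarrow> r \<odot>\<^bsub>A\<^esub> x \<in> N"
      by (auto simp: submodule_iff)
    have "set_sum ker I \<subseteq> {x \<in> carrier S. \<pi> x \<in> N}"
    proof (rule set_sum_least[OF N(1)])
      have "\<zero>\<^bsub>A\<^esub> \<in> N" using stableD(1)[OF N(1)] by (simp add: zero)
      then show "ker \<subseteq> {x \<in> carrier S. \<pi> x \<in> N}" by (auto simp: ker_def)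
      show "I \<subseteq> {x \<in> carrier S. \<pi> x \<in> N}"
      proof
        fix r assume r: "r \<in> I"
        have "\<pi> 1 \<in> carrier A" unfolding onto[symmetric] using is_subringD(2)[OF S] by (rule imageI)
        then have "\<pi> (r * 1) \<in> N" using N(2)[OF r, of "\<pi> 1"] is_subringD(2)[OF S] smult[of r 1] r I(2) by auto
        then show "r \<in> {x \<in> carrier S. \<pi> x \<in> N}" using r I(2) by auto
      qed
    qed
    then show "\<pi> ` set_sum ker I \<subseteq> N" by auto
  qed
qed

text \<open>The cosets of \<pi>(E') in \<pi>(E) are the sets \<pi>(E' + b) with b in E. Hence E
  covers the quotient, and the kernel is exactly E' because E' contains the kernel of \<pi>.\<close>

lemma quot_module_length:
  assumes E: "stable (mulops (carrier S)) E" "E \<subseteq> carrier S" and E': "stable (mulops (carrier S)) E'" "ker \<subseteq> E'" "E' \<subseteq> E"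
  shows "module_length S (quot_module (A\<lparr>carrier := \<pi> ` E\<rparr>) (\<pi> ` E')) = len (mulops (carrier S)) E' E"
proof -
  let ?Q = "quot_module (A\<lparr>carrier := \<pi> ` E\<rparr>) (\<pi> ` E')"
  define \<phi> where "\<phi> b = \<pi> ` ((\<lambda>e. e + b) ` E')" for b
  have coset: "\<pi> ` E' +>\<^bsub>A\<lparr>carrier := \<pi> ` E\<rparr>\<^esub> \<pi> b = \<phi> b" if "b \<in> carrier S" for b
  proof -
    have "\<pi> e \<oplus>\<^bsub>A\<^esub> \<pi> b = \<pi> (e + b)" if "e \<in> E'" for e using that \<open>b \<in> carrier S\<close> E E' add by auto
    then show ?thesis unfolding a_r_coset_image \<phi>_def image_image by (intro image_cong) auto
  qed
  have coset': "\<pi> ` E' +>\<^bsub>A\<^esub> \<pi> b = \<phi> b" if "b \<in> carrier S" for b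
    using coset[OF that] by (simp add: a_r_coset_image)
  have shift: "(\<lambda>e. e + b) ` E' = E'" if "b \<in> E'" for b
  proof (intro antisym subsetI)
    fix x assume "x \<in> E'"
    then show "x \<in> (\<lambda>e. e + b) ` E'" using stableD(5)[OF E'(1) _ that, of x]
      by (intro image_eqI[of _ _ "x - b"]) auto
  qed (use that stableD(2)[OF E'(1)] in auto)
  interpret Q: module_cover ?Q S \<phi> E
  proof
    show "stable (mulops (carrier S)) E" by (rule E(1))
    show "\<phi> ` E = carrier ?Q"
      unfolding quot_module_def A_RCOSETS_def' using coset E(2) by auto
    show "\<phi> 0 = \<zero>\<^bsub>?Q\<^esub>" by (simp add: \<phi>_def quot_module_def)
  next
    fix x y assume xy: "x \<in> E" "y \<in> E"
    have "\<phi> x \<oplus>\<^bsub>?Q\<^esub> \<phi> y = (\<Union>e\<in>E'. \<Union>e'\<in>E'. {\<pi> (e + x) \<oplus>\<^bsub>A\<^esub> \<pi> (e' + y)})"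
      by (auto simp: quot_module_def set_add_def' \<phi>_def)
    also have "\<dots> = (\<Union>e\<in>E'. \<Union>e'\<in>E'. {\<pi> ((e + x) + (e' + y))})"
    proof -
      have "\<pi> (e + x) \<oplus>\<^bsub>A\<^esub> \<pi> (e' + y) = \<pi> ((e + x) + (e' + y))" if "e \<in> E'" "e' \<in> E'" for e e'
      proof (rule add[symmetric])
        have "e + x \<in> E" "e' + y \<in> E" using that xy E'(3) by (auto intro: stableD(2)[OF E(1)])
        then show "e + x \<in> carrier S" "e' + y \<in> carrier S" using E(2) by auto
      qed
      then show ?thesis by auto
    qed
    also have "\<dots> = \<phi> (x + y)"
    proof (intro antisym subsetI)
      fix z assume "z \<in> (\<Union>e\<in>E'. \<Union>e'\<in>E'. {\<pi> ((e + x) + (e' + y))})"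
      then obtain e e' where "e \<in> E'" "e' \<in> E'" "z = \<pi> ((e + e') + (x + y))" by (auto simp: add_ac)
      then show "z \<in> \<phi> (x + y)" unfolding \<phi>_def using stableD(2)[OF E'(1)] by blast
    next
      fix z assume "z \<in> \<phi> (x + y)"
      then obtain e where "e \<in> E'" "z = \<pi> (e + (x + y))" by (auto simp: \<phi>_def)
      then have "e \<in> E'" "0 \<in> E'" "z = \<pi> ((e + x) + (0 + y))" using stableD(1)[OF E'(1)] by (auto simp: add_ac)
      then show "z \<in> (\<Union>e\<in>E'. \<Union>e'\<in>E'. {\<pi> ((e + x) + (e' + y))})" by blast
    qed
    finally show "\<phi> (x + y) = \<phi> x \<oplus>\<^bsub>?Q\<^esub> \<phi> y" ..
  next
    fix r x assume r: "r \<in> carrier S" and x: "x \<in> E"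
    have "\<pi> ` E' +>\<^bsub>A\<lparr>carrier := \<pi> ` E\<rparr>\<^esub> (r \<odot>\<^bsub>A\<^esub> z) = \<phi> (r * x)" if z: "z \<in> \<phi> x" for z
    proof -
      obtain e where e: "e \<in> E'" "z = \<pi> (e + x)" using z by (auto simp: \<phi>_def)
      have ex: "e + x \<in> carrier S" using e(1) x E(2) E'(3) stableD(2)[OF E(1), of e x] by blast
      have "r \<odot>\<^bsub>A\<^esub> z = \<pi> (r * (e + x))" unfolding e(2) by (rule smult[symmetric, OF r ex])
      moreover have "r * (e + x) \<in> carrier S" by (rule is_subringD(4)[OF S r ex])
      ultimately have "\<pi> ` E' +>\<^bsub>A\<lparr>carrier := \<pi> ` E\<rparr>\<^esub> (r \<odot>\<^bsub>A\<^esub> z) = \<phi> (r * (e + x))" using coset by simp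
      also have "\<dots> = \<pi> ` ((\<lambda>e. e + r * x) ` ((\<lambda>e'. e' + r * e) ` E'))"
        unfolding \<phi>_def image_image by (simp add: distrib_left add_ac)
      also have "\<dots> = \<phi> (r * x)" unfolding \<phi>_def using shift[OF stable_mulops_mult[OF E'(1) r e(1)]] by simp
      finally show ?thesis .
    qed
    moreover have "\<phi> x \<noteq> {}" using stableD(1)[OF E'(1)] by (auto simp: \<phi>_def)
    ultimately show "\<phi> (r * x) = r \<odot>\<^bsub>?Q\<^esub> \<phi> x" by (auto simp: quot_module_def)
  qed
  have zQ: "zero ?Q = \<pi> ` E'" by (simp add: quot_module_def)
  have "Q.ker = E'"
  proof (intro antisym subsetI)
    fix b assume "b \<in> Q.ker"
    then have b: "b \<in> E" "\<phi> b = \<pi> ` E'" unfolding Q.ker_def zQ by auto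
    have "\<pi> (0 + b) \<in> \<phi> b" unfolding \<phi>_def using stableD(1)[OF E'(1)] by blast
    then obtain e where e: "e \<in> E'" "\<pi> b = \<pi> e" using b by auto
    then have "b - e \<in> E'" using eq_iff[of b e] b E E' by auto
    then have "(b - e) + e \<in> E'" using e(1) by (rule stableD(2)[OF E'(1)])
    then show "b \<in> E'" by simp
  next
    fix b assume "b \<in> E'"
    then show "b \<in> Q.ker" using shift[of b] E'(3) unfolding Q.ker_def zQ \<phi>_def by auto
  qed
  then show ?thesis using Q.module_length_eq by simp
qed

end

section \<open>The symmetric algebra as a quotient of a polynomial ring\<close>

lemma polys_gen_induct [consumes 2, case_names const var add mult]:
  assumes K: "is_subring K" and F: "F \<in> polys K V"
    and c: "\<And>a. a \<in> K \<Longrightarrow> P (mConst a)" and v: "\<And>v. v \<in> V \<Longrightarrow> P (mVar v)"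
    and add: "\<And>F G. F \<in> polys K V \<Longrightarrow> G \<in> polys K V \<Longrightarrow> P F \<Longrightarrow> P G \<Longrightarrow> P (F + G)"
    and mult: "\<And>F G. F \<in> polys K V \<Longrightarrow> G \<in> polys K V \<Longrightarrow> P F \<Longrightarrow> P G \<Longrightarrow> P (F * G)"
  shows "P F"
  using is_subring_stable[OF K] F
proof (induction rule: polys_induct)
  case (single m a)
  note M = is_subringD[OF is_subring_polys[OF K, of V]]
  have one: "P 1" using c[of 1] is_subringD(2)[OF K] by simp
  have pow: "P (mVar v ^ e) \<and> mVar v ^ e \<in> polys K V" if "v \<in> V" for v e
    by (induction e) (auto simp: one M polys_mVar[OF K that] intro!: mult v that)
  have "P (\<Prod>v\<in>S. mVar v ^ lookup m v) \<and> (\<Prod>v\<in>S. mVar v ^ lookup m v) \<in> polys K V" if "S \<subseteq> V" for S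
    using that by (induction S rule: infinite_finite_induct) (auto simp: one M pow intro!: mult)
  then have "P (mon mVar m) \<and> mon mVar m \<in> polys K V" using single by (simp add: mon_def)
  then have "P (mConst a * mon mVar m)"
    using single c by (intro mult polys_mConst is_subring_stable K) auto
  then show ?case by (simp add: mon_mVar mConst_def mult_single)
qed (use add in auto)

text \<open>Serves twice: for the symmetric algebra, with \<psi> sending T i to the variable named f
  i, and for R modulo the colon ideal, with \<psi> the identity.\<close>

lemma quotient_cyclic_cover:
  fixes K :: "'a::comm_ring_1 set" and V :: "'v set" and S :: "('r::comm_ring_1, 'z) ring_scheme"
  assumes K: "is_subring K" and N: "stable (mulops (polys K V)) N" "N \<subseteq> polys K V"
    and S: "is_subring (carrier S)" and \<psi>: "is_hom \<psi>" "\<psi> ` carrier S \<subseteq> polys K V"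
    and surj: "\<And>p. p \<in> polys K V \<Longrightarrow> \<exists>b\<in>carrier S. p - \<psi> b \<in> N"
  defines "\<pi> \<equiv> (\<lambda>b. N +>\<^bsub>mpoly_ring K V\<^esub> \<psi> b)"
  shows "cyclic_cover (hom_module (mpoly_ring K V Quot N) \<pi>) S \<pi>"
    and "module_cover.ker (hom_module (mpoly_ring K V Quot N) \<pi>) \<pi> (carrier S) = {b \<in> carrier S. \<psi> b \<in> N}"
proof -
  let ?P = "mpoly_ring K V"
  have car: "carrier ?P = polys K V" by (rule carrier_mpoly_ring[OF is_subringD(1)[OF K]])
  interpret I: ideal N ?P unfolding ideal_mpoly_ring_iff[OF K] using N by simp
  have co: "N +>\<^bsub>?P\<^esub> x = (\<lambda>h. h + x) ` N" for x by (simp add: a_r_coset_image)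
  have co_eq: "N +>\<^bsub>?P\<^esub> x = N +>\<^bsub>?P\<^esub> y" if "x - y \<in> N" for x y
  proof -
    have "N +>\<^bsub>?P\<^esub> x \<subseteq> N +>\<^bsub>?P\<^esub> y" if d: "x - y \<in> N" for x y
    proof
      fix z assume "z \<in> N +>\<^bsub>?P\<^esub> x"
      then obtain h where "h \<in> N" "z = h + x" by (auto simp: co)
      then have "h + (x - y) \<in> N" "z = (h + (x - y)) + y" using stableD(2)[OF N(1) _ d] by auto
      then show "z \<in> N +>\<^bsub>?P\<^esub> y" unfolding co by blast
    qed
    from this[OF that] this[of y x] show ?thesis using stableD(3)[OF N(1) that] by auto
  qed
  have mem: "x \<in> N +>\<^bsub>?P\<^esub> x" for x unfolding co using stableD(1)[OF N(1)] by (intro image_eqI[of _ _ 0]) auto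
  have \<psi>P: "\<psi> b \<in> carrier ?P" if "b \<in> carrier S" for b using \<psi>(2) car that by auto
  have N0: "N +>\<^bsub>?P\<^esub> 0 = N" by (simp add: co)
  let ?A = "hom_module (?P Quot N) \<pi>"
  interpret module_cover ?A S \<pi> "carrier S"
  proof
    show "stable (mulops (carrier S)) (carrier S)" by (rule stable_is_subring[OF S subset_refl])
    show "\<pi> ` carrier S = carrier ?A"
    proof (intro antisym subsetI)
      fix x assume "x \<in> \<pi> ` carrier S"
      then show "x \<in> carrier ?A" unfolding hom_module_def FactRing_def A_RCOSETS_def' \<pi>_def using \<psi>P by auto
    next
      fix x assume "x \<in> carrier ?A"
      then obtain p where p: "p \<in> polys K V" "x = N +>\<^bsub>?P\<^esub> p"
        by (auto simp: hom_module_def FactRing_def A_RCOSETS_def' car)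
      obtain b where "b \<in> carrier S" "p - \<psi> b \<in> N" using surj[OF p(1)] by blast
      then show "x \<in> \<pi> ` carrier S" unfolding p(2) \<pi>_def using co_eq by blast
    qed
    show "\<pi> 0 = \<zero>\<^bsub>?A\<^esub>" by (simp add: \<pi>_def hom_module_def FactRing_def is_homD[OF \<psi>(1)] N0)
    fix x y assume xy: "x \<in> carrier S" "y \<in> carrier S"
    show "\<pi> (x + y) = \<pi> x \<oplus>\<^bsub>?A\<^esub> \<pi> y"
      using ring_hom_add[OF I.rcos_ring_hom \<psi>P[OF xy(1)] \<psi>P[OF xy(2)]]
      by (simp add: \<pi>_def hom_module_def is_homD[OF \<psi>(1)])
    show "\<pi> (x * y) = x \<odot>\<^bsub>?A\<^esub> \<pi> y"
      using ring_hom_mult[OF I.rcos_ring_hom \<psi>P[OF xy(1)] \<psi>P[OF xy(2)]]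
      by (simp add: \<pi>_def hom_module_def is_homD[OF \<psi>(1)])
  qed
  show "cyclic_cover ?A S \<pi>" by (intro cyclic_cover.intro cyclic_cover_axioms.intro module_cover_axioms S)
  have "N +>\<^bsub>?P\<^esub> \<psi> b = N \<longleftrightarrow> \<psi> b \<in> N" for b
    using mem[of "\<psi> b"] co_eq[of "\<psi> b" 0] N0 by auto
  then show "ker = {b \<in> carrier S. \<psi> b \<in> N}"
    unfolding ker_def by (simp add: \<pi>_def hom_module_def FactRing_def)
qed

context reg_seq
begin

section \<open>Generators and relations of the symmetric algebra\<close>

definition relators :: "(('a \<Rightarrow>\<^sub>0 nat) \<Rightarrow>\<^sub>0 'a) set" where
  "relators = {mVar (x + y) - mVar x - mVar y | x y. x \<in> J (Suc d) \<and> y \<in> J (Suc d)} \<union>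
     {mVar (r * x) - mConst r * mVar x | r x. r \<in> R \<and> x \<in> J (Suc d)}"

definition Rel :: "(('a \<Rightarrow>\<^sub>0 nat) \<Rightarrow>\<^sub>0 'a) set" where
  "Rel = ideal_hull (polys R (J (Suc d))) relators"

abbreviation (input) polys_I where "polys_I \<equiv> polys R (J (Suc d))"

definition linear_form :: "(nat \<Rightarrow> 'a) \<Rightarrow> ((nat \<Rightarrow>\<^sub>0 nat) \<Rightarrow>\<^sub>0 'a)" where
  "linear_form a = (\<Sum>i\<in>{1..Suc d}. mConst (a i) * mVar i)"

text \<open>Meaningful only on the ideal generated by \<open>f 1, \<dots>, f (Suc d)\<close>.\<close>

definition coords :: "'a \<Rightarrow> nat \<Rightarrow> 'a" where
  "coords x = (SOME a. (\<forall>i. a i \<in> R) \<and> x = (\<Sum>i\<in>{1..Suc d}. a i * f i))"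

text \<open>\<open>coords\<close> is a choice and not linear, so the relators are sent into
  \<open>L (Suc d)\<close> rather than to 0; \<open>to_B\<close> and \<open>to_P\<close> are
  mutually inverse only modulo \<open>L (Suc d)\<close> and \<open>Rel\<close>.\<close>

definition to_B :: "(('a \<Rightarrow>\<^sub>0 nat) \<Rightarrow>\<^sub>0 'a) \<Rightarrow> ((nat \<Rightarrow>\<^sub>0 nat) \<Rightarrow>\<^sub>0 'a)" where
  "to_B = msubst (\<lambda>x. linear_form (coords x))"

definition to_P :: "((nat \<Rightarrow>\<^sub>0 nat) \<Rightarrow>\<^sub>0 'a) \<Rightarrow> (('a \<Rightarrow>\<^sub>0 nat) \<Rightarrow>\<^sub>0 'a)" where
  "to_P = msubst (\<lambda>i. mVar (f i))"

lemma is_hom_msubst: "is_hom (msubst \<sigma>)"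
  unfolding msubst_eq by (rule is_hom_evalh[OF is_hom_mConst])

lemma msubst_mConst: "msubst \<sigma> (mConst a) = mConst a"
proof -
  have "msubst \<sigma> (single 0 a) = mConst a"
    unfolding msubst_eq using evalh_single[OF is_hom_mConst, of \<sigma> 0 a] by simp
  then show ?thesis by (simp add: mConst_def)
qed

lemma msubst_mVar: "msubst \<sigma> (mVar v) = \<sigma> v"
  unfolding msubst_eq mVar_def by (subst evalh_single[OF is_hom_mConst]) simp

lemma coords:
  assumes "x \<in> J (Suc d)"
  shows "coords x i \<in> R" "(\<Sum>i\<in>{1..Suc d}. coords x i * f i) = x"
proof -
  have "\<exists>a. (\<forall>i. a i \<in> R) \<and> x = (\<Sum>i\<in>{1..Suc d}. a i * f i)" using assms by (auto simp: J_def)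
  from someI_ex[OF this] show "coords x i \<in> R" "(\<Sum>i\<in>{1..Suc d}. coords x i * f i) = x"
    unfolding coords_def by auto
qed

lemma linear_form_L:
  assumes "\<And>i. a i \<in> R" "(\<Sum>i\<in>{1..Suc d}. a i * f i) = 0"
  shows "linear_form a \<in> L (Suc d)"
proof -
  have "linear_form a \<in> lin (Suc d)" unfolding lin_def linear_form_def using assms by blast
  then show ?thesis unfolding L_def using hull_superset[OF is_subring_B] by blast
qed

lemma linear_form_add: "linear_form (\<lambda>i. a i + b i) = linear_form a + linear_form b"
  by (simp add: linear_form_def mConst_add distrib_right sum.distrib)

lemma linear_form_scale: "linear_form (\<lambda>i. r * a i) = mConst r * linear_form a"
  by (simp add: linear_form_def mConst_mult sum_distrib_left mult.assoc del: sum.cl_ivl_Suc)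

lemma linear_form_uminus: "linear_form (\<lambda>i. - a i) = - linear_form a"
  by (simp add: linear_form_def mConst_uminus sum_negf)

lemma linear_form_B: "(\<And>i. a i \<in> R) \<Longrightarrow> linear_form a \<in> B (Suc d)"
  unfolding linear_form_def B_def by (intro polys_sum polys_mult polys_mConst polys_mVar K_stable R) auto

text \<open>Two coordinate vectors of one element differ by a syzygy. This absorbs the arbitrary
  choices in \<open>coords\<close>.\<close>

lemma linear_form_eq_mod_L:
  assumes "\<And>i. a i \<in> R" "\<And>i. b i \<in> R" "(\<Sum>i\<in>{1..Suc d}. a i * f i) = (\<Sum>i\<in>{1..Suc d}. b i * f i)"
  shows "linear_form a - linear_form b \<in> L (Suc d)"
proof -
  have "linear_form (\<lambda>i. a i + - b i) \<in> L (Suc d)"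
  proof (rule linear_form_L)
    show "a i + - b i \<in> R" for i using assms(1,2) R by (intro is_subringD) auto
    show "(\<Sum>i\<in>{1..Suc d}. (a i + - b i) * f i) = 0"
      using assms(3) by (simp only: distrib_right sum.distrib minus_mult_left[symmetric] sum_negf) simp
  qed
  then show ?thesis using linear_form_add[of a "\<lambda>i. - b i"] by (simp add: linear_form_uminus)
qed

lemma to_P_hom: "is_hom to_P" and to_B_hom: "is_hom to_B"
  unfolding to_P_def to_B_def by (rule is_hom_msubst)+

lemmas to_simps = is_homD[OF to_P_hom] is_homD[OF to_B_hom]

lemma to_P_gen: "to_P (mConst a) = mConst a" "to_P (mVar i) = mVar (f i)"
  unfolding to_P_def by (rule msubst_mConst, rule msubst_mVar)

lemma to_B_gen: "to_B (mConst a) = mConst a" "to_B (mVar x) = linear_form (coords x)"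
  unfolding to_B_def by (rule msubst_mConst, rule msubst_mVar)

lemma is_subring_polys_I: "is_subring polys_I"
  by (rule is_subring_polys[OF R])

lemma to_B_B:
  assumes "p \<in> polys_I"
  shows "to_B p \<in> B (Suc d)"
  using R assms
proof (induction rule: polys_gen_induct)
  case (const a)
  then show ?case by (simp add: to_B_gen B_def polys_mConst K_stable)
next
  case (var x)
  then show ?case unfolding to_B_gen by (intro linear_form_B coords(1))
qed (simp_all add: to_simps is_subringD[OF is_subring_B])

lemma f_in_J_Suc: "i \<in> {1..Suc d} \<Longrightarrow> f i \<in> J (Suc d)"
  by (rule f_in_J)

lemma to_P_polys_I:
  assumes "b \<in> B (Suc d)"
  shows "to_P b \<in> polys_I"
  using R assms[unfolded B_def]
proof (induction rule: polys_gen_induct)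
  case (const a)
  then show ?case by (simp add: to_P_gen polys_mConst K_stable)
next
  case (var i)
  then show ?case unfolding to_P_gen by (intro polys_mVar R f_in_J_Suc)
qed (simp_all add: to_simps is_subringD[OF is_subring_polys_I])

lemma relators_subset: "relators \<subseteq> polys_I"
proof -
  note M = is_subringD[OF is_subring_polys_I]
  have "mVar x \<in> polys_I" if "x \<in> J (Suc d)" for x using that by (rule polys_mVar[OF R])
  moreover have "mConst r \<in> polys_I" if "r \<in> R" for r using that by (intro polys_mConst K_stable)
  ultimately show ?thesis unfolding relators_def
    using stableD(2)[OF J_stable] J_mult by (auto intro!: M)
qed

lemma Rel_stable: "stable (mulops polys_I) Rel"
  unfolding Rel_def by (rule stable_hull[OF is_subring_polys_I])

lemma Rel_subset: "Rel \<subseteq> polys_I"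
  unfolding Rel_def by (rule hull_least[OF stable_is_subring[OF is_subring_polys_I subset_refl] relators_subset])

lemma relators_Rel: "relators \<subseteq> Rel"
  unfolding Rel_def by (rule hull_superset[OF is_subring_polys_I])

lemma to_B_Rel: "p \<in> Rel \<Longrightarrow> to_B p \<in> L (Suc d)"
proof -
  let ?N = "{p \<in> polys_I. to_B p \<in> L (Suc d)}"
  note st = stableD[OF L_stable[of "Suc d"]] and M = is_subringD[OF is_subring_polys_I]
  have "stable (mulops polys_I) ?N"
    by (rule stable_mulopsI)
      (use st M stable_mulops_mult[OF L_stable to_B_B] in \<open>auto simp: to_simps\<close>)
  moreover have "relators \<subseteq> ?N"
  proof
    fix p assume p: "p \<in> relators"
    then consider x y where "x \<in> J (Suc d)" "y \<in> J (Suc d)" "p = mVar (x + y) - mVar x - mVar y"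
      | r x where "r \<in> R" "x \<in> J (Suc d)" "p = mVar (r * x) - mConst r * mVar x"
      by (auto simp: relators_def)
    then have "to_B p \<in> L (Suc d)"
    proof cases
      case 1
      have xy: "x + y \<in> J (Suc d)" using 1 stableD(2)[OF J_stable] by blast
      have "linear_form (coords (x + y)) - linear_form (\<lambda>i. coords x i + coords y i) \<in> L (Suc d)"
        using 1 xy coords R by (intro linear_form_eq_mod_L) (simp_all add: is_subringD distrib_right sum.distrib del: sum.cl_ivl_Suc)
      then show ?thesis by (simp add: 1 to_simps to_B_gen linear_form_add diff_diff_eq)
    next
      case 2
      have rx: "r * x \<in> J (Suc d)" using 2 J_mult by blast
      have "linear_form (coords (r * x)) - linear_form (\<lambda>i. r * coords x i) \<in> L (Suc d)"
        using 2 rx coords R by (intro linear_form_eq_mod_L)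
          (simp_all add: is_subringD mult.assoc sum_distrib_left[symmetric] del: sum.cl_ivl_Suc)
      then show ?thesis by (simp add: 2 to_simps to_B_gen linear_form_scale)
    qed
    then show "p \<in> ?N" using p relators_subset by auto
  qed
  ultimately have "Rel \<subseteq> ?N" unfolding Rel_def by (rule hull_least)
  then show "to_B p \<in> L (Suc d)" if "p \<in> Rel" using that by auto
qed

lemma to_B_to_P:
  assumes "b \<in> B (Suc d)"
  shows "to_B (to_P b) - b \<in> L (Suc d)"
  using R assms[unfolded B_def]
proof (induction rule: polys_gen_induct)
  case (const a)
  then show ?case by (simp add: to_P_gen to_B_gen stableD(1)[OF L_stable])
next
  case (var i)
  let ?a = "\<lambda>k. if k = i then 1 else 0 :: 'a"
  have i: "f i \<in> J (Suc d)" by (rule f_in_J_Suc[OF var])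
  have "linear_form ?a = (\<Sum>k\<in>{1..Suc d}. if k = i then mVar i else 0)"
    unfolding linear_form_def by (intro sum.cong) auto
  then have lfa: "linear_form ?a = mVar i" using var by (simp del: sum.cl_ivl_Suc)
  have "(\<Sum>k\<in>{1..Suc d}. ?a k * f k) = (\<Sum>k\<in>{1..Suc d}. if k = i then f i else 0)"
    by (intro sum.cong) auto
  then have fa: "(\<Sum>k\<in>{1..Suc d}. ?a k * f k) = f i" using var by (simp del: sum.cl_ivl_Suc)
  have "linear_form (coords (f i)) - linear_form ?a \<in> L (Suc d)"
    by (rule linear_form_eq_mod_L) (use coords[OF i] fa R in \<open>simp_all add: is_subringD del: sum.cl_ivl_Suc\<close>)
  then show ?case unfolding lfa to_P_gen to_B_gen .
next
  case (add F G)
  have eq: "to_B (to_P (F + G)) - (F + G) = (to_B (to_P F) - F) + (to_B (to_P G) - G)" by (simp add: to_simps)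
  show ?case unfolding eq by (rule stableD(2)[OF L_stable add(3,4)])
next
  case (mult F G)
  have "to_B (to_P (F * G)) - F * G = to_B (to_P F) * (to_B (to_P G) - G) + G * (to_B (to_P F) - F)"
    by (simp add: to_simps algebra_simps)
  moreover have "to_B (to_P F) \<in> B (Suc d)" "G \<in> B (Suc d)" 
    using mult(1,2) unfolding B_def[symmetric] by (auto intro!: to_B_B to_P_polys_I)
  ultimately show ?case
    using stableD(2)[OF L_stable stable_mulops_mult[OF L_stable _ mult(4)] stable_mulops_mult[OF L_stable _ mult(3)]] by simp
qed

text \<open>In the symmetric algebra the variable of a linear combination is that combination of
  variables. The index set is general so that terms can be added one by one.\<close>

lemma mVar_comb_Rel:
  assumes "T \<subseteq> {1..Suc d}" "\<And>i. a i \<in> R"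
  shows "mVar (\<Sum>i\<in>T. a i * f i) - (\<Sum>i\<in>T. mConst (a i) * mVar (f i)) \<in> Rel"
proof -
  have "finite T" using assms(1) by (rule finite_subset) simp
  then show ?thesis using assms(1)
  proof (induction T rule: finite_induct)
    case empty
    \<comment> \<open>This relator equals minus the variable named 0: the class of the zero element
      vanishes.\<close>
    have "mVar (0 + 0) - mVar 0 - mVar 0 \<in> relators"
      unfolding relators_def using stableD(1)[OF J_stable] by blast
    then have "- (mVar (0 + 0) - mVar 0 - mVar 0) \<in> Rel" using relators_Rel stableD(3)[OF Rel_stable] by blast
    then show ?case by simp
  next
    case (insert i T)
    let ?s = "\<Sum>i\<in>T. a i * f i"
    have fi: "f i \<in> J (Suc d)" using insert.prems by (intro f_in_J_Suc) auto
    have afi: "a i * f i \<in> J (Suc d)" using J_mult[OF assms(2) fi] .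
    have sJ: "?s \<in> J (Suc d)"
      by (rule stable_sum[OF J_stable], rule J_mult[OF assms(2)], rule f_in_J_Suc) (use insert.prems in auto)
    have 1: "mVar (a i * f i + ?s) - mVar (a i * f i) - mVar ?s \<in> Rel"
      using relators_Rel afi sJ unfolding relators_def by blast
    have 2: "mVar (a i * f i) - mConst (a i) * mVar (f i) \<in> Rel"
      using relators_Rel assms(2) fi unfolding relators_def by blast
    have 3: "mVar ?s - (\<Sum>i\<in>T. mConst (a i) * mVar (f i)) \<in> Rel" using insert by auto
    have "(mVar (a i * f i + ?s) - mVar (a i * f i) - mVar ?s) + ((mVar (a i * f i) - mConst (a i) * mVar (f i))
      + (mVar ?s - (\<Sum>i\<in>T. mConst (a i) * mVar (f i)))) \<in> Rel"
      by (rule stableD(2)[OF Rel_stable 1 stableD(2)[OF Rel_stable 2 3]])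
    then show ?case using insert.hyps by (simp add: algebra_simps)
  qed
qed

lemma to_P_linear_form: "to_P (linear_form a) = (\<Sum>i\<in>{1..Suc d}. mConst (a i) * mVar (f i))"
  unfolding linear_form_def is_hom_sum[OF to_P_hom] by (simp add: to_simps to_P_gen del: sum.cl_ivl_Suc)

lemma to_P_L:
  assumes "b \<in> L (Suc d)"
  shows "to_P b \<in> Rel"
proof -
  let ?N = "{b \<in> B (Suc d). to_P b \<in> Rel}"
  note st = stableD[OF Rel_stable] and M = is_subringD[OF is_subring_B[of "Suc d"]]
  have "stable (mulops (B (Suc d))) ?N"
    by (rule stable_mulopsI)
      (use st M stable_mulops_mult[OF Rel_stable to_P_polys_I] in \<open>auto simp: to_simps\<close>)
  moreover have "lin (Suc d) \<subseteq> ?N"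
  proof
    fix x assume x: "x \<in> lin (Suc d)"
    then obtain a where a: "x = linear_form a" "\<And>i. a i \<in> R" "(\<Sum>i\<in>{1..Suc d}. a i * f i) = 0"
      by (auto simp: lin_def linear_form_def)
    have m1: "mVar 0 - to_P x \<in> Rel"
      using mVar_comb_Rel[of "{1..Suc d}" a] a(2) unfolding a(3) a(1) to_P_linear_form by blast
    have m0: "mVar 0 \<in> Rel" using mVar_comb_Rel[of "{}" a] a(2) by simp
    have "to_P x \<in> Rel" using stableD(5)[OF Rel_stable m0 m1] by (simp only: diff_diff_eq2 add_diff_cancel_left')
    then show "x \<in> ?N" using x lin_subset_B by auto
  qed
  ultimately have "L (Suc d) \<subseteq> ?N" unfolding L_def by (rule hull_least)
  then show ?thesis using assms by auto
qed

text \<open>Identifies the symmetric algebra with B/L: a relation pulled back by \<open>to_B\<close>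
  falls into L, and the round trip changes b only by an element of L.\<close>

lemma to_P_Rel_iff:
  assumes "b \<in> B (Suc d)"
  shows "to_P b \<in> Rel \<longleftrightarrow> b \<in> L (Suc d)"
proof
  assume "to_P b \<in> Rel"
  then have "to_B (to_P b) - (to_B (to_P b) - b) \<in> L (Suc d)"
    by (intro stableD(5)[OF L_stable] to_B_Rel to_B_to_P assms)
  then show "b \<in> L (Suc d)" by simp
qed (rule to_P_L)

lemma to_P_surj:
  assumes "p \<in> polys_I"
  shows "p - to_P (to_B p) \<in> Rel"
  using R assms
proof (induction rule: polys_gen_induct)
  case (const a)
  then show ?case by (simp add: to_P_gen to_B_gen stableD(1)[OF Rel_stable])
next
  case (var x)
  then show ?case
    using mVar_comb_Rel[of "{1..Suc d}" "coords x"] coords[OF var] unfolding to_B_gen to_P_linear_form by simp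
next
  case (add F G)
  have eq: "F + G - to_P (to_B (F + G)) = (F - to_P (to_B F)) + (G - to_P (to_B G))" by (simp add: to_simps)
  show ?case unfolding eq by (rule stableD(2)[OF Rel_stable add(3,4)])
next
  case (mult F G)
  have "F * G - to_P (to_B (F * G)) = to_P (to_B F) * (G - to_P (to_B G)) + G * (F - to_P (to_B F))"
    by (simp add: to_simps algebra_simps)
  moreover have "to_P (to_B F) \<in> polys_I" using mult(1) by (intro to_P_polys_I to_B_B)
  ultimately show ?case
    using stableD(2)[OF Rel_stable stable_mulops_mult[OF Rel_stable _ mult(4)] stable_mulops_mult[OF Rel_stable mult(2) mult(3)]] by simp
qed

lemma sym_cover:
  fixes Rr :: "('a, 'c) ring_scheme"
  assumes Rr: "carrier Rr = R" "mult Rr = (*)" "add Rr = (+)"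
  shows "\<exists>\<pi>. cyclic_cover (sym_ideal_module Rr (J (Suc d)) f) (mpoly_ring R {1..Suc d}) \<pi> \<and>
    module_cover.ker (sym_ideal_module Rr (J (Suc d)) f) \<pi> (B (Suc d)) = L (Suc d)"
proof -
  let ?P = "mpoly_ring R (J (Suc d))" and ?S = "mpoly_ring R {1..Suc d}"
  have P: "sym_poly_ring Rr (ideal_module Rr (J (Suc d))) = ?P"
    by (simp add: sym_poly_ring_def ideal_module_def Rr)
  have rel: "sym_relations Rr (ideal_module Rr (J (Suc d))) = Rel"
    unfolding sym_relations_def P Rel_def relators_def[symmetric]
    using genideal_mpoly_ring[OF R relators_subset]
    by (simp add: ideal_module_def hom_module_def Rr relators_def)
  have S: "carrier ?S = B (Suc d)" unfolding B_def by (rule carrier_mpoly_ring[OF is_subringD(1)[OF R]])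
  define \<pi> where "\<pi> = (\<lambda>b. Rel +>\<^bsub>?P\<^esub> to_P b)"
  have A: "sym_ideal_module Rr (J (Suc d)) f = hom_module (?P Quot Rel) \<pi>"
    unfolding sym_ideal_module_def sym_algebra_def rel P \<pi>_def to_P_def ..
  note cover = quotient_cyclic_cover[OF R Rel_stable Rel_subset, of ?S to_P, folded \<pi>_def, unfolded S]
  have surj: "\<exists>b\<in>B (Suc d). p - to_P b \<in> Rel" if "p \<in> polys_I" for p
    using to_P_surj[OF that] to_B_B[OF that] by blast
  have "cyclic_cover (hom_module (?P Quot Rel) \<pi>) ?S \<pi>"
    by (rule cover(1)) (use is_subring_B to_P_hom to_P_polys_I surj in auto)
  moreover have "module_cover.ker (hom_module (?P Quot Rel) \<pi>) \<pi> (B (Suc d)) = {b \<in> B (Suc d). to_P b \<in> Rel}"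
    by (rule cover(2)) (use is_subring_B to_P_hom to_P_polys_I surj in auto)
  moreover have "\<dots> = L (Suc d)" using to_P_Rel_iff L_subset_B by auto
  ultimately show ?thesis unfolding A by blast
qed

end

text \<open>A polynomial is determined by its values at large integers, so the definite description
  has one candidate. Positivity of e makes D its true degree; otherwise the normalisation would
  refer to a lower coefficient.\<close>

lemma module_deg_eqI:
  assumes sum: "\<And>t. (\<Sum>i<t. module_length S (gr_component S I A i)) = enat (h t)"
    and ev: "evpoly D (int e) (\<lambda>t. int (h t))" and e: "e > 0"
  shows "module_deg S I A = e"
proof -
  \<comment> \<open>The definition sums up to and including t, so the relevant function is h at t +
    1, with the same leading term.\<close>
  have "evpoly D (int e) (\<lambda>t. int (h (Suc t)))" using ev evpoly_shift_iff[of D "int e" "\<lambda>t. int (h t)" 1] by simp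
  from evpoly_poly[OF this] obtain p :: "real poly" and N where p: "Polynomial.degree p \<le> D" "fact D * coeff p D = real e"
    "\<And>t. t \<ge> N \<Longrightarrow> real (h (Suc t)) = poly p (real t)" by auto
  have "coeff p D \<noteq> 0" using p(2) e by auto
  then have deg: "Polynomial.degree p = D" using p(1) le_degree[of p D] by simp
  have sum': "(\<Sum>i\<le>t. module_length S (gr_component S I A i)) = enat (h (Suc t))" for t
    using sum[of "Suc t"] by (simp only: lessThan_Suc_atMost)
  show ?thesis unfolding module_deg_def sum'
  proof (rule the_equality)
    show "\<exists>P. (\<exists>t0. \<forall>t\<ge>t0. \<exists>ha. enat (h (Suc t)) = enat ha \<and> real ha = poly P (real t)) \<and>
        real e = fact (Polynomial.degree P) * Polynomial.lead_coeff P"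
      by (intro exI[of _ p] conjI exI[of _ N]) (use p deg in auto)
  next
    fix e' assume "\<exists>P. (\<exists>t0. \<forall>t\<ge>t0. \<exists>ha. enat (h (Suc t)) = enat ha \<and> real ha = poly P (real t)) \<and>
        real e' = fact (Polynomial.degree P) * Polynomial.lead_coeff P"
    then obtain P t0 where P: "\<And>t. t \<ge> t0 \<Longrightarrow> real (h (Suc t)) = poly P (real t)"
      "real e' = fact (Polynomial.degree P) * Polynomial.lead_coeff P" by auto
    have "P = p" by (rule real_poly_eqI_eventually[of "max N t0"]) (simp add: P(1)[symmetric] p(3))
    then show "e' = e" using P(2) p(2) deg by simp
  qed
qed

lemma (in graded_reg_seq) module_deg_sym:
  fixes Rr :: "('a, 'c) ring_scheme"
  assumes Rr: "carrier Rr = R" "mult Rr = (*)" "add Rr = (+)"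
    and M: "\<And>i. ideal_pow (mpoly_ring R {1..Suc d}) M i = hiB (Suc d) i" and d: "d \<ge> 1"
  shows "enat (module_deg (mpoly_ring R {1..Suc d}) M (sym_ideal_module Rr (J (Suc d)) f)) =
    enat (\<Sum>j<d. n ^ j) + len (mulops R) (colon d) R"
proof -
  let ?S = "mpoly_ring R {1..Suc d}" and ?A = "sym_ideal_module Rr (J (Suc d)) f"
  have carS: "carrier ?S = B (Suc d)" unfolding B_def by (rule carrier_mpoly_ring[OF is_subringD(1)[OF R]])
  obtain \<pi> where "cyclic_cover ?A ?S \<pi>" and kerL: "module_cover.ker ?A \<pi> (B (Suc d)) = L (Suc d)"
    using sym_cover[OF Rr] by blast
  then interpret cyclic_cover ?A ?S \<pi> by blast
  have hi: "stable (mulops (B (Suc d))) (hiB (Suc d) i)" "hiB (Suc d) i \<subseteq> B (Suc d)" for i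
    unfolding hiB_def by (rule grading.stable_hi[OF grading_lift_cp is_subring_B], rule grading.hi_subset[OF grading_lift_cp])
  have Est: "stable (mulops (B (Suc d))) (E (Suc d) i)" for i
    unfolding E_def by (rule stable_set_sum[OF additive_mulops L_stable hi(1)])
  have sm: "ideal_smult ?S (hiB (Suc d) i) ?A = \<pi> ` E (Suc d) i" for i
    using ideal_smult_eq[of "hiB (Suc d) i"] hi[of i] unfolding carS kerL E_def by blast
  have EE: "E (Suc d) (Suc i) \<subseteq> E (Suc d) i" for i
    unfolding E_def hiB_def by (rule connected_grading.hi_sum_mono[OF cgB])
  have gr: "module_length ?S (gr_component ?S M ?A i) = len (mulops (B (Suc d))) (E (Suc d) (Suc i)) (E (Suc d) i)" for i
    unfolding gr_component_def M sm
    using quot_module_length[of "E (Suc d) i" "E (Suc d) (Suc i)"] Est E_subset L_subset_E EE unfolding carS kerL by blast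
  obtain cl h where h: "len (mulops R) (colon d) R = enat cl"
    "\<And>t. (\<Sum>i<t. len (mulops (B (Suc d))) (E (Suc d) (Suc i)) (E (Suc d) i)) = enat (h t)"
    "evpoly (Suc d) (int ((\<Sum>j<d. n ^ j) + cl)) (\<lambda>t. int (h t))" by (rule hilbert_sum) blast
  \<comment> \<open>The term j = 0 is 1 even when n = 0, which yields the positivity required by
    \<open>module_deg_eqI\<close>.\<close>
  have "(\<Sum>j<d. n ^ j) \<ge> n ^ 0" using d by (intro member_le_sum) auto
  then have "module_deg ?S M ?A = (\<Sum>j<d. n ^ j) + cl"
    using h(2,3) gr by (intro module_deg_eqI[where h = h and D = "Suc d"]) auto
  then show ?thesis by (simp add: h(1))
qed

section \<open>The multiplicity\<close>

text \<open>Orders add under multiplication and the generators have order 1, giving one inclusion.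
  Conversely, an element of order at least i + 1 is a sum of monomials of degree at least i + 1,
  from each of which one variable can be split off.\<close>

lemma ideal_pow_eq_hi:
  fixes V :: "'v set" and W :: "'w set"
  defines "X \<equiv> polys (UNIV :: 'k::comm_ring_1 set) V"
  defines "M \<equiv> genideal (mpoly_ring X W) (mConst ` mVar ` V \<union> mVar ` W)"
  shows "ideal_pow (mpoly_ring X W) M i = grading.hi (lift_cp (lift_cp trivial_cp)) (polys X W) i"
proof -
  interpret G0: grading "trivial_cp :: nat \<Rightarrow> 'k \<Rightarrow> 'k" by (rule grading_trivial_cp)
  interpret G1: grading "lift_cp trivial_cp :: nat \<Rightarrow> (('v \<Rightarrow>\<^sub>0 nat) \<Rightarrow>\<^sub>0 'k) \<Rightarrow> _" by (rule G0.grading_lift_cp)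
  interpret G: grading "lift_cp (lift_cp trivial_cp) :: nat \<Rightarrow> (('w \<Rightarrow>\<^sub>0 nat) \<Rightarrow>\<^sub>0 (('v \<Rightarrow>\<^sub>0 nat) \<Rightarrow>\<^sub>0 'k)) \<Rightarrow> _" by (rule G1.grading_lift_cp)
  have X: "is_subring X" unfolding X_def by (rule is_subring_polys) simp
  note XW = is_subring_polys[OF X, of W]
  have car: "carrier (mpoly_ring X W) = polys X W" by (rule carrier_mpoly_ring[OF is_subringD(1)[OF X]])
  let ?G = "mConst ` mVar ` V \<union> mVar ` W"
  have GX: "?G \<subseteq> polys X W"
    using X by (auto simp: X_def intro!: polys_mConst polys_mVar is_subring_stable)
  have M: "M = ideal_hull (polys X W) ?G" unfolding M_def by (rule genideal_mpoly_ring[OF X GX])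
  have GM: "?G \<subseteq> M" unfolding M by (rule hull_superset[OF XW])
  have M1: "M \<subseteq> G.hi (polys X W) 1"
    unfolding M
  proof (rule hull_least[OF G.stable_hi[OF XW]])
    have "lift_cp trivial_cp 0 (mVar v) = (0 :: ('v \<Rightarrow>\<^sub>0 nat) \<Rightarrow>\<^sub>0 'k)" for v by (simp add: mVar_def G0.lift_cp_single)
    moreover have "lift_cp (lift_cp trivial_cp) 0 (mVar w) = (0 :: ('w \<Rightarrow>\<^sub>0 nat) \<Rightarrow>\<^sub>0 (('v \<Rightarrow>\<^sub>0 nat) \<Rightarrow>\<^sub>0 'k))" for w
      by (simp add: mVar_def G1.lift_cp_single)
    ultimately show "?G \<subseteq> G.hi (polys X W) 1"
      using GX by (auto simp: G.hi_def G1.lift_cp_mConst)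
  qed
  have sX: "single k c \<in> X" if "keys k \<subseteq> V" for k and c :: 'k
    unfolding X_def using that by (intro polys_single is_subring_stable) auto
  have monomial: "single a (single k c) \<in> G.hi (polys X W) i"
    if "keys a \<subseteq> W" "keys k \<subseteq> V" "i \<le> edeg a + edeg k" for a k i and c :: 'k
  proof -
    have "single a (single k c) \<in> polys X W" using that sX by (intro polys_single is_subring_stable X) auto
    moreover have "lift_cp (lift_cp trivial_cp) u (single a (single k c)) = 0" if "u < i" for u
      using that \<open>i \<le> edeg a + edeg k\<close> by (auto simp: G1.lift_cp_single G0.lift_cp_single)
    ultimately show ?thesis by (simp add: G.hi_def)
  qed
  show ?thesis
  proof (induction i)
    case 0
    then show ?case by (simp add: car)
  next
    case (Suc i)
    let ?P = "ideal_prod (mpoly_ring X W) M (G.hi (polys X W) i)"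
    have zero: "0 \<in> ?P"
      using ideal_prod.prod[of 0 M 0 "G.hi (polys X W) i" "mpoly_ring X W"] stableD(1)[OF stable_hull[OF XW]]
        stableD(1)[OF G.stable_hi[OF XW]] by (simp add: M)
    have sum: "(\<Sum>t\<in>T. g t) \<in> ?P" if "\<And>t. t \<in> T \<Longrightarrow> g t \<in> ?P" for T :: "'t set" and g
      using that
    proof (induction T rule: infinite_finite_induct)
      case (insert t T)
      then show ?case using ideal_prod.sum[of "g t" "mpoly_ring X W" M "G.hi (polys X W) i" "\<Sum>t\<in>T. g t"] by simp
    qed (simp_all add: zero)
    \<comment> \<open>The split-off variable is a T if the T-exponent a is nonzero, and otherwise an
      x from the coefficient.\<close>
    have monomial_mem: "single a (single k c) \<in> ?P" if ak: "keys a \<subseteq> W" "keys k \<subseteq> V" "Suc i \<le> edeg a + edeg k" for a k and c :: 'k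
    proof (cases "a = 0")
      case False
      then have "edeg a \<noteq> 0" by simp
      then obtain w where w: "w \<in> keys a" unfolding edeg_def by fastforce
      obtain a' where a': "a = a' + single w 1" "keys a' \<subseteq> keys a" by (rule exponent_pred[OF w])
      have "mVar w \<otimes>\<^bsub>mpoly_ring X W\<^esub> single a' (single k c) \<in> ?P"
      proof (rule ideal_prod.prod)
        show "mVar w \<in> M" using GM w ak(1) by blast
        show "single a' (single k c) \<in> G.hi (polys X W) i"
          by (rule monomial) (use a' ak in \<open>auto simp: edeg_add\<close>)
      qed
      then show ?thesis by (simp add: mVar_def mult_single a'(1) add.commute)
    next
      case True
      then have "edeg k \<noteq> 0" using ak(3) by (metis edeg_zero add_0 not_less_eq_eq zero_le)
      then obtain v where v: "v \<in> keys k" unfolding edeg_def by fastforce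
      obtain k' where k': "k = k' + single v 1" "keys k' \<subseteq> keys k" by (rule exponent_pred[OF v])
      have "mConst (mVar v) \<otimes>\<^bsub>mpoly_ring X W\<^esub> single a (single k' c) \<in> ?P"
      proof (rule ideal_prod.prod)
        show "mConst (mVar v) \<in> M" using GM v ak(2) by blast
        show "single a (single k' c) \<in> G.hi (polys X W) i"
          by (rule monomial) (use k' ak in \<open>auto simp: edeg_add\<close>)
      qed
      then show ?thesis by (simp add: mVar_def mConst_def mult_single k'(1) add.commute)
    qed
    have "G.hi (polys X W) (Suc i) \<subseteq> ?P"
    proof
      fix F assume F: "F \<in> G.hi (polys X W) (Suc i)"
      have "single a (lookup F a) \<in> ?P" if a: "a \<in> keys F" for a
      proof -
        have aW: "keys a \<subseteq> W" and aX: "lookup F a \<in> X" using F a by (auto simp: G.hi_def polys_def in_keys_iff)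
        have "single a (single k (lookup (lookup F a) k)) \<in> ?P" if k: "k \<in> keys (lookup F a)" for k
        proof (rule monomial_mem[OF aW])
          show "keys k \<subseteq> V" using aX k by (simp add: X_def polys_def in_keys_iff)
          show "Suc i \<le> edeg a + edeg k"
          proof (rule ccontr)
            assume "\<not> Suc i \<le> edeg a + edeg k"
            then have "lift_cp (lift_cp trivial_cp) (edeg a + edeg k) F = 0" using F by (simp add: G.hi_def)
            then have "lookup (lookup (lift_cp (lift_cp trivial_cp) (edeg a + edeg k) F) a) k = 0" by simp
            then show False using k by (simp add: G1.lookup_lift_cp G0.lookup_lift_cp trivial_cp_def in_keys_iff)
          qed
        qed
        then have "single a (\<Sum>k\<in>keys (lookup F a). single k (lookup (lookup F a) k)) \<in> ?P"
          unfolding single_sum by (rule sum)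
        then show ?thesis unfolding poly_mapping_sum_single[symmetric] .
      qed
      then have "(\<Sum>a\<in>keys F. single a (lookup F a)) \<in> ?P" by (rule sum)
      then show "F \<in> ?P" unfolding poly_mapping_sum_single[symmetric] .
    qed
    moreover have "?P \<subseteq> G.hi (polys X W) (Suc i)"
    proof
      fix F assume "F \<in> ?P"
      then show "F \<in> G.hi (polys X W) (Suc i)"
      proof induction
        case (prod x y)
        then show ?case using G.hi_mult[OF XW, of x 1 y i] M1 by auto
      next
        case (sum x y)
        then show ?case using stableD(2)[OF G.stable_hi[OF XW]] by simp
      qed
    qed
    ultimately show ?case using Suc by auto
  qed
qed

lemma len_field: "len (mulops UNIV) {0} (UNIV :: 'k::field set) = 1"
proof (rule antisym)
  have triv: "N = {0} \<or> N = UNIV" if N: "stable (mulops UNIV) N" for N :: "'k set"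
  proof (cases "N = {0}")
    case False
    then obtain x where x: "x \<in> N" "x \<noteq> 0" using stableD(1)[OF N] by blast
    have "y \<in> N" for y using stable_mulops_mult[OF N _ x(1), of "y / x"] x(2) by simp
    then show ?thesis by auto
  qed simp
  show "len (mulops UNIV) {0} (UNIV :: 'k set) \<le> 1"
    unfolding len_def
  proof (rule chain_len_least, rule ccontr)
    fix l and N :: "nat \<Rightarrow> 'k set"
    assume N: "\<And>i. i \<le> l \<Longrightarrow> stable (mulops UNIV) (N i) \<and> {0} \<subseteq> N i \<and> N i \<subseteq> UNIV"
      "\<And>i. i < l \<Longrightarrow> N i \<subset> N (Suc i)" and "\<not> enat l \<le> 1"
    then have l: "2 \<le> l" by (simp add: one_enat_def)
    have "N 0 \<subset> N 1" "N 1 \<subset> N 2" using N(2)[of 0] N(2)[of 1] l by (auto simp: numeral_2_eq_2)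
    then show False using triv[of "N 0"] triv[of "N 1"] triv[of "N 2"] N(1)[of 0] N(1)[of 1] N(1)[of 2] l by auto
  qed
  have ne: "{0} \<noteq> (UNIV :: 'k set)" by (metis UNIV_I singletonD zero_neq_one)
  have "enat 1 \<le> len (mulops UNIV) {0} (UNIV :: 'k set)" unfolding len_def
    by (rule chain_len_upper[where N = "\<lambda>i. if i = 0 then {0} else UNIV"])
      (use ne in \<open>auto intro!: stable_mulopsI\<close>)
  then show "1 \<le> len (mulops UNIV) {0} (UNIV :: 'k set)" by (simp add: one_enat_def)
qed

text \<open>The number of monomials of degree less than u in d variables, in the shape in which
  \<open>len_polys\<close> produces it and \<open>evpoly_expos\<close> consumes it.\<close>

definition hilbert_poly_ring :: "nat \<Rightarrow> nat \<Rightarrow> nat" where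
  "hilbert_poly_ring d u = (\<Sum>m\<in>expos {1..d} u. if u - edeg m = 0 then 0 else 1)"

lemma evpoly_hilbert_poly_ring: "evpoly d 1 (\<lambda>u. int (hilbert_poly_ring d u))"
proof -
  have "evpoly 0 1 (\<lambda>u. if u = 0 then 0 else 1)" by (auto intro: exI[of _ 1])
  from evpoly_expos[OF this, of d] show ?thesis
    by (simp add: hilbert_poly_ring_def of_nat_sum if_distrib cong: if_cong)
qed

lemma connected_grading_trivial_cp: "connected_grading trivial_cp UNIV (UNIV :: 'k::comm_ring_1 set)"
  by (intro connected_grading.intro connected_grading_axioms.intro grading_trivial_cp) auto

lemma len_poly_ring:
  fixes d :: nat
  defines "X \<equiv> polys (UNIV :: 'k::field set) {1..d}"
  shows "len (mulops (mConst ` UNIV)) (grading.hi (lift_cp trivial_cp) X u) X = enat (hilbert_poly_ring d u)"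
proof -
  interpret G0: connected_grading trivial_cp UNIV "UNIV :: 'k set" by (rule connected_grading_trivial_cp)
  have hi: "G0.hi UNIV v = (if v = 0 then UNIV else {0})" for v by (auto simp: G0.hi_def trivial_cp_def)
  have "len (mulops (mConst ` UNIV)) (grading.hi (lift_cp trivial_cp) X u) X =
    (\<Sum>m\<in>expos {1..d} u. len (mulops UNIV) (G0.hi UNIV (u - edeg m)) UNIV)"
    unfolding X_def G0.hi_polys by (rule len_polys) (auto intro: G0.stable_hi)
  also have "\<dots> = (\<Sum>m\<in>expos {1..d} u. enat (if u - edeg m = 0 then 0 else 1))"
    by (rule sum.cong) (auto simp: hi len_field zero_enat_def one_enat_def)
  finally show ?thesis by (simp only: sum_enat hilbert_poly_ring_def)
qed

lemma is_form_lift_cp: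
  assumes "is_form n p"
  shows "lift_cp trivial_cp n p = p"
proof (rule poly_mapping_eqI)
  fix m
  have "edeg m = n" if "lookup p m \<noteq> 0"
    using assms that by (auto simp: is_form_def edeg_def in_keys_iff)
  then show "lookup (lift_cp trivial_cp n p) m = lookup p m"
    by (cases "lookup p m = 0") (auto simp: grading.lookup_lift_cp[OF grading_trivial_cp] trivial_cp_def)
qed

lemma (in reg_seq) ideal_hull_eq_J: "ideal_hull R (f ` {1..j}) = J j"
proof (rule antisym)
  show "ideal_hull R (f ` {1..j}) \<subseteq> J j" by (rule hull_least[OF J_stable]) (auto intro!: f_in_J)
  note st = stable_hull[OF R, of "f ` {1..j}"]
  show "J j \<subseteq> ideal_hull R (f ` {1..j})"
  proof
    fix x assume "x \<in> J j"
    then obtain a where a: "x = (\<Sum>i\<in>{1..j}. a i * f i)" "\<forall>i. a i \<in> R" by (auto simp: J_def)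
    show "x \<in> ideal_hull R (f ` {1..j})" unfolding a(1)
      by (rule stable_sum[OF st], rule stable_mulops_mult[OF st])
        (use a(2) hull_superset[OF R, of "f ` {1..j}"] in auto)
  qed
qed

theorem theorem3p20:
  fixes f :: "nat \<Rightarrow> ((nat \<Rightarrow>\<^sub>0 nat) \<Rightarrow>\<^sub>0 'k::field)"
    and d n :: nat and R B \<M> I J
  defines "R \<equiv> mpoly_ring (UNIV :: 'k set) {1..d}"
    and "B \<equiv> mpoly_ring (carrier R) {1..d+1}"
    and "\<M> \<equiv> genideal B (mConst ` mVar ` {1..d} \<union> mVar ` {1..d+1})"
    and "I \<equiv> genideal R (f ` {1..d+1})"
    and "J \<equiv> genideal R (f ` {1..d})"
  assumes "d \<ge> 1"
    and "\<And>i. i \<in> {1..d+1} \<Longrightarrow> f i \<in> carrier R"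
    and "\<And>i. i \<in> {1..d+1} \<Longrightarrow> is_form n (f i)"
    and "regular_sequence R (map f [1..<d+1])"
  shows "enat (module_deg B \<M> (sym_ideal_module R I f)) =
     enat (\<Sum>j = 0..d-1. n ^ j) +
     module_length R (hom_module (R Quot (colon_ideal R J I)) (\<lambda>r. colon_ideal R J I +>\<^bsub>R\<^esub> r))"
proof -
  define X where "X = polys (UNIV :: 'k set) {1..d}"
  have car: "carrier R = X" unfolding R_def X_def by (rule carrier_mpoly_ring) simp
  have mult: "mult R = (*)" by (simp add: R_def)
  have X: "is_subring X" unfolding X_def by (rule is_subring_polys) simp
  have fX: "f i \<in> X" if "i \<in> {1..Suc d}" for i using assms(7)[of i] that by (simp add: car)
  have gen: "genideal R (f ` {1..j}) = {\<Sum>i\<in>{1..j}. a i * f i | a. \<forall>i. a i \<in> X}" if "j \<le> Suc d" for j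
  proof -
    \<comment> \<open>With length 0 the regularity assumption is void; this gives the description of
      generated ideals from which regularity is then derived.\<close>
    interpret zero: reg_seq X f 0 by unfold_locales (use X fX in auto)
    have "f ` {1..j} \<subseteq> polys UNIV {1..d}" using fX that unfolding X_def by auto
    then have "genideal R (f ` {1..j}) = ideal_hull X (f ` {1..j})"
      unfolding R_def X_def by (intro genideal_mpoly_ring) auto
    then show ?thesis unfolding zero.ideal_hull_eq_J zero.J_def .
  qed
  have reg: "\<exists>a. (\<forall>i. a i \<in> X) \<and> r = (\<Sum>i\<in>{1..j}. a i * f i)"
    if j: "j < d" and r: "r \<in> X" and ex: "\<exists>a. (\<forall>i. a i \<in> X) \<and> r * f (Suc j) = (\<Sum>i\<in>{1..j}. a i * f i)" for j r
  proof -
    have g: "genideal R (f ` {1..j}) = {\<Sum>i\<in>{1..j}. a i * f i | a. \<forall>i. a i \<in> X}"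
      by (rule gen) (use j in simp)
    \<comment> \<open>The list counts from 0 and the forms from 1: entry j is
      \<open>f (Suc j)\<close>, and the entries before it are \<open>f 1\<close>, ...,
      \<open>f j\<close>.\<close>
    have "take j [1..<d + 1] = [1..<1 + j]" using j by (intro take_upt) simp
    then have tk: "set (take j (map f [1..<d + 1])) = f ` {1..j}" by (auto simp: take_map)
    have nth: "map f [1..<d + 1] ! j = f (Suc j)" using j by (simp del: upt_Suc)
    have "f (Suc j) \<otimes>\<^bsub>R\<^esub> r \<in> genideal R (f ` {1..j}) \<longrightarrow> r \<in> genideal R (f ` {1..j})"
    proof -
      have "\<forall>i < length (map f [1..<d + 1]). \<forall>r \<in> carrier R. (map f [1..<d + 1] ! i) \<otimes>\<^bsub>R\<^esub> r
          \<in> genideal R (set (take i (map f [1..<d + 1]))) \<longrightarrow> r \<in> genideal R (set (take i (map f [1..<d + 1])))"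
        using assms(9) unfolding regular_sequence_def by blast
      from this[rule_format, of j r] show ?thesis unfolding tk nth car using j r by simp
    qed
    moreover have "f (Suc j) \<otimes>\<^bsub>R\<^esub> r \<in> genideal R (f ` {1..j})"
    proof -
      have fr: "f (Suc j) \<otimes>\<^bsub>R\<^esub> r = r * f (Suc j)" by (simp add: R_def mult.commute)
      show ?thesis unfolding g fr using ex by blast
    qed
    ultimately have "r \<in> genideal R (f ` {1..j})" by blast
    then show ?thesis unfolding g by blast
  qed
  have cg: "connected_grading (lift_cp trivial_cp) X (mConst ` UNIV)"
    unfolding X_def by (rule connected_grading.connected_grading_polys[OF connected_grading_trivial_cp])
  interpret G: graded_reg_seq X f d "lift_cp trivial_cp" "mConst ` UNIV" n "hilbert_poly_ring d"
  proof (intro graded_reg_seq.intro graded_reg_seq_axioms.intro cg)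
    show "reg_seq X f d" by unfold_locales (use X fX reg in blast)+
    show "lift_cp trivial_cp n (f i) = f i" if "i \<in> {1..Suc d}" for i
      using assms(8)[of i] that by (intro is_form_lift_cp) simp
    show "len (mulops (mConst ` UNIV)) (grading.hi (lift_cp trivial_cp) X u) X = enat (hilbert_poly_ring d u)" for u
      unfolding X_def by (rule len_poly_ring)
    show "evpoly d 1 (\<lambda>u. int (hilbert_poly_ring d u))" by (rule evpoly_hilbert_poly_ring)
  qed
  have J: "J = G.J d" and I: "I = G.J (Suc d)"
    using gen[of d] gen[of "Suc d"] unfolding J_def I_def G.J_def by simp_all
  have B: "B = mpoly_ring X {1..Suc d}" unfolding B_def car by simp
  have colon: "colon_ideal R J I = G.colon d"
  proof (intro antisym subsetI)
    fix r assume "r \<in> colon_ideal R J I"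
    then show "r \<in> G.colon d"
      using G.f_in_J[of "Suc d" "Suc d"] by (auto simp: colon_ideal_def G.colon_def car I J mult)
  next
    fix r assume r: "r \<in> G.colon d"
    then have rX: "r \<in> X" "r * f (Suc d) \<in> G.J d" by (auto simp: G.colon_def)
    \<comment> \<open>An element of I is one of J plus a multiple of the last form, so testing the
      last form suffices for membership in J : I.\<close>
    have "r * a \<in> G.J d" if a: "a \<in> G.J (Suc d)" for a
    proof -
      obtain y b where yb: "a = y + b * f (Suc d)" "y \<in> G.J d" "b \<in> X" using a by (auto simp: G.J_Suc)
      have "r * y + b * (r * f (Suc d)) \<in> G.J d"
        by (rule stableD(2)[OF G.J_stable G.J_mult[OF rX(1) yb(2)] G.J_mult[OF yb(3) rX(2)]])
      then show ?thesis by (simp add: yb(1) algebra_simps)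
    qed
    then show "r \<in> colon_ideal R J I" using rX by (simp add: colon_ideal_def car I J mult)
  qed
  have "module_length R (hom_module (R Quot G.colon d) (\<lambda>r. G.colon d +>\<^bsub>R\<^esub> r)) = len (mulops X) (G.colon d) X"
  proof -
    have *: "is_subring (UNIV :: 'k set)" "stable (mulops (polys (UNIV :: 'k set) {1..d})) (G.colon d)"
      "G.colon d \<subseteq> polys UNIV {1..d}" "is_subring (carrier R)" "is_hom (\<lambda>r :: (nat \<Rightarrow>\<^sub>0 nat) \<Rightarrow>\<^sub>0 'k. r)"
      "(\<lambda>r. r) ` carrier R \<subseteq> polys (UNIV :: 'k set) {1..d}"
      unfolding X_def[symmetric] car using G.colon_stable G.colon_subset X by (simp_all add: is_hom_def)
    have **: "\<exists>b\<in>carrier R. p - b \<in> G.colon d" if "p \<in> polys (UNIV :: 'k set) {1..d}" for p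
      using that stableD(1)[OF G.colon_stable] unfolding X_def[symmetric] car by (intro bexI[of _ p]) simp_all
    note cover = quotient_cyclic_cover[OF * **, folded R_def]
    interpret C: cyclic_cover "hom_module (R Quot G.colon d) (\<lambda>r. G.colon d +>\<^bsub>R\<^esub> r)" R "\<lambda>r. G.colon d +>\<^bsub>R\<^esub> r"
      by (rule cover(1))
    have "C.ker = G.colon d" using cover(2) G.colon_subset[of d] by (auto simp: car)
    then show ?thesis using C.module_length_eq by (simp add: car)
  qed
  moreover have "enat (module_deg B \<M> (sym_ideal_module R (G.J (Suc d)) f)) =
      enat (\<Sum>j<d. n ^ j) + len (mulops X) (G.colon d) X"
    unfolding B
  proof (rule G.module_deg_sym)
    show "ideal_pow (mpoly_ring X {1..Suc d}) \<M> i = G.hiB (Suc d) i" for i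
      unfolding \<M>_def B G.hiB_def G.B_def unfolding X_def
      using ideal_pow_eq_hi[of "{1..d}" "{1..Suc d}" i] by simp
  qed (use \<open>d \<ge> 1\<close> car in \<open>simp_all add: R_def\<close>)
  moreover have "(\<Sum>j<d. n ^ j) = (\<Sum>j = 0..d-1. n ^ j)"
    using \<open>d \<ge> 1\<close> by (intro sum.cong) auto
  ultimately show ?thesis unfolding colon unfolding I by simp
qed

end
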